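(* If $\lambda$ is an exacting cardinal, then $\lambda$ is a regular cardinal in $\mathrm{HOD}_{V_\lambda}$, and therefore $\mathrm{HOD}_{V_\lambda}\neq V$.
   Context: Work in $\mathsf{ZFC}$. For a class $\Gamma$, $\mathrm{OD}_\Gamma$ is the class of sets definable from parameters in $\Gamma\cup\mathrm{Ord}$, and $\mathrm{HOD}_\Gamma$ is the class of sets $x$ with $\mathrm{tc}(\{x\})\subseteq\mathrm{OD}_\Gamma$. A cardinal $\lambda$ is exacting if for every ordinal $\zeta>\lambda$ there exist an elementary submodel $X\prec V_\zeta$ with $V_\lambda\cup\{\lambda\}\subseteq X$ and an elementary embedding $j\colon X\to V_\zeta$ with $j(\lambda)=\lambda$ and $j\restriction\lambda\neq\mathrm{id}_\lambda$. *)

theory Defs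
  imports Main
begin

text \<open>
  "Work in ZFC" is rendered by an arbitrary model of first-order ZFC: a type \<^typ>\<open>'a\<close> of sets with a
  binary relation \<open>E\<close>, read as membership, that satisfies the ZFC axioms. By the completeness
  theorem, a sentence is a theorem of ZFC iff it holds in all such models. The relation need not be
  well-founded in the metatheory and its natural numbers may be nonstandard. Hence every notion below
  (ordinals, \<open>V\<^sub>\<alpha>\<close>, formulas, satisfaction, definability, ...) is the internal one of the model, written
  out with quantifiers over the elements of the model. Subsets of the type play the role of classes.
\<close>

section \<open>First-order formulas of the metatheory and the axioms of ZFC\<close>

datatype fm = FMem nat nat | FEq nat nat | FNeg fm | FConj fm fm | FEx nat fm

primrec sat :: "('a \<Rightarrow> 'a \<Rightarrow> bool) \<Rightarrow> fm \<Rightarrow> (nat \<Rightarrow> 'a) \<Rightarrow> bool" where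
  "sat E (FMem i j) e = E (e i) (e j)"
| "sat E (FEq i j) e = (e i = e j)"
| "sat E (FNeg p) e = (\<not> sat E p e)"
| "sat E (FConj p q) e = (sat E p e \<and> sat E q e)"
| "sat E (FEx i p) e = (\<exists>x. sat E p (e(i := x)))"

text \<open>In the two schemas, the values of \<open>e\<close> at the remaining variables are the parameters.\<close>

locale ZFC =
  fixes E :: "'a \<Rightarrow> 'a \<Rightarrow> bool"  (infix "\<^bold>\<in>" 50)
  assumes extensionality: "(\<And>z. z \<^bold>\<in> x \<longleftrightarrow> z \<^bold>\<in> y) \<Longrightarrow> x = y"
    and foundation: "\<exists>y. y \<^bold>\<in> x \<Longrightarrow> \<exists>y. y \<^bold>\<in> x \<and> \<not> (\<exists>z. z \<^bold>\<in> y \<and> z \<^bold>\<in> x)"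
    and pairing: "\<exists>z. \<forall>w. w \<^bold>\<in> z \<longleftrightarrow> w = x \<or> w = y"
    and union: "\<exists>u. \<forall>w. w \<^bold>\<in> u \<longleftrightarrow> (\<exists>y. y \<^bold>\<in> x \<and> w \<^bold>\<in> y)"
    and power_set: "\<exists>p. \<forall>w. w \<^bold>\<in> p \<longleftrightarrow> (\<forall>z. z \<^bold>\<in> w \<longrightarrow> z \<^bold>\<in> x)"
    and infinity: "\<exists>x. (\<exists>z. z \<^bold>\<in> x \<and> (\<forall>w. \<not> w \<^bold>\<in> z)) \<and>
                     (\<forall>y. y \<^bold>\<in> x \<longrightarrow> (\<exists>z. z \<^bold>\<in> x \<and> (\<forall>w. w \<^bold>\<in> z \<longleftrightarrow> w \<^bold>\<in> y \<or> w = y)))"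
    and separation: "\<exists>b. \<forall>x. x \<^bold>\<in> b \<longleftrightarrow> x \<^bold>\<in> a \<and> sat E p (e(0 := x))"
    and replacement: "(\<And>x. x \<^bold>\<in> a \<Longrightarrow> \<exists>!y. sat E p (e(0 := x, 1 := y))) \<Longrightarrow>
                     \<exists>b. \<forall>x. x \<^bold>\<in> a \<longrightarrow> (\<exists>y. y \<^bold>\<in> b \<and> sat E p (e(0 := x, 1 := y)))"
    and choice: "(\<And>x. x \<^bold>\<in> a \<Longrightarrow> \<exists>z. z \<^bold>\<in> x) \<Longrightarrow>
                 (\<And>x y z. x \<^bold>\<in> a \<Longrightarrow> y \<^bold>\<in> a \<Longrightarrow> z \<^bold>\<in> x \<Longrightarrow> z \<^bold>\<in> y \<Longrightarrow> x = y) \<Longrightarrow>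
                 \<exists>c. \<forall>x. x \<^bold>\<in> a \<longrightarrow> (\<exists>!z. z \<^bold>\<in> x \<and> z \<^bold>\<in> c)"

context
  fixes E :: "'a \<Rightarrow> 'a \<Rightarrow> bool"  (infix "\<^bold>\<in>" 50)
begin

section \<open>Notions relativized to a class\<close>

text \<open>
  All quantifiers of these definitions range over the class \<open>C\<close>: "\<open>C\<close> satisfies that ...". The
  absolute notions are obtained for \<open>C = UNIV\<close>. Ordered pairs are Kuratowski pairs and functions are
  sets of ordered pairs.
\<close>

definition is_upair :: "'a set \<Rightarrow> 'a \<Rightarrow> 'a \<Rightarrow> 'a \<Rightarrow> bool" where
  "is_upair C x y z \<longleftrightarrow> (\<forall>w\<in>C. w \<^bold>\<in> z \<longleftrightarrow> w = x \<or> w = y)"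

definition is_opair :: "'a set \<Rightarrow> 'a \<Rightarrow> 'a \<Rightarrow> 'a \<Rightarrow> bool" where
  "is_opair C x y z \<longleftrightarrow> (\<exists>a\<in>C. \<exists>b\<in>C. is_upair C x x a \<and> is_upair C x y b \<and> is_upair C a b z)"

definition maps_to :: "'a set \<Rightarrow> 'a \<Rightarrow> 'a \<Rightarrow> 'a \<Rightarrow> bool" where
  "maps_to C f x y \<longleftrightarrow> (\<exists>z\<in>C. is_opair C x y z \<and> z \<^bold>\<in> f)"

definition is_fun :: "'a set \<Rightarrow> 'a \<Rightarrow> 'a \<Rightarrow> 'a \<Rightarrow> bool" where
  "is_fun C f a b \<longleftrightarrow>
     (\<forall>z\<in>C. z \<^bold>\<in> f \<longrightarrow> (\<exists>x\<in>C. \<exists>y\<in>C. x \<^bold>\<in> a \<and> y \<^bold>\<in> b \<and> is_opair C x y z)) \<and>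
     (\<forall>x\<in>C. x \<^bold>\<in> a \<longrightarrow> (\<exists>!y. y \<in> C \<and> maps_to C f x y))"

definition is_bij :: "'a set \<Rightarrow> 'a \<Rightarrow> 'a \<Rightarrow> 'a \<Rightarrow> bool" where
  "is_bij C f a b \<longleftrightarrow> is_fun C f a b \<and>
     (\<forall>y\<in>C. y \<^bold>\<in> b \<longrightarrow> (\<exists>!x. x \<in> C \<and> x \<^bold>\<in> a \<and> maps_to C f x y))"

definition transitive_set :: "'a set \<Rightarrow> 'a \<Rightarrow> bool" where
  "transitive_set C x \<longleftrightarrow> (\<forall>y\<in>C. y \<^bold>\<in> x \<longrightarrow> (\<forall>z\<in>C. z \<^bold>\<in> y \<longrightarrow> z \<^bold>\<in> x))"

text \<open>By Foundation, von Neumann ordinals are the transitive sets of transitive sets.\<close>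

definition ordinal :: "'a set \<Rightarrow> 'a \<Rightarrow> bool" where
  "ordinal C x \<longleftrightarrow> transitive_set C x \<and> (\<forall>y\<in>C. y \<^bold>\<in> x \<longrightarrow> transitive_set C y)"

definition limit_ordinal :: "'a set \<Rightarrow> 'a \<Rightarrow> bool" where
  "limit_ordinal C x \<longleftrightarrow> ordinal C x \<and> (\<exists>y\<in>C. y \<^bold>\<in> x) \<and>
     (\<forall>y\<in>C. y \<^bold>\<in> x \<longrightarrow> (\<exists>z\<in>C. z \<^bold>\<in> x \<and> y \<^bold>\<in> z))"

definition cardinal :: "'a set \<Rightarrow> 'a \<Rightarrow> bool" where
  "cardinal C k \<longleftrightarrow> ordinal C k \<and> \<not> (\<exists>a\<in>C. a \<^bold>\<in> k \<and> (\<exists>f\<in>C. is_bij C f a k))"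

text \<open>A cardinal is infinite iff it is a (nonzero) limit ordinal.\<close>

definition regular_cardinal :: "'a set \<Rightarrow> 'a \<Rightarrow> bool" where
  "regular_cardinal C k \<longleftrightarrow> cardinal C k \<and> limit_ordinal C k \<and>
     \<not> (\<exists>a\<in>C. a \<^bold>\<in> k \<and> (\<exists>f\<in>C. is_fun C f a k \<and>
          (\<forall>b\<in>C. b \<^bold>\<in> k \<longrightarrow> (\<exists>x\<in>C. \<exists>y\<in>C. x \<^bold>\<in> a \<and> maps_to C f x y \<and> (b = y \<or> b \<^bold>\<in> y)))))"

section \<open>Operations of the universe\<close>

abbreviation func :: "'a \<Rightarrow> 'a \<Rightarrow> 'a \<Rightarrow> bool" where
  "func \<equiv> is_fun UNIV"

abbreviation Ord :: "'a \<Rightarrow> bool" where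
  "Ord \<equiv> ordinal UNIV"

definition subset :: "'a \<Rightarrow> 'a \<Rightarrow> bool" where
  "subset x y \<longleftrightarrow> (\<forall>z. z \<^bold>\<in> x \<longrightarrow> z \<^bold>\<in> y)"

definition emp :: 'a where
  "emp = (THE x. \<forall>w. \<not> w \<^bold>\<in> x)"

definition sing :: "'a \<Rightarrow> 'a" where
  "sing x = (THE z. is_upair UNIV x x z)"

definition opair :: "'a \<Rightarrow> 'a \<Rightarrow> 'a" where
  "opair x y = (THE z. is_opair UNIV x y z)"

definition app :: "'a \<Rightarrow> 'a \<Rightarrow> 'a" where
  "app f x = (THE y. maps_to UNIV f x y)"

definition succ :: "'a \<Rightarrow> 'a" where
  "succ x = (THE z. \<forall>w. w \<^bold>\<in> z \<longleftrightarrow> w \<^bold>\<in> x \<or> w = x)"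

definition omega :: 'a where
  "omega = (THE w. limit_ordinal UNIV w \<and> (\<forall>v. v \<^bold>\<in> w \<longrightarrow> \<not> limit_ordinal UNIV v))"

definition trcl :: "'a \<Rightarrow> 'a" where
  "trcl x = (THE t. transitive_set UNIV t \<and> subset x t \<and>
     (\<forall>u. transitive_set UNIV u \<and> subset x u \<longrightarrow> subset t u))"

text \<open>The recursion is \<open>V\<^sub>\<beta> = (\<Union>\<gamma><\<beta>. Pow V\<^sub>\<gamma>)\<close>; \<open>f\<close> is its solution on \<open>\<alpha> + 1\<close>.\<close>

definition Vset :: "'a \<Rightarrow> 'a" where
  "Vset \<alpha> = (THE v. \<exists>f b. func f (succ \<alpha>) b \<and>
     (\<forall>\<beta>. \<beta> \<^bold>\<in> succ \<alpha> \<longrightarrow> (\<forall>x. x \<^bold>\<in> app f \<beta> \<longleftrightarrow> (\<exists>\<gamma>. \<gamma> \<^bold>\<in> \<beta> \<and> subset x (app f \<gamma>)))) \<and>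
     app f \<alpha> = v)"

section \<open>Internal formulas, satisfaction and elementarity\<close>

text \<open>
  Formulas in the variables \<open>v\<^sub>i\<close> (\<open>i \<in> \<omega>\<close>) are coded by hereditarily finite sets, and assignments in a
  set \<open>A\<close> are functions from \<open>\<omega>\<close> to \<open>A\<close>.
\<close>

definition cMem :: "'a \<Rightarrow> 'a \<Rightarrow> 'a" where
  "cMem i j = opair emp (opair i j)"

definition cEq :: "'a \<Rightarrow> 'a \<Rightarrow> 'a" where
  "cEq i j = opair (succ emp) (opair i j)"

definition cNeg :: "'a \<Rightarrow> 'a" where
  "cNeg p = opair (succ (succ emp)) p"

definition cConj :: "'a \<Rightarrow> 'a \<Rightarrow> 'a" where
  "cConj p q = opair (succ (succ (succ emp))) (opair p q)"

definition cEx :: "'a \<Rightarrow> 'a \<Rightarrow> 'a" where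
  "cEx i p = opair (succ (succ (succ (succ emp)))) (opair i p)"

definition formula :: "'a \<Rightarrow> bool" where
  "formula p \<longleftrightarrow> (\<forall>F.
     (\<forall>i j. i \<^bold>\<in> omega \<and> j \<^bold>\<in> omega \<longrightarrow> cMem i j \<^bold>\<in> F \<and> cEq i j \<^bold>\<in> F) \<and>
     (\<forall>q. q \<^bold>\<in> F \<longrightarrow> cNeg q \<^bold>\<in> F) \<and>
     (\<forall>q r. q \<^bold>\<in> F \<and> r \<^bold>\<in> F \<longrightarrow> cConj q r \<^bold>\<in> F) \<and>
     (\<forall>i q. i \<^bold>\<in> omega \<and> q \<^bold>\<in> F \<longrightarrow> cEx i q \<^bold>\<in> F)
     \<longrightarrow> p \<^bold>\<in> F)"

text \<open>\<open>T\<close> contains a pair \<open>(p, s)\<close> of a formula and an assignment iff \<open>(A, \<in>) \<Turnstile> p[s]\<close> (Tarski's clauses).\<close>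

definition truth_set :: "'a \<Rightarrow> 'a \<Rightarrow> bool" where
  "truth_set A T \<longleftrightarrow> (\<forall>s. func s omega A \<longrightarrow>
     (\<forall>i j. i \<^bold>\<in> omega \<and> j \<^bold>\<in> omega \<longrightarrow>
        (opair (cMem i j) s \<^bold>\<in> T \<longleftrightarrow> app s i \<^bold>\<in> app s j) \<and>
        (opair (cEq i j) s \<^bold>\<in> T \<longleftrightarrow> app s i = app s j)) \<and>
     (\<forall>p. formula p \<longrightarrow> (opair (cNeg p) s \<^bold>\<in> T \<longleftrightarrow> \<not> opair p s \<^bold>\<in> T)) \<and>
     (\<forall>p q. formula p \<and> formula q \<longrightarrow>
        (opair (cConj p q) s \<^bold>\<in> T \<longleftrightarrow> opair p s \<^bold>\<in> T \<and> opair q s \<^bold>\<in> T)) \<and>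
     (\<forall>i p. i \<^bold>\<in> omega \<and> formula p \<longrightarrow>
        (opair (cEx i p) s \<^bold>\<in> T \<longleftrightarrow>
          (\<exists>t. func t omega A \<and> (\<forall>k. k \<^bold>\<in> omega \<and> k \<noteq> i \<longrightarrow> app t k = app s k) \<and>
               opair p t \<^bold>\<in> T))))"

definition Sat :: "'a \<Rightarrow> 'a \<Rightarrow> 'a \<Rightarrow> bool" where
  "Sat A p s \<longleftrightarrow> (\<exists>T. truth_set A T \<and> opair p s \<^bold>\<in> T)"

definition elem_submodel :: "'a \<Rightarrow> 'a \<Rightarrow> bool" where
  "elem_submodel X Y \<longleftrightarrow> subset X Y \<and>
     (\<forall>p s. formula p \<and> func s omega X \<longrightarrow> (Sat X p s \<longleftrightarrow> Sat Y p s))"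

text \<open>Here \<open>t\<close> is the assignment \<open>j \<circ> s\<close>.\<close>

definition elem_embedding :: "'a \<Rightarrow> 'a \<Rightarrow> 'a \<Rightarrow> bool" where
  "elem_embedding j X Y \<longleftrightarrow> func j X Y \<and>
     (\<forall>p s t. formula p \<and> func s omega X \<and> func t omega Y \<and>
        (\<forall>i. i \<^bold>\<in> omega \<longrightarrow> app t i = app j (app s i)) \<longrightarrow> (Sat X p s \<longleftrightarrow> Sat Y p t))"

section \<open>Exacting cardinals and hereditary ordinal definability\<close>

definition exacting :: "'a \<Rightarrow> bool" where
  "exacting \<kappa> \<longleftrightarrow> cardinal UNIV \<kappa> \<and>
     (\<forall>\<zeta>. Ord \<zeta> \<and> \<kappa> \<^bold>\<in> \<zeta> \<longrightarrow>
       (\<exists>X j. elem_submodel X (Vset \<zeta>) \<and> subset (Vset \<kappa>) X \<and> \<kappa> \<^bold>\<in> X \<and>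
              elem_embedding j X (Vset \<zeta>) \<and> app j \<kappa> = \<kappa> \<and>
              (\<exists>\<alpha>. \<alpha> \<^bold>\<in> \<kappa> \<and> app j \<alpha> \<noteq> \<alpha>)))"

text \<open>
  As usual, definability in the universe is expressed, via the reflection principle, as definability
  over some \<open>(V\<^sub>\<beta>, \<in>)\<close>. The finite sequence of parameters is \<open>q : n \<rightarrow> V\<^sub>\<beta> \<inter> (\<Gamma> \<union> Ord)\<close>: it is the value of
  the variables \<open>v\<^sub>1, ..., v\<^sub>n\<close>, while \<open>v\<^sub>0\<close> stands for the set being defined and the values of the
  other variables must not matter.
\<close>

definition OD :: "'a set \<Rightarrow> 'a set" where
  "OD \<Gamma> = {x. \<exists>\<beta> n q p. Ord \<beta> \<and> x \<^bold>\<in> Vset \<beta> \<and>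
     n \<^bold>\<in> omega \<and> func q n (Vset \<beta>) \<and> (\<forall>i. i \<^bold>\<in> n \<longrightarrow> app q i \<in> \<Gamma> \<or> Ord (app q i)) \<and>
     formula p \<and>
     (\<forall>y s. y \<^bold>\<in> Vset \<beta> \<and> func s omega (Vset \<beta>) \<and> app s emp = y \<and>
            (\<forall>i. i \<^bold>\<in> n \<longrightarrow> app s (succ i) = app q i)
        \<longrightarrow> (Sat (Vset \<beta>) p s \<longleftrightarrow> y = x))}"

definition HOD :: "'a set \<Rightarrow> 'a set" where
  "HOD \<Gamma> = {x. \<forall>y. y \<^bold>\<in> trcl (sing x) \<longrightarrow> y \<in> OD \<Gamma>}"

end

end

theory Submission
  imports Defs
begin

text \<open>
  Suppose that some \<open>f \<in> OD\<^sub>V\<^sub>\<kappa>\<close> maps an ordinal below \<open>\<kappa>\<close> cofinally into \<open>\<kappa>\<close>. Minimizing first the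
  rank of the parameters in \<open>V\<^sub>\<kappa>\<close> and then, lexicographically, the ordinal parameters makes such an \<open>f\<close>
  definable from \<open>\<kappa>\<close> and from sets in \<open>V\<^sub>\<gamma>\<close>, where \<open>\<gamma> < \<kappa>\<close> is itself definable from \<open>\<kappa>\<close>. Take
  \<open>j : X \<rightarrow> V\<^sub>\<zeta>\<close> as in the definition of an exacting cardinal, for a \<open>\<zeta>\<close> that reflects the formulas
  involved. Then \<open>j(\<gamma>) = \<gamma>\<close>. By Kunen's argument the critical point of \<open>j\<close> exceeds every fixed point
  below \<open>\<kappa>\<close>. So \<open>j\<close> is the identity on \<open>V\<^sub>\<gamma>\<close>, hence \<open>j(f) = f\<close> and all values of \<open>f\<close> are fixed points.
  These are bounded by the critical point, a contradiction. The critical sequence of \<open>j\<close> is cofinal in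
  \<open>\<kappa>\<close>, again by Kunen's argument, so \<open>\<kappa>\<close> is singular and \<open>HOD\<^sub>V\<^sub>\<kappa> \<noteq> V\<close>.
\<close>

section \<open>Definable predicates\<close>

text \<open>The obstacle is that \<open>X\<close> need not be transitive and only
  \<open>V \<kappa>\<close> is known to lie inside it. A map cofinal in \<kappa> is not an element
  of \<open>V \<kappa>\<close>; it gets into \<open>X\<close> only as the unique solution of a
  preserved condition whose parameters are in \<open>X\<close>. Its ordinal parameters may be far
  above \<kappa>, so they are minimized away instead of being kept. Kunen's argument works with
  \<omega>-sequences in one ordinal \<gamma> below \<kappa>: such sequences are elements of
  \<open>V \<kappa>\<close>, hence of \<open>X\<close>, and can be pulled back along
  \<open>j\<close>, while the indices in \<omega> are fixed by \<open>j\<close>. On the formal side,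
  the model may be ill-founded with nonstandard natural numbers. Separation, Replacement and all
  internal inductions are available only for predicates shown to be first-order definable, which is
  the purpose of \<open>definable\<close> and of the rules \<open>dfn\<close>. Elementarity of
  \<open>j\<close> speaks of internal formulas, and is used only for the codes of the finitely many
  metatheoretic formulas behind \<open>preserved\<close>.\<close>

primrec fm_vars :: "fm => nat set" where
  "fm_vars (FMem i j) = {i, j}"
| "fm_vars (FEq i j) = {i, j}"
| "fm_vars (FNeg p) = fm_vars p"
| "fm_vars (FConj p q) = fm_vars p \<union> fm_vars q"
| "fm_vars (FEx i p) = insert i (fm_vars p)"

lemma finite_fm_vars: "finite (fm_vars p)"
  by (induction p) auto

abbreviation (input) iff_ascii (infixr "<->" 25) where "P <-> Q == P = Q"

lemma sat_cong: "(\<And>n. n \<in> fm_vars p ==> e n = e' n) ==> sat E p e <-> sat E p e'"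
proof (induction p arbitrary: e e')
  case (FEx i p)
  have "sat E p (e(i := x)) <-> sat E p (e'(i := x))" for x
    by (rule FEx.IH) (use FEx.prems in auto)
  then show ?case by simp
next
  case (FConj p q)
  then show ?case by (metis UnCI fm_vars.simps(4) sat.simps(4))
next
  case (FNeg p)
  then show ?case by (metis fm_vars.simps(3) sat.simps(3))
qed auto

text \<open>The renaming \<open>r\<close> need not be injective, so applying it to a bound variable
  could capture a free one. The bound variable is therefore sent to a number outside the image of
  all variables of the body.\<close>

lemma sat_rename: "\<exists>p'. \<forall>e. sat E p' e <-> sat E p (\<lambda>n. e (r n))"
proof (induction p arbitrary: r)
  case (FMem i j)
  show ?case by (rule exI[of _ "FMem (r i) (r j)"]) simp
next
  case (FEq i j)
  show ?case by (rule exI[of _ "FEq (r i) (r j)"]) simp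
next
  case (FNeg p)
  from FNeg[of r] obtain p' where "\<forall>e. sat E p' e <-> sat E p (\<lambda>n. e (r n))" ..
  then show ?case by (intro exI[of _ "FNeg p'"]) simp
next
  case (FConj p q)
  from FConj.IH(1)[of r] FConj.IH(2)[of r] obtain p' q'
    where "\<forall>e. sat E p' e <-> sat E p (\<lambda>n. e (r n))" "\<forall>e. sat E q' e <-> sat E q (\<lambda>n. e (r n))"
    by blast
  then show ?case by (intro exI[of _ "FConj p' q'"]) simp
next
  case (FEx i p)
  have "finite (r ` fm_vars p)" by (simp add: finite_fm_vars)
  then obtain k where k: "k \<notin> r ` fm_vars p"
    using ex_new_if_finite infinite_UNIV_nat by blast
  from FEx[of "r(i := k)"] obtain p'
    where p': "\<And>e. sat E p' e <-> sat E p (\<lambda>n. e ((r(i := k)) n))" by blast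
  have "sat E p' (e(k := x)) <-> sat E p ((\<lambda>n. e (r n))(i := x))" for e x
    unfolding p' by (rule sat_cong) (use k in auto)
  then show ?case by (intro exI[of _ "FEx k p'"]) simp
qed

text \<open>The first \<open>k\<close> variables hold constants from \<open>K\<close> and the
  environment is shifted behind them. \<open>K = UNIV\<close> allows arbitrary parameters, as the
  axiom schemas do; \<open>K = {}\<close> is for the predicates that the embedding must
  respect.\<close>

definition definable :: "('a => 'a => bool) => 'a set => ((nat => 'a) => bool) => bool" where
  "definable E K \<Phi> <-> (\<exists>p k c. (\<forall>i<k. c i \<in> K) &
     (\<forall>e. \<Phi> e <-> sat E p (\<lambda>n. if n < k then c n else e (n - k))))"

text \<open>Bound variables are handled as de Bruijn indices: under a quantifier, variable 0 is the bound one
  and the others are shifted.\<close>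

definition definable_term :: "('a => 'a => bool) => 'a set => ((nat => 'a) => 'a) => bool" where
  "definable_term E K t <-> definable E K (\<lambda>e. e 0 = t (\<lambda>n. e (Suc n)))"

lemma definable_empD:
  assumes "definable E {} \<Phi>"
  shows "\<exists>p. \<forall>e. sat E p e <-> \<Phi> e"
proof -
  from assms obtain p k and c :: "nat => 'a" where c: "\<forall>i<k. c i \<in> {}"
    and p: "\<forall>e. \<Phi> e <-> sat E p (\<lambda>n. if n < k then c n else e (n - k))"
    unfolding definable_def by blast
  from c have "k = 0" by auto
  with p show ?thesis by auto
qed

lemma definable_rename:
  assumes "definable E K \<Phi>"
  shows "definable E K (\<lambda>e. \<Phi> (\<lambda>n. e (r n)))"
proof -
  from assms obtain p k c where c: "\<forall>i<k. c i \<in> K"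
    and p: "\<And>e. \<Phi> e <-> sat E p (\<lambda>n. if n < k then c n else e (n - k))"
    unfolding definable_def by blast
  obtain p' where p': "\<And>e. sat E p' e <-> sat E p (\<lambda>n. e (if n < k then n else k + r (n - k)))"
    using sat_rename[of E p "\<lambda>n. if n < k then n else k + r (n - k)"] by blast
  have "\<Phi> (\<lambda>n. e (r n)) <-> sat E p' (\<lambda>n. if n < k then c n else e (n - k))" for e
    unfolding p p' by (rule sat_cong) auto
  with c show ?thesis unfolding definable_def by blast
qed

lemma definable_var_mem: "definable E K (\<lambda>e. E (e i) (e j))"
  unfolding definable_def by (rule exI[of _ "FMem i j"], rule exI[of _ 0]) simp

lemma definable_var_eq: "definable E K (\<lambda>e. e i = e j)"
  unfolding definable_def by (rule exI[of _ "FEq i j"], rule exI[of _ 0]) simp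

lemma definable_not: "definable E K \<Phi> ==> definable E K (\<lambda>e. \<not> \<Phi> e)"
proof -
  assume "definable E K \<Phi>"
  then obtain p k c where "\<forall>i<k. c i \<in> K"
    "\<forall>e. \<Phi> e <-> sat E p (\<lambda>n. if n < k then c n else e (n - k))"
    unfolding definable_def by blast
  then have "(\<forall>i<k. c i \<in> K) & (\<forall>e. \<not> \<Phi> e <-> sat E (FNeg p) (\<lambda>n. if n < k then c n else e (n - k)))"
    by simp
  then show ?thesis unfolding definable_def by blast
qed

lemma definable_conj:
  assumes "definable E K \<Phi>" "definable E K \<Psi>"
  shows "definable E K (\<lambda>e. \<Phi> e & \<Psi> e)"
proof -
  from assms(1) obtain p k c where c: "\<forall>i<k. c i \<in> K"
    and p: "\<And>e. \<Phi> e <-> sat E p (\<lambda>n. if n < k then c n else e (n - k))"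
    unfolding definable_def by blast
  from assms(2) obtain q l d where d: "\<forall>i<l. d i \<in> K"
    and q: "\<And>e. \<Psi> e <-> sat E q (\<lambda>n. if n < l then d n else e (n - l))"
    unfolding definable_def by blast
  \<comment> \<open>The constants of \<open>q\<close> are placed behind those of \<open>p\<close>:
    the free variables of \<open>p\<close> move up by \<open>l\<close>, all variables of
    \<open>q\<close> by \<open>k\<close>.\<close>
  obtain p' where p': "\<And>e. sat E p' e <-> sat E p (\<lambda>n. e (if n < k then n else n + l))"
    using sat_rename[of E p "\<lambda>n. if n < k then n else n + l"] by blast
  obtain q' where q': "\<And>e. sat E q' e <-> sat E q (\<lambda>n. e (n + k))"
    using sat_rename[of E q "\<lambda>n. n + k"] by blast
  define b where "b n = (if n < k then c n else d (n - k))" for n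
  have b: "\<forall>i<k + l. b i \<in> K" using c d by (auto simp: b_def)
  have "\<Phi> e & \<Psi> e <-> sat E (FConj p' q') (\<lambda>n. if n < k + l then b n else e (n - (k + l)))" for e
  proof -
    have "\<Phi> e <-> sat E p' (\<lambda>n. if n < k + l then b n else e (n - (k + l)))"
      unfolding p p' by (rule sat_cong) (auto simp: b_def)
    moreover have "\<Psi> e <-> sat E q' (\<lambda>n. if n < k + l then b n else e (n - (k + l)))"
      unfolding q q' by (rule sat_cong) (auto simp: b_def add.commute)
    ultimately show ?thesis by simp
  qed
  with b show ?thesis unfolding definable_def by blast
qed

lemma definable_ex:
  assumes "definable E K (\<lambda>e. Q (\<lambda>n. e (Suc n)) (e 0))"
  shows "definable E K (\<lambda>e. \<exists>x. Q e x)"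
proof -
  from assms obtain p k c where c: "\<forall>i<k. c i \<in> K"
    and p: "\<And>e. Q (\<lambda>n. e (Suc n)) (e 0) <-> sat E p (\<lambda>n. if n < k then c n else e (n - k))"
    unfolding definable_def by blast
  \<comment> \<open>Position \<open>k\<close>, which is index 0 behind the constants, becomes the
    fresh variable \<open>N\<close>; later positions move down by one because the bound variable
    leaves the environment.\<close>
  define r where "r N n = (if n < k then n else if n = k then N else n - 1)" for N n :: nat
  have "finite (fm_vars p \<union> r 0 ` fm_vars p)" by (simp add: finite_fm_vars)
  then obtain N where N: "N \<notin> fm_vars p \<union> r 0 ` fm_vars p"
    using ex_new_if_finite infinite_UNIV_nat by blast
  obtain p' where p': "\<And>e. sat E p' e <-> sat E p (\<lambda>n. e (r N n))"
    using sat_rename[of E p "r N"] by blast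
  have "Q e x <-> sat E p' ((\<lambda>n. if n < k then c n else e (n - k))(N := x))" for e x
  proof -
    have "Q e x <-> sat E p (\<lambda>n. if n < k then c n else if n - k = 0 then x else e (n - k - 1))"
      using p[of "\<lambda>n. if n = 0 then x else e (n - 1)"] by simp
    also have "\<dots> <-> sat E p' ((\<lambda>n. if n < k then c n else e (n - k))(N := x))"
      unfolding p' by (rule sat_cong) (use N in \<open>auto simp: r_def\<close>)
    finally show ?thesis .
  qed
  then have "\<forall>e. (\<exists>x. Q e x) <-> sat E (FEx N p') (\<lambda>n. if n < k then c n else e (n - k))"
    by simp
  with c show ?thesis unfolding definable_def by blast
qed

lemma definable_disj:
  "definable E K \<Phi> ==> definable E K \<Psi> ==> definable E K (\<lambda>e. \<Phi> e | \<Psi> e)"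
  using definable_not[OF definable_conj[OF definable_not definable_not], of E K \<Phi> \<Psi>] by simp

lemma definable_imp:
  "definable E K \<Phi> ==> definable E K \<Psi> ==> definable E K (\<lambda>e. \<Phi> e --> \<Psi> e)"
  using definable_not[OF definable_conj[OF _ definable_not], of E K \<Phi> \<Psi>] by simp

lemma definable_iff:
  "definable E K \<Phi> ==> definable E K \<Psi> ==> definable E K (\<lambda>e. \<Phi> e <-> \<Psi> e)"
  using definable_conj[OF definable_imp definable_imp, of E K \<Phi> \<Psi> \<Psi> \<Phi>]
  by (simp add: iff_conv_conj_imp)

lemma definable_all:
  assumes "definable E K (\<lambda>e. Q (\<lambda>n. e (Suc n)) (e 0))"
  shows "definable E K (\<lambda>e. \<forall>x. Q e x)"
  using definable_not[OF definable_ex[of E K "\<lambda>e x. \<not> Q e x"]] definable_not[OF assms] by simp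

section \<open>Definable terms and their substitution into definable predicates\<close>

lemma definable_term_shift:
  assumes "definable_term E K t"
  shows "definable_term E K (\<lambda>e. t (\<lambda>n. e (Suc n)))"
  unfolding definable_term_def
  using definable_rename[OF assms[unfolded definable_term_def], of "case_nat 0 (\<lambda>n. Suc (Suc n))"]
  by simp

text \<open>Formulas have no function symbols, so a term is eliminated by quantifying over its
  value.\<close>

lemma definable_lift2:
  assumes P: "definable E K (\<lambda>e. P (e 0) (e 1))"
    and t: "definable_term E K t" and u: "definable_term E K u"
  shows "definable E K (\<lambda>e. P (t e) (u e))"
proof -
  note r = definable_rename[OF t[unfolded definable_term_def], of "case_nat 1 (\<lambda>n. Suc (Suc n))"]
    definable_term_shift[OF u, unfolded definable_term_def]
    definable_rename[OF P, of "case_nat 1 (\<lambda>_. 0)"]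
  have "definable E K (\<lambda>e. \<exists>x y. x = t e & y = u e & P x y)"
    by (intro definable_ex definable_conj) (use r in simp_all)
  then show ?thesis by simp
qed

lemma definable_term_var: "definable_term E K (\<lambda>e. e i)"
  unfolding definable_term_def by (rule definable_var_eq)

lemma definable_term_const:
  assumes "c \<in> K"
  shows "definable_term E K (\<lambda>e. c)"
  unfolding definable_term_def definable_def
  by (rule exI[of _ "FEq 1 0"], rule exI[of _ 1], rule exI[of _ "\<lambda>_. c"]) (simp add: assms)

lemma definable_mem:
  "definable_term E K t ==> definable_term E K u ==> definable E K (\<lambda>e. E (t e) (u e))"
  by (rule definable_lift2[where P = E]) (rule definable_var_mem)

lemma definable_eq:
  "definable_term E K t ==> definable_term E K u ==> definable E K (\<lambda>e. t e = u e)"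
  by (rule definable_lift2[where P = "(=)"]) (rule definable_var_eq)

text \<open>Simultaneous substitution of terms by induction on the formula. Under a quantifier the
  bound variable becomes index 0 and the remaining terms are shifted, so no renaming of syntax is
  needed.\<close>

lemma definable_sat:
  assumes "\<And>n. definable_term E K (T n)"
  shows "definable E K (\<lambda>e. sat E p (\<lambda>n. T n e))"
  using assms
proof (induction p arbitrary: T)
  case (FMem i j)
  then show ?case by (simp add: definable_mem)
next
  case (FEq i j)
  then show ?case by (simp add: definable_eq)
next
  case (FNeg p)
  then show ?case by (simp add: definable_not)
next
  case (FConj p q)
  then show ?case by (simp add: definable_conj)
next
  case (FEx i p)
  define T' where "T' n = (if n = i then (\<lambda>e. e 0) else (\<lambda>e. T n (\<lambda>n. e (Suc n))))" for n
  have "definable_term E K (T' n)" for n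
    by (simp add: T'_def FEx.prems definable_term_shift definable_term_var)
  from FEx.IH[OF this] have "definable E K (\<lambda>e. sat E p (\<lambda>n. T' n e))" .
  moreover have "(\<lambda>n. T' n e) = (\<lambda>n. T n (\<lambda>n. e (Suc n)))(i := e 0)" for e
    by (auto simp: T'_def)
  ultimately have "definable E K (\<lambda>e. \<exists>x. sat E p ((\<lambda>n. T n e)(i := x)))"
    by (intro definable_ex) simp
  then show ?case by simp
qed

lemma definable_substs:
  assumes "definable E K \<Phi>" "\<And>n. definable_term E K (T n)"
  shows "definable E K (\<lambda>e. \<Phi> (\<lambda>n. T n e))"
proof -
  from assms obtain p k c where c: "\<And>i. i < k ==> c i \<in> K"
    and p: "\<And>e. \<Phi> e <-> sat E p (\<lambda>n. if n < k then c n else e (n - k))"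
    unfolding definable_def by blast
  have "definable E K (\<lambda>e. sat E p (\<lambda>n. (if n < k then (\<lambda>e. c n) else T (n - k)) e))"
    by (rule definable_sat) (simp add: c definable_term_const assms)
  then show ?thesis unfolding p by (simp add: if_distrib[of "\<lambda>f. f _"])
qed

lemma definable_lift:
  assumes "definable E K \<Phi>" "\<forall>t\<in>set ts. definable_term E K t"
  shows "definable E K (\<lambda>e. \<Phi> (\<lambda>n. if n < length ts then (ts ! n) e else e n))"
proof -
  have "definable E K (\<lambda>e. \<Phi> (\<lambda>n. (if n < length ts then ts ! n else (\<lambda>e. e n)) e))"
    by (rule definable_substs) (use assms in \<open>auto simp: definable_term_var\<close>)
  then show ?thesis by (simp add: if_distrib[of "\<lambda>f. f _"])
qed

lemma definable_lift1:
  assumes "definable E K (\<lambda>e. P (e 0))" "definable_term E K t"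
  shows "definable E K (\<lambda>e. P (t e))"
  using definable_lift[OF assms(1), of "[t]"] assms(2) by simp

lemma definable_lift3:
  assumes "definable E K (\<lambda>e. P (e 0) (e 1) (e 2))" "definable_term E K t1" "definable_term E K t2"
    "definable_term E K t3"
  shows "definable E K (\<lambda>e. P (t1 e) (t2 e) (t3 e))"
  using definable_lift[OF assms(1), of "[t1, t2, t3]"] assms(2-) by simp

lemma definable_lift4:
  assumes "definable E K (\<lambda>e. P (e 0) (e 1) (e 2) (e 3))" "definable_term E K t1"
    "definable_term E K t2" "definable_term E K t3" "definable_term E K t4"
  shows "definable E K (\<lambda>e. P (t1 e) (t2 e) (t3 e) (t4 e))"
  using definable_lift[OF assms(1), of "[t1, t2, t3, t4]"] assms(2-) by simp

lemma definable_lift5: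
  assumes "definable E K (\<lambda>e. P (e 0) (e 1) (e 2) (e 3) (e 4))" "definable_term E K t1"
    "definable_term E K t2" "definable_term E K t3" "definable_term E K t4" "definable_term E K t5"
  shows "definable E K (\<lambda>e. P (t1 e) (t2 e) (t3 e) (t4 e) (t5 e))"
  using definable_lift[OF assms(1), of "[t1, t2, t3, t4, t5]"] assms(2-) by simp

lemma definable_term_lift1:
  assumes "definable_term E K (\<lambda>e. f (e 0))" "definable_term E K t"
  shows "definable_term E K (\<lambda>e. f (t e))"
  unfolding definable_term_def
  using definable_lift[OF assms(1)[unfolded definable_term_def],
      of "[\<lambda>e. e 0, \<lambda>e. t (\<lambda>n. e (Suc n))]"]
    definable_term_shift[OF assms(2)] by (simp add: definable_term_var)

lemma definable_term_lift2:
  assumes "definable_term E K (\<lambda>e. f (e 0) (e 1))" "definable_term E K t" "definable_term E K u"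
  shows "definable_term E K (\<lambda>e. f (t e) (u e))"
  unfolding definable_term_def
  using definable_lift[OF assms(1)[unfolded definable_term_def],
      of "[\<lambda>e. e 0, \<lambda>e. t (\<lambda>n. e (Suc n)), \<lambda>e. u (\<lambda>n. e (Suc n))]"]
    definable_term_shift[OF assms(2)] definable_term_shift[OF assms(3)]
  by (simp add: definable_term_var)

lemma definable_ex1:
  assumes "definable E K (\<lambda>e. Q (\<lambda>n. e (Suc n)) (e 0))"
  shows "definable E K (\<lambda>e. \<exists>!x. Q e x)"
  unfolding Ex1_def
proof (intro definable_ex definable_conj definable_all definable_imp definable_eq definable_term_var)
  show "definable E K (\<lambda>e. Q (\<lambda>n. e (Suc (Suc n))) (e 0))"
    using definable_rename[OF assms, of "case_nat 0 (\<lambda>n. Suc (Suc n))"] by simp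
qed (rule assms)

lemma definable_true: "definable E K (\<lambda>e. True)"
proof -
  have "definable E K (\<lambda>e. e 0 = e 0)" by (rule definable_var_eq)
  then show ?thesis by simp
qed

lemma definable_term_param: "definable_term E UNIV (\<lambda>e. c)"
  by (simp add: definable_term_const)

lemmas definable_intros =
  definable_not definable_conj definable_disj definable_imp definable_iff definable_ex definable_all
  definable_ex1 definable_mem definable_eq definable_term_var definable_true

named_theorems dfn

declare definable_intros [dfn] definable_term_param [dfn]

context ZFC
begin

notation E (infix "\<epsilon>" 50)

abbreviation subset_eq (infix "\<sqsubseteq>" 50) where "x \<sqsubseteq> y == subset E x y"
abbreviation Def where "Def == definable E"
abbreviation Trm where "Trm == definable_term E"
abbreviation succ where "succ == Defs.succ E"
abbreviation func where "func == is_fun E UNIV"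
abbreviation app where "app == Defs.app E"
abbreviation Ord where "Ord == ordinal E UNIV"
abbreviation opair where "opair == Defs.opair E"
abbreviation emp where "emp == Defs.emp E"
abbreviation formula where "formula == Defs.formula E"
abbreviation Sat where "Sat == Defs.Sat E"
abbreviation cMem where "cMem == Defs.cMem E"
abbreviation cEq where "cEq == Defs.cEq E"
abbreviation cNeg where "cNeg == Defs.cNeg E"
abbreviation cConj where "cConj == Defs.cConj E"
abbreviation cEx where "cEx == Defs.cEx E"
abbreviation trcl where "trcl == Defs.trcl E"
abbreviation sing where "sing == Defs.sing E"
abbreviation truth_set where "truth_set == Defs.truth_set E"
abbreviation exacting where "exacting == Defs.exacting E"
abbreviation OD where "OD == Defs.OD E"
abbreviation HOD where "HOD == Defs.HOD E"
abbreviation Vset where "Vset == Defs.Vset E"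
abbreviation limit where "limit == limit_ordinal E UNIV"
abbreviation transitive where "transitive == transitive_set E UNIV"

section \<open>Basic set operations\<close>

lemma subsetI: "(\<And>z. z \<epsilon> x ==> z \<epsilon> y) ==> x \<sqsubseteq> y"
  by (simp add: subset_def)

lemma subsetD: "x \<sqsubseteq> y ==> z \<epsilon> x ==> z \<epsilon> y"
  by (simp add: subset_def)

lemma subset_refl: "x \<sqsubseteq> x"
  by (simp add: subset_def)

lemma subset_trans: "x \<sqsubseteq> y ==> y \<sqsubseteq> z ==> x \<sqsubseteq> z"
  by (simp add: subset_def)

lemma subset_antisym: "x \<sqsubseteq> y ==> y \<sqsubseteq> x ==> x = y"
  by (rule extensionality) (auto simp: subset_def)

text \<open>Brings a definable predicate into the shape of the axiom schemas, with the arguments at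
  variables 0 and 1 and the parameters above them. The rest of the environment is constantly
  \<open>d\<close>, so \<open>r\<close> can collapse it into the single variable
  \<open>k + 2\<close>.\<close>

lemma definable_param2:
  assumes "Def UNIV \<Phi>"
  shows "\<exists>p c. \<forall>x y. \<Phi> (\<lambda>n. if n = 0 then x else if n = 1 then y else d) <-> sat E p (c(0 := x, 1 := y))"
proof -
  from assms obtain p k c where p: "\<And>e. \<Phi> e <-> sat E p (\<lambda>n. if n < k then c n else e (n - k))"
    unfolding definable_def by blast
  define r where "r n = (if n < k then n + 2 else if n = k then 0 else if n = k + 1 then 1 else k + 2)"
    for n :: nat
  obtain p' where p': "\<And>e. sat E p' e <-> sat E p (\<lambda>n. e (r n))"
    using sat_rename[of E p r] by blast
  define c' where "c' n = (if n < k + 2 then c (n - 2) else d)" for n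
  have "\<Phi> (\<lambda>n. if n = 0 then x else if n = 1 then y else d) <-> sat E p' (c'(0 := x, 1 := y))" for x y
    unfolding p p' by (rule sat_cong) (auto simp: r_def c'_def)
  then show ?thesis by blast
qed

lemma separation':
  assumes "Def UNIV (\<lambda>e. P (e 0))"
  shows "\<exists>b. \<forall>x. x \<epsilon> b <-> x \<epsilon> a & P x"
proof -
  obtain p c where "\<And>x y. P x <-> sat E p (c(0 := x, 1 := y))"
    using definable_param2[OF assms, of a] by auto
  then have "P x <-> sat E p ((c(1 := a))(0 := x))" for x
    by (simp add: fun_upd_twist)
  then show ?thesis using separation[of a p "c(1 := a)"] by simp
qed

lemma replacement':
  assumes "Def UNIV (\<lambda>e. R (e 0) (e 1))" "\<And>x. x \<epsilon> a ==> \<exists>!y. R x y"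
  shows "\<exists>b. \<forall>x. x \<epsilon> a --> (\<exists>y. y \<epsilon> b & R x y)"
proof -
  obtain p c where "\<And>x y. R x y <-> sat E p (c(0 := x, 1 := y))"
    using definable_param2[OF assms(1), of a] by auto
  then show ?thesis using replacement[of a p c] assms(2) by simp
qed

text \<open>Meaningful only if the class is a set; \<open>mem_collect\<close> obtains this from
  definability and a bounding set.\<close>

definition collect :: "('a => bool) => 'a" where
  "collect P = (THE b. \<forall>x. x \<epsilon> b <-> P x)"

lemma mem_collect':
  assumes "\<exists>b. \<forall>x. x \<epsilon> b <-> P x"
  shows "x \<epsilon> collect P <-> P x"
proof -
  from assms obtain b where b: "\<forall>x. x \<epsilon> b <-> P x" ..
  then have "collect P = b"
    unfolding collect_def by (intro the_equality) (auto intro: extensionality)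
  with b show ?thesis by simp
qed

lemma mem_collect:
  assumes "Def UNIV (\<lambda>e. P (e 0))" "\<And>x. P x ==> x \<epsilon> a"
  shows "x \<epsilon> collect P <-> P x"
  using separation'[OF assms(1), of a] assms(2) by (intro mem_collect') blast

lemma eq_collect: "\<exists>b. \<forall>x. x \<epsilon> b <-> P x ==> y = collect P <-> (\<forall>x. x \<epsilon> y <-> P x)"
  using mem_collect'[of P] by (auto intro: extensionality)

definition upair :: "'a => 'a => 'a" where "upair x y = collect (\<lambda>w. w = x | w = y)"
definition Uni :: "'a => 'a" where "Uni x = collect (\<lambda>w. \<exists>y. y \<epsilon> x & w \<epsilon> y)"
definition Pw :: "'a => 'a" where "Pw x = collect (\<lambda>w. w \<sqsubseteq> x)"
definition cup :: "'a => 'a => 'a" where "cup x y = Uni (upair x y)"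

lemma mem_upair [simp]: "w \<epsilon> upair x y <-> w = x | w = y"
  unfolding upair_def by (rule mem_collect'[OF pairing])

lemma mem_Uni [simp]: "w \<epsilon> Uni x <-> (\<exists>y. y \<epsilon> x & w \<epsilon> y)"
  unfolding Uni_def by (rule mem_collect'[OF union])

lemma mem_Pw [simp]: "w \<epsilon> Pw x <-> w \<sqsubseteq> x"
  unfolding Pw_def subset_def by (rule mem_collect'[OF power_set])

lemma mem_cup [simp]: "w \<epsilon> cup x y <-> w \<epsilon> x | w \<epsilon> y"
  unfolding cup_def by auto

lemma not_mem_emp [simp]: "\<not> w \<epsilon> emp"
proof -
  obtain x where x: "\<forall>w. \<not> w \<epsilon> x" using infinity by blast
  then have "emp = x"
    unfolding emp_def by (intro the_equality) (auto intro: extensionality)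
  with x show ?thesis by simp
qed

lemma eq_emp_iff: "x = emp <-> (\<forall>w. \<not> w \<epsilon> x)"
  by (auto intro: extensionality)

lemma is_upair_iff: "is_upair E UNIV x y z <-> z = upair x y"
  unfolding is_upair_def by (auto intro: extensionality)

lemma sing_eq: "sing x = upair x x"
  unfolding sing_def is_upair_iff by simp

lemma is_opair_eq: "is_opair E UNIV x y z <-> z = upair (upair x x) (upair x y)"
  unfolding is_opair_def is_upair_iff by simp

lemma opair_eq: "opair x y = upair (upair x x) (upair x y)"
  unfolding opair_def is_opair_eq by simp

lemma is_opair_iff: "is_opair E UNIV x y z <-> z = opair x y"
  by (simp add: is_opair_eq opair_eq)

lemma mem_sing [simp]: "w \<epsilon> sing x <-> w = x"
  by (simp add: sing_eq)

lemma upair_eq_iff: "upair a b = upair c d <-> (a = c & b = d) | (a = d & b = c)"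
proof
  assume "upair a b = upair c d"
  then have "w = a | w = b <-> w = c | w = d" for w using mem_upair by metis
  from this[of a] this[of b] this[of c] this[of d]
  show "(a = c & b = d) | (a = d & b = c)" by auto
qed (auto intro: extensionality)

lemma opair_inject [simp]: "opair a b = opair c d <-> a = c & b = d"
  unfolding opair_eq upair_eq_iff by auto

lemma maps_to_iff: "maps_to E UNIV f x y <-> opair x y \<epsilon> f"
  unfolding maps_to_def is_opair_iff by simp

lemma mem_succ [simp]: "w \<epsilon> succ x <-> w \<epsilon> x | w = x"
proof -
  have "\<exists>!z. \<forall>w. w \<epsilon> z <-> w \<epsilon> x | w = x"
    by (rule ex1I[of _ "cup x (upair x x)"]) (auto intro: extensionality)
  from theI'[OF this] show ?thesis unfolding succ_def by simp
qed

lemma succ_neq_emp [simp]: "succ x ~= emp" "emp ~= succ x"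
  by (metis mem_succ not_mem_emp)+

lemma definable_subset [dfn]:
  "Trm K t ==> Trm K u ==> Def K (\<lambda>e. t e \<sqsubseteq> u e)"
  by (rule definable_lift2[where P = "subset E"])
    (unfold subset_def, intro dfn)

lemma definable_term_upair [dfn]:
  "Trm K t ==> Trm K u ==> Trm K (\<lambda>e. upair (t e) (u e))"
proof (rule definable_term_lift2[where f = upair])
  show "Trm K (\<lambda>e. upair (e 0) (e 1))"
    unfolding definable_term_def is_upair_iff[symmetric] is_upair_def Ball_def
    by simp (intro dfn)
qed

lemma definable_term_opair [dfn]:
  "Trm K t ==> Trm K u ==> Trm K (\<lambda>e. opair (t e) (u e))"
  unfolding opair_eq by (intro dfn)

lemma definable_term_sing [dfn]:
  "Trm K t ==> Trm K (\<lambda>e. sing (t e))"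
  unfolding sing_eq by (intro dfn)

lemma definable_term_Uni [dfn]:
  "Trm K t ==> Trm K (\<lambda>e. Uni (t e))"
  by (rule definable_term_lift1[where f = Uni])
    (unfold definable_term_def Uni_def eq_collect[OF union], intro dfn)

lemma definable_term_Pw [dfn]:
  "Trm K t ==> Trm K (\<lambda>e. Pw (t e))"
proof (rule definable_term_lift1[where f = Pw])
  have "y = Pw x <-> (\<forall>w. w \<epsilon> y <-> w \<sqsubseteq> x)" for x y
    by (auto intro: extensionality)
  then show "Trm K (\<lambda>e. Pw (e 0))"
    unfolding definable_term_def by simp (intro dfn)
qed

lemma definable_term_cup [dfn]:
  "Trm K t ==> Trm K u ==> Trm K (\<lambda>e. cup (t e) (u e))"
  unfolding cup_def by (intro dfn)

lemma succ_eq: "succ x = cup x (upair x x)"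
  by (rule extensionality) auto

lemma definable_term_succ [dfn]:
  "Trm K t ==> Trm K (\<lambda>e. succ (t e))"
  unfolding succ_eq by (intro dfn)

lemma definable_term_emp [dfn]: "Trm K (\<lambda>e. emp)"
  unfolding definable_term_def eq_emp_iff by (intro dfn)

lemma mem_irrefl [simp]: "\<not> x \<epsilon> x"
  using foundation[of "sing x"] by auto

lemma mem_asym: "x \<epsilon> y ==> \<not> y \<epsilon> x"
  using foundation[of "upair x y"] by auto

lemma succ_inject [simp]: "succ x = succ y <-> x = y"
  by (metis mem_asym mem_succ)

section \<open>Functions\<close>

definition prod :: "'a => 'a => 'a" where
  "prod a b = collect (\<lambda>z. \<exists>x y. x \<epsilon> a & y \<epsilon> b & z = opair x y)"

lemma mem_prod: "z \<epsilon> prod a b <-> (\<exists>x y. x \<epsilon> a & y \<epsilon> b & z = opair x y)"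
  unfolding prod_def
proof (rule mem_collect)
  show "\<exists>x y. x \<epsilon> a & y \<epsilon> b & z = opair x y ==> z \<epsilon> Pw (Pw (cup a b))" for z
    by (auto simp: opair_eq subset_def)
qed (intro dfn)

lemma opair_mem_prod [simp]: "opair x y \<epsilon> prod a b <-> x \<epsilon> a & y \<epsilon> b"
  by (simp add: mem_prod)

lemma definable_term_prod [dfn]:
  "Trm K t ==> Trm K u ==> Trm K (\<lambda>e. prod (t e) (u e))"
proof (rule definable_term_lift2[where f = prod])
  have "y = prod a b <-> (\<forall>w. w \<epsilon> y <-> (\<exists>x y. x \<epsilon> a & y \<epsilon> b & w = opair x y))" for a b y
    by (metis mem_prod extensionality)
  then show "Trm K (\<lambda>e. prod (e 0) (e 1))"
    unfolding definable_term_def by simp (intro dfn)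
qed

lemma func_iff:
  "func f a b <-> f \<sqsubseteq> prod a b & (\<forall>x. x \<epsilon> a --> (\<exists>!y. opair x y \<epsilon> f))"
  unfolding is_fun_def is_opair_iff maps_to_iff subset_def mem_prod by simp

lemma definable_func [dfn]:
  "Trm K t ==> Trm K u ==> Trm K v ==>
    Def K (\<lambda>e. func (t e) (u e) (v e))"
  by (rule definable_lift3[where P = "func"])
    (unfold func_iff, intro dfn)

lemma app_eq:
  assumes "func f a b" "opair x y \<epsilon> f"
  shows "app f x = y"
proof -
  have "x \<epsilon> a" using assms by (auto simp: func_iff subset_def)
  with assms show ?thesis unfolding app_def maps_to_iff func_iff by blast
qed

lemma app_mem:
  assumes "func f a b" "x \<epsilon> a"
  shows "opair x (app f x) \<epsilon> f" and "app f x \<epsilon> b"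
proof -
  from assms obtain y where y: "opair x y \<epsilon> f" unfolding func_iff by blast
  with app_eq[OF assms(1)] show *: "opair x (app f x) \<epsilon> f" by simp
  with assms(1) show "app f x \<epsilon> b" by (auto simp: func_iff subset_def)
qed

lemma func_mem_iff:
  "func f a b ==> opair x y \<epsilon> f <-> x \<epsilon> a & app f x = y"
  by (metis app_eq app_mem(1) func_iff opair_mem_prod subset_def)

lemma func_ext:
  assumes "func f a b" "func g a c" "\<And>x. x \<epsilon> a ==> app f x = app g x"
  shows "f = g"
proof (rule extensionality)
  fix z
  have "z \<epsilon> f ==> \<exists>x y. z = opair x y" "z \<epsilon> g ==> \<exists>x y. z = opair x y"
    using assms(1,2) by (auto simp: func_iff subset_def mem_prod)
  then show "z \<epsilon> f <-> z \<epsilon> g"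
    using func_mem_iff[OF assms(1)] func_mem_iff[OF assms(2)] assms(3) by metis
qed

lemma func_range:
  assumes "func f a b" "\<And>x. x \<epsilon> a ==> app f x \<epsilon> c"
  shows "func f a c"
  using assms func_mem_iff[OF assms(1)] unfolding func_iff subset_def mem_prod by metis

lemma func_mono: "func f a b ==> b \<sqsubseteq> c ==> func f a c"
  by (rule func_range, assumption) (blast intro: subsetD app_mem)

text \<open>A total variant of application, so that it is a definable term.\<close>

definition ap :: "'a => 'a => 'a" where
  "ap f x = collect (\<lambda>w. \<exists>y. opair x y \<epsilon> f & w \<epsilon> y)"

lemma mem_ap: "w \<epsilon> ap f x <-> (\<exists>y. opair x y \<epsilon> f & w \<epsilon> y)"
  unfolding ap_def
proof (rule mem_collect)
  show "\<exists>y. opair x y \<epsilon> f & w \<epsilon> y ==> w \<epsilon> Uni (Uni (Uni f))" for w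
    by (auto simp: opair_eq) (metis mem_upair)
qed (intro dfn)

lemma definable_term_ap [dfn]:
  "Trm K t ==> Trm K u ==> Trm K (\<lambda>e. ap (t e) (u e))"
proof (rule definable_term_lift2[where f = ap])
  have "y = ap f x <-> (\<forall>w. w \<epsilon> y <-> (\<exists>y. opair x y \<epsilon> f & w \<epsilon> y))" for f x y
    by (metis mem_ap extensionality)
  then show "Trm K (\<lambda>e. ap (e 0) (e 1))"
    unfolding definable_term_def by simp (intro dfn)
qed

lemma app_eq_ap:
  assumes "func f a b" "x \<epsilon> a"
  shows "app f x = ap f x"
  by (rule extensionality) (simp add: mem_ap func_mem_iff[OF assms(1)] assms(2))

text \<open>The axiom selects only from disjoint families. The sets of all pairs
  \<open>opair x y\<close> with \<open>y\<close> in \<open>b\<close> and \<open>R x y\<close>, one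
  set for each \<open>x\<close> in \<open>a\<close>, are disjoint by their first coordinates, and
  the selected pairs form the graph of the function.\<close>

lemma choice_function:
  assumes "Def UNIV (\<lambda>e. R (e 0) (e 1))" "\<And>x. x \<epsilon> a ==> \<exists>y. y \<epsilon> b & R x y"
  shows "\<exists>f. func f a b & (\<forall>x. x \<epsilon> a --> R x (app f x))"
proof -
  note R = definable_lift2[where P = R, OF assms(1)]
  define F where "F = collect (\<lambda>Y. \<exists>x. x \<epsilon> a & (\<forall>z. z \<epsilon> Y <-> (\<exists>y. y \<epsilon> b & R x y & z = opair x y)))"
  have F: "Y \<epsilon> F <-> (\<exists>x. x \<epsilon> a & (\<forall>z. z \<epsilon> Y <-> (\<exists>y. y \<epsilon> b & R x y & z = opair x y)))" for Y
    unfolding F_def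
  proof (rule mem_collect)
    show "\<exists>x. x \<epsilon> a & (\<forall>z. z \<epsilon> Y <-> (\<exists>y. y \<epsilon> b & R x y & z = opair x y)) ==>
        Y \<epsilon> Pw (prod a b)" for Y
      by (auto simp: subset_def)
  qed (intro dfn R)
  have "\<exists>c. \<forall>x. x \<epsilon> F --> (\<exists>!z. z \<epsilon> x & z \<epsilon> c)"
  proof (rule choice)
    show "\<exists>z. z \<epsilon> x" if "x \<epsilon> F" for x
      using that assms(2) unfolding F by blast
    show "x = y" if "x \<epsilon> F" "y \<epsilon> F" "z \<epsilon> x" "z \<epsilon> y" for x y z
    proof (rule extensionality)
      show "w \<epsilon> x <-> w \<epsilon> y" for w using that unfolding F by auto
    qed
  qed
  then obtain c where c: "\<And>x. x \<epsilon> F ==> \<exists>!z. z \<epsilon> x & z \<epsilon> c" by blast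
  define f where "f = collect (\<lambda>z. \<exists>x y. x \<epsilon> a & y \<epsilon> b & R x y & z = opair x y & z \<epsilon> c)"
  have f: "z \<epsilon> f <-> (\<exists>x y. x \<epsilon> a & y \<epsilon> b & R x y & z = opair x y & z \<epsilon> c)" for z
    unfolding f_def
    by (rule mem_collect[where a = "prod a b"]) (intro dfn R, auto simp: subset_def)
  have ex1: "\<exists>!y. opair x y \<epsilon> f" if x: "x \<epsilon> a" for x
  proof -
    define Y where "Y = collect (\<lambda>z. \<exists>y. y \<epsilon> b & R x y & z = opair x y)"
    have Y: "z \<epsilon> Y <-> (\<exists>y. y \<epsilon> b & R x y & z = opair x y)" for z
      unfolding Y_def
      by (rule mem_collect[where a = "prod a b"]) (intro dfn R, auto simp: x subset_def)
    have "Y \<epsilon> F" unfolding F using Y x by blast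
    from c[OF this] obtain z where z: "z \<epsilon> Y" "z \<epsilon> c"
      and u: "\<And>w. w \<epsilon> Y ==> w \<epsilon> c ==> w = z" by blast
    from z(1) obtain y where y: "y \<epsilon> b" "R x y" "z = opair x y" unfolding Y by blast
    show ?thesis
    proof (rule ex1I[of _ y])
      show "opair x y \<epsilon> f" unfolding f using x y z(2) by blast
    next
      fix y' assume "opair x y' \<epsilon> f"
      then have "opair x y' \<epsilon> Y" "opair x y' \<epsilon> c" unfolding f Y by auto
      from u[OF this] y(3) show "y' = y" by simp
    qed
  qed
  have fn: "func f a b" unfolding func_iff using ex1 by (auto simp: f subset_def)
  moreover have "R x (app f x)" if "x \<epsilon> a" for x
    using app_mem(1)[OF fn that] unfolding f by auto
  ultimately show ?thesis by blast
qed

lemma make_func: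
  assumes "Trm UNIV (\<lambda>e. h (e 0))" "\<And>x. x \<epsilon> a ==> h x \<epsilon> b"
  shows "\<exists>f. func f a b & (\<forall>x. x \<epsilon> a --> app f x = h x)"
proof -
  have "\<exists>f. func f a b & (\<forall>x. x \<epsilon> a --> (app f x) = h x)"
  proof (rule choice_function[where R = "\<lambda>x y. y = h x"])
    show "Def UNIV (\<lambda>e. e 1 = h (e 0))"
      by (intro dfn definable_term_lift1[where f = h, OF assms(1)])
  qed (use assms(2) in auto)
  then show ?thesis by simp
qed

lemma func_update:
  assumes f: "func f a b" and "i \<epsilon> a" "y \<epsilon> b"
  shows "\<exists>g. func g a b & app g i = y & (\<forall>x. x \<epsilon> a & x ~= i --> app g x = app f x)"
proof -
  define R where "R x z <-> x = i & z = y | x ~= i & opair x z \<epsilon> f" for x z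
  have "\<exists>g. func g a b & (\<forall>x. x \<epsilon> a --> R x (app g x))"
  proof (rule choice_function)
    show "Def UNIV (\<lambda>e. R (e 0) (e 1))" unfolding R_def by (intro dfn)
    show "\<exists>z. z \<epsilon> b & R x z" if "x \<epsilon> a" for x
      using app_mem[OF f that] assms(3) unfolding R_def by (cases "x = i") auto
  qed
  then obtain g where g: "func g a b" "\<And>x. x \<epsilon> a ==> R x (app g x)" by blast
  have "app g i = y" using g(2)[OF assms(2)] by (simp add: R_def)
  moreover have "app g x = app f x" if "x \<epsilon> a" "x ~= i" for x
    using g(2)[OF that(1)] that(2) app_eq[OF f] by (auto simp: R_def)
  ultimately show ?thesis using g(1) by blast
qed


section \<open>Ordinals\<close>

lemma transitive_iff: "transitive x <-> (\<forall>y. y \<epsilon> x --> y \<sqsubseteq> x)"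
  by (simp add: transitive_set_def subset_def)

lemma definable_transitive [dfn]:
  "Trm K t ==> Def K (\<lambda>e. transitive (t e))"
  unfolding transitive_iff
  by (rule definable_lift1[where P = "\<lambda>x. \<forall>y. y \<epsilon> x --> y \<sqsubseteq> x"]) (intro dfn)

lemma Ord_iff: "Ord x <-> (\<forall>y. y \<epsilon> x --> y \<sqsubseteq> x & (\<forall>z. z \<epsilon> y --> z \<sqsubseteq> y))"
  by (auto simp: ordinal_def transitive_iff)

lemma definable_Ord [dfn]:
  "Trm K t ==> Def K (\<lambda>e. Ord (t e))"
  unfolding Ord_iff
  by (rule definable_lift1[where P = "\<lambda>x. \<forall>y. y \<epsilon> x --> y \<sqsubseteq> x & (\<forall>z. z \<epsilon> y --> z \<sqsubseteq> y)"]) (intro dfn)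

lemma Ord_mem: "Ord x ==> y \<epsilon> x ==> Ord y"
  unfolding Ord_iff subset_def by blast

lemma Ord_trans: "Ord x ==> y \<epsilon> x ==> z \<epsilon> y ==> z \<epsilon> x"
  unfolding Ord_iff subset_def by blast

lemma OrdI: "(\<And>y z. y \<epsilon> x ==> z \<epsilon> y ==> z \<epsilon> x) ==> (\<And>y. y \<epsilon> x ==> Ord y) ==> Ord x"
  unfolding ordinal_def transitive_iff subset_def by blast

lemma Ord_emp: "Ord (emp)"
  by (rule OrdI) auto

lemma Ord_succ: "Ord x ==> Ord (succ x)"
  by (rule OrdI) (auto intro: Ord_mem Ord_trans)

lemma Ord_Uni: "(\<And>y. y \<epsilon> x ==> Ord y) ==> Ord (Uni x)"
  by (rule OrdI) (simp_all, blast intro: Ord_trans, blast intro: Ord_mem)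

text \<open>The ordinals of the model need not be well-ordered from outside. Definability makes the
  candidates below \<open>a\<close> a set, and Foundation gives a minimal one.\<close>

lemma Ord_least:
  assumes P: "Def UNIV (\<lambda>e. P (e 0))" and "Ord a" "P a"
  shows "\<exists>m. Ord m & P m & (\<forall>b. b \<epsilon> m --> \<not> P b)"
proof (cases "\<exists>b. b \<epsilon> a & P b")
  case True
  obtain s where s: "\<And>x. x \<epsilon> s <-> x \<epsilon> a & P x"
    using separation'[OF P] by blast
  with True have "\<exists>y. y \<epsilon> s" by blast
  from foundation[OF this] obtain m where "m \<epsilon> s" "\<And>z. z \<epsilon> m ==> \<not> z \<epsilon> s" by blast
  with s assms(2) show ?thesis by (metis Ord_mem Ord_trans)
next
  case False
  with assms show ?thesis by blast
qed

lemma Ord_induct: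
  assumes "Def UNIV (\<lambda>e. P (e 0))" "Ord a"
    and step: "\<And>x. Ord x ==> (\<And>y. y \<epsilon> x ==> P y) ==> P x"
  shows "P a"
proof (rule ccontr)
  assume "\<not> P a"
  from Ord_least[OF definable_not[OF assms(1)] assms(2) this] step show False by blast
qed

lemma Ord_linear:
  assumes "Ord a" "Ord b"
  shows "a \<epsilon> b | a = b | b \<epsilon> a"
proof -
  have "\<forall>b. Ord b --> a \<epsilon> b | a = b | b \<epsilon> a"
  proof (rule Ord_induct[where P = "\<lambda>a. \<forall>b. Ord b --> a \<epsilon> b | a = b | b \<epsilon> a", OF _ assms(1)])
    fix x assume x: "Ord x"
      and IH: "\<And>y. y \<epsilon> x ==> \<forall>b. Ord b --> y \<epsilon> b | y = b | b \<epsilon> y"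
    have "x \<epsilon> b | x = b | b \<epsilon> x" if "Ord b" for b
    proof (rule Ord_induct[where P = "\<lambda>b. x \<epsilon> b | x = b | b \<epsilon> x", OF _ that])
      fix b assume b: "Ord b" and IHb: "\<And>y. y \<epsilon> b ==> x \<epsilon> y | x = y | y \<epsilon> x"
      show "x \<epsilon> b | x = b | b \<epsilon> x"
      proof (rule ccontr)
        assume n: "\<not> ?thesis"
        have "w \<epsilon> x" if "w \<epsilon> b" for w using IHb[OF that] n Ord_trans[OF b that] that by blast
        moreover have "w \<epsilon> b" if "w \<epsilon> x" for w
          using IH[OF that] b n Ord_trans[OF x that] that by blast
        ultimately have "x = b" by (blast intro: extensionality)
        with n show False by blast
      qed
    qed (intro dfn)
    then show "\<forall>b. Ord b --> x \<epsilon> b | x = b | b \<epsilon> x" by blast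
  qed (intro dfn)
  with assms show ?thesis by blast
qed

lemma Ord_mem_succ: "Ord a ==> Ord b ==> \<not> b \<epsilon> a ==> a \<epsilon> succ b"
  using Ord_linear by auto

lemma Ord_mem_succ_Uni:
  assumes "\<And>y. y \<epsilon> x ==> Ord y" "a \<epsilon> x"
  shows "a \<epsilon> succ (Uni x)"
proof (rule Ord_mem_succ)
  show "\<not> Uni x \<epsilon> a" using assms(2) mem_irrefl[of "Uni x"] mem_Uni[of "Uni x" x] by blast
qed (use assms Ord_Uni in auto)

lemma Ord_max:
  assumes "Ord l" "a \<epsilon> l" "b \<epsilon> l"
  obtains c where "c \<epsilon> l" "a \<epsilon> succ c" "b \<epsilon> succ c"
  by (metis assms Ord_linear Ord_mem mem_succ)

lemma limit_iff:
  "limit x <-> Ord x & (\<exists>y. y \<epsilon> x) & (\<forall>y. y \<epsilon> x --> (\<exists>z. z \<epsilon> x & y \<epsilon> z))"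
  by (simp add: limit_ordinal_def)

lemma definable_limit [dfn]:
  "Trm K t ==> Def K (\<lambda>e. limit (t e))"
  by (rule definable_lift1[where P = "limit"])
    (unfold limit_iff, intro dfn)

lemma limit_succ:
  assumes "limit l" "x \<epsilon> l"
  shows "succ x \<epsilon> l"
proof -
  from assms obtain z where z: "z \<epsilon> l" "x \<epsilon> z" and l: "Ord l" unfolding limit_iff by blast
  have "Ord z" "Ord x" using Ord_mem l z(1) assms(2) by blast+
  then have "succ x \<epsilon> z | succ x = z | z \<epsilon> succ x"
    using Ord_linear Ord_succ by blast
  with z l show ?thesis by (metis Ord_trans mem_asym mem_irrefl mem_succ)
qed

lemma limit_Ord: "limit l ==> Ord l"
  by (simp add: limit_iff)

lemma limit_emp:
  assumes "limit l"
  shows "emp \<epsilon> l"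
proof -
  from assms obtain y where "y \<epsilon> l" "Ord l" unfolding limit_iff by blast
  with Ord_linear[OF Ord_emp, of l] show ?thesis by auto
qed

abbreviation \<omega> where "\<omega> == omega E"

lemma omega_least: "limit \<omega> & (\<forall>v. v \<epsilon> \<omega> --> \<not> limit v)"
proof -
  obtain i where i: "emp \<epsilon> i" "\<And>y. y \<epsilon> i ==> succ y \<epsilon> i"
  proof -
    obtain x z where xz: "z \<epsilon> x" "\<forall>w. \<not> w \<epsilon> z"
      "\<And>y. y \<epsilon> x ==> \<exists>z. z \<epsilon> x & (\<forall>w. w \<epsilon> z <-> w \<epsilon> y | w = y)"
      using infinity by blast
    have "emp \<epsilon> x" using xz(1,2) eq_emp_iff by metis
    moreover have "succ y \<epsilon> x" if "y \<epsilon> x" for y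
    proof -
      from xz(3)[OF \<open>y \<epsilon> x\<close>]
      obtain z where "z \<epsilon> x" "\<forall>w. w \<epsilon> z <-> w \<epsilon> y | w = y" by blast
      moreover from this have "z = succ y" by (auto intro: extensionality)
      ultimately show ?thesis by simp
    qed
    ultimately show ?thesis using that by blast
  qed
  have "Def UNIV (\<lambda>e. Ord (e 0))" by (intro dfn)
  from separation'[where P = "Ord", OF this]
  obtain s where s: "\<And>x. x \<epsilon> s <-> x \<epsilon> i & Ord x" by blast
  have "limit (Uni s)"
    unfolding limit_iff
  proof (intro conjI allI impI)
    show "Ord (Uni s)" by (rule Ord_Uni) (simp add: s)
    have *: "x \<epsilon> Uni s" if "x \<epsilon> s" for x
      using that by (auto simp: s intro!: exI[of _ "succ x"] i Ord_succ)
    from *[of "emp"] show "\<exists>y. y \<epsilon> Uni s" using i s Ord_emp by blast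
    fix y assume "y \<epsilon> Uni s"
    then obtain x where "x \<epsilon> s" "y \<epsilon> x" by auto
    with * show "\<exists>z. z \<epsilon> Uni s & y \<epsilon> z" by blast
  qed
  then obtain m where m: "limit m" "\<forall>b. b \<epsilon> m --> \<not> limit b"
  proof -
    have "Def UNIV (\<lambda>e. limit (e 0))" by (intro dfn)
    from Ord_least[where P = "limit", OF this limit_Ord] that
      \<open>limit (Uni s)\<close> show ?thesis by blast
  qed
  have "\<omega> = m"
    unfolding omega_def
  proof (rule the_equality)
    fix w assume w: "limit w & (\<forall>v. v \<epsilon> w --> \<not> limit v)"
    then show "w = m" using m Ord_linear[of w m] limit_Ord by blast
  qed (use m in blast)
  with m show ?thesis by simp
qed

lemmas limit_omega = omega_least[THEN conjunct1]
lemmas Ord_omega = limit_Ord[OF limit_omega]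
lemmas omega_succ = limit_succ[OF limit_omega]
lemmas omega_emp = limit_emp[OF limit_omega]

lemma definable_term_omega [dfn]: "Trm K (\<lambda>e. \<omega>)"
proof -
  have "x = \<omega> <-> limit x & (\<forall>v. v \<epsilon> x --> \<not> limit v)" for x
    using omega_least Ord_linear limit_Ord by blast
  then show ?thesis unfolding definable_term_def by simp (intro dfn)
qed

lemma omega_cases:
  assumes "n \<epsilon> \<omega>"
  obtains "n = emp" | m where "m \<epsilon> \<omega>" "n = succ m"
proof -
  have o: "Ord n" using Ord_mem[OF Ord_omega assms] .
  have "\<not> limit n" using omega_least assms by blast
  with o consider "n = emp" | m where "m \<epsilon> n" "\<And>z. z \<epsilon> n ==> \<not> m \<epsilon> z"
    unfolding limit_iff eq_emp_iff by blast
  then show ?thesis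
  proof cases
    case 2
    have "n = succ m"
    proof (rule extensionality)
      fix z show "z \<epsilon> n <-> z \<epsilon> succ m"
        using 2 o Ord_linear[of z m] Ord_mem[OF o] Ord_trans[OF o] by auto
    qed
    with 2 that show ?thesis using Ord_trans[OF Ord_omega assms] by blast
  qed (rule that)
qed

lemma omega_induct:
  assumes "Def UNIV (\<lambda>e. P (e 0))" "n \<epsilon> \<omega>" "P (emp)"
    and "\<And>n. n \<epsilon> \<omega> ==> P n ==> P (succ n)"
  shows "P n"
proof -
  have "n \<epsilon> \<omega> --> P n"
  proof (rule Ord_induct[where P = "\<lambda>n. n \<epsilon> \<omega> --> P n"])
    show "Ord n" using Ord_mem[OF Ord_omega assms(2)] .
    fix x assume IH: "\<And>y. y \<epsilon> x ==> y \<epsilon> \<omega> --> P y"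
    show "x \<epsilon> \<omega> --> P x"
    proof
      assume "x \<epsilon> \<omega>"
      then show "P x"
      proof (cases rule: omega_cases)
        case (2 m)
        with IH[of m] assms(4) show ?thesis by simp
      qed (simp add: assms(3))
    qed
  qed (intro dfn assms)
  with assms(2) show ?thesis by simp
qed

section \<open>Iteration, transitive closure and induction on membership\<close>

text \<open>\<open>g\<close> is a class function, so the values are bounded only by Replacement. An
  approximation \<open>h\<close> is any set of pairs in which each pair is justified by a pair one
  step earlier. It need not be a function or have an initial segment as domain, so adding a
  justified pair always gives another approximation; uniqueness of the values is left to
  induction.\<close>

lemma omega_iterate:
  assumes g: "Trm UNIV (\<lambda>e. g (e 0))"
  shows "\<exists>f b. func f \<omega> b & app f emp = a &
    (\<forall>n. n \<epsilon> \<omega> --> app f (succ n) = g (app f n))"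
proof -
  note g' = definable_term_lift1[where f = g, OF g]
  define D where "D h <-> (\<forall>y. opair emp y \<epsilon> h --> y = a) &
    (\<forall>k y. opair (succ k) y \<epsilon> h --> (\<exists>z. opair k z \<epsilon> h & y = g z))" for h
  define I where "I n y <-> (\<exists>h. D h & opair n y \<epsilon> h)" for n y
  have dI: "Def UNIV (\<lambda>e. I (e 0) (e 1))"
    unfolding I_def D_def by (intro dfn g')
  note dI' = definable_lift2[where P = I, OF dI]
  have I0: "I emp y <-> y = a" for y
    unfolding I_def D_def
    by (auto intro!: exI[of _ "sing (opair emp a)"])
  have ISucc: "I (succ n) y <-> (\<exists>z. I n z & y = g z)" for n y
  proof
    assume "\<exists>z. I n z & y = g z"
    then obtain h z where h: "D h" "opair n z \<epsilon> h" "y = g z" unfolding I_def by blast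
    then have "D (cup h (sing (opair (succ n) y)))"
      unfolding D_def by simp blast
    then show "I (succ n) y" unfolding I_def
      by (intro exI[of _ "cup h (sing (opair (succ n) y))"]) simp
  qed (unfold I_def D_def, blast)
  have ex1: "\<exists>!y. I n y" if "n \<epsilon> \<omega>" for n
  proof (rule omega_induct[where P = "\<lambda>n. \<exists>!y. I n y", OF _ that])
    show "\<exists>!y. I emp y" by (simp add: I0)
    show "\<exists>!y. I (succ n) y" if "\<exists>!y. I n y" for n
      unfolding ISucc using that by auto
  qed (intro dfn dI')
  obtain b where b: "\<And>n. n \<epsilon> \<omega> ==> \<exists>y. y \<epsilon> b & I n y"
    using replacement'[OF dI, of \<omega>] ex1 by blast
  obtain f where f: "func f \<omega> b" "\<And>n. n \<epsilon> \<omega> ==> I n (app f n)"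
    using choice_function[OF dI b] by blast
  have "app f emp = a" using f(2)[OF omega_emp] I0 by simp
  moreover have "app f (succ n) = g (app f n)" if "n \<epsilon> \<omega>" for n
    using ex1[OF omega_succ[OF that]] f(2)[OF that] f(2)[OF omega_succ[OF that]] ISucc by blast
  ultimately show ?thesis using f(1) by blast
qed

lemma trcl_props:
  "transitive (trcl x) & x \<sqsubseteq> trcl x &
    (\<forall>u. transitive u & x \<sqsubseteq> u --> trcl x \<sqsubseteq> u)"
proof -
  obtain f b where f: "func f \<omega> b" "app f emp = x"
    "\<And>n. n \<epsilon> \<omega> ==> app f (succ n) = Uni (app f n)"
  proof -
    have "Trm UNIV (\<lambda>e. Uni (e 0))" by (intro dfn)
    from omega_iterate[where g = Uni, OF this] that show ?thesis by blast
  qed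
  define s where "s = collect (\<lambda>z. \<exists>n. n \<epsilon> \<omega> & z \<epsilon> ap f n)"
  have s: "z \<epsilon> s <-> (\<exists>n. n \<epsilon> \<omega> & z \<epsilon> app f n)" for z
  proof -
    have "z \<epsilon> s <-> (\<exists>n. n \<epsilon> \<omega> & z \<epsilon> ap f n)"
      unfolding s_def
    proof (rule mem_collect[where a = "Uni b"])
      show "z \<epsilon> Uni b" if "\<exists>n. n \<epsilon> \<omega> & z \<epsilon> ap f n" for z
        using that app_mem(2)[OF f(1)] app_eq_ap[OF f(1)] by (metis mem_Uni)
    qed (intro dfn)
    then show ?thesis using app_eq_ap[OF f(1)] by auto
  qed
  have "transitive s"
    unfolding transitive_iff
  proof (intro allI impI subsetI)
    fix y z assume "y \<epsilon> s" "z \<epsilon> y"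
    then obtain n where "n \<epsilon> \<omega>" "z \<epsilon> Uni (app f n)" by (auto simp: s)
    then show "z \<epsilon> s" unfolding s using f(3) omega_succ by metis
  qed
  moreover have "x \<sqsubseteq> s" using f(2) omega_emp by (auto simp: subset_def s)
  moreover have "s \<sqsubseteq> u" if u: "transitive u" "x \<sqsubseteq> u" for u
  proof -
    have "ap f n \<sqsubseteq> u & n \<epsilon> \<omega>" if "n \<epsilon> \<omega>" for n
      using that
    proof (rule omega_induct[where P = "\<lambda>n. ap f n \<sqsubseteq> u & n \<epsilon> \<omega>", rotated])
      show "ap f emp \<sqsubseteq> u & emp \<epsilon> \<omega>"
        using f(2) u(2) app_eq_ap[OF f(1) omega_emp] omega_emp by simp
      show "ap f (succ n) \<sqsubseteq> u & succ n \<epsilon> \<omega>" if "n \<epsilon> \<omega>" "ap f n \<sqsubseteq> u & n \<epsilon> \<omega>" for n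
        using that f(3)[OF that(1)] app_eq_ap[OF f(1) that(1)] u(1) omega_succ[OF that(1)]
          app_eq_ap[OF f(1) omega_succ[OF that(1)]] by (auto simp: subset_def transitive_iff)
    qed (intro dfn)
    then show ?thesis using app_eq_ap[OF f(1)] by (auto simp: subset_def s)
  qed
  ultimately have "transitive s & x \<sqsubseteq> s &
    (\<forall>u. transitive u & x \<sqsubseteq> u --> s \<sqsubseteq> u)" by blast
  moreover from this have "trcl x = s"
    unfolding trcl_def by (intro the_equality) (blast intro: subset_antisym)+
  ultimately show ?thesis by simp
qed

text \<open>Foundation speaks of sets, so the counterexamples are cut down to the transitive closure
  of \<open>sing a\<close>. A minimal one there is minimal outright, because all its members are in
  the closure too.\<close>

lemma mem_induct:
  assumes "Def UNIV (\<lambda>e. P (e 0))" "\<And>x. (\<And>y. y \<epsilon> x ==> P y) ==> P x"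
  shows "P a"
proof (rule ccontr)
  assume a: "\<not> P a"
  let ?t = "trcl (sing a)"
  obtain s where s: "\<And>x. x \<epsilon> s <-> x \<epsilon> ?t & \<not> P x"
    using separation'[OF definable_not[OF assms(1)]] by blast
  have "a \<epsilon> ?t" using trcl_props[of "sing a"] by (auto simp: subset_def)
  with s a have "\<exists>y. y \<epsilon> s" by blast
  from foundation[OF this] obtain m where m: "m \<epsilon> s" "\<And>z. z \<epsilon> m ==> \<not> z \<epsilon> s" by blast
  have "P y" if "y \<epsilon> m" for y
    using m s that trcl_props[of "sing a"] by (metis transitive_iff subset_def)
  with assms(2) m s show False by blast
qed

section \<open>The cumulative hierarchy\<close>

text \<open>The recursion runs over all sets and not only over ordinals, so that \<open>V\<close>
  becomes a definable term without side conditions. As in \<open>omega_iterate\<close>, an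
  approximation is a possibly multivalued set of justified pairs; the last clause makes its domain
  closed under membership.\<close>

definition rec_graph :: "'a => bool" where
  "rec_graph h <-> (\<forall>\<beta> v. opair \<beta> v \<epsilon> h -->
     (\<forall>x. x \<epsilon> v <-> (\<exists>\<gamma> w. \<gamma> \<epsilon> \<beta> & opair \<gamma> w \<epsilon> h & x \<sqsubseteq> w)) &
     (\<forall>\<gamma>. \<gamma> \<epsilon> \<beta> --> (\<exists>w. opair \<gamma> w \<epsilon> h)))"

definition is_V :: "'a => 'a => bool" where
  "is_V \<alpha> v <-> (\<exists>h. rec_graph h & opair \<alpha> v \<epsilon> h)"

definition V :: "'a => 'a" where
  "V \<alpha> = (THE v. is_V \<alpha> v)"

lemma definable_is_V:
  "Trm K t ==> Trm K u ==> Def K (\<lambda>e. is_V (t e) (u e))"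
  by (rule definable_lift2[where P = is_V])
    (unfold is_V_def rec_graph_def, intro dfn)

lemma is_V_unique: "is_V \<alpha> v ==> is_V \<alpha> w ==> v = w"
proof -
  have "\<forall>v w. is_V \<alpha> v --> is_V \<alpha> w --> v = w"
  proof (rule mem_induct[where P = "\<lambda>\<alpha>. \<forall>v w. is_V \<alpha> v --> is_V \<alpha> w --> v = w"])
    fix \<alpha> assume IH: "\<And>\<gamma>. \<gamma> \<epsilon> \<alpha> ==> \<forall>v w. is_V \<gamma> v --> is_V \<gamma> w --> v = w"
    show "\<forall>v w. is_V \<alpha> v --> is_V \<alpha> w --> v = w"
    proof (intro allI impI)
      fix v w assume "is_V \<alpha> v" "is_V \<alpha> w"
      then obtain g h where g: "rec_graph g" "opair \<alpha> v \<epsilon> g" and h: "rec_graph h" "opair \<alpha> w \<epsilon> h"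
        unfolding is_V_def by blast
      have eq: "opair \<gamma> u \<epsilon> g <-> opair \<gamma> u \<epsilon> h" if "\<gamma> \<epsilon> \<alpha>" for \<gamma> u
      proof -
        from g h that obtain a b where "opair \<gamma> a \<epsilon> g" "opair \<gamma> b \<epsilon> h"
          unfolding rec_graph_def by blast
        with IH[OF that] g h show ?thesis unfolding is_V_def by blast
      qed
      have "x \<epsilon> v <-> (\<exists>\<gamma> u. \<gamma> \<epsilon> \<alpha> & opair \<gamma> u \<epsilon> g & x \<sqsubseteq> u)"
        "x \<epsilon> w <-> (\<exists>\<gamma> u. \<gamma> \<epsilon> \<alpha> & opair \<gamma> u \<epsilon> h & x \<sqsubseteq> u)" for x
        using g h unfolding rec_graph_def by blast+
      then have "x \<epsilon> v <-> x \<epsilon> w" for x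
        by (simp add: eq cong: conj_cong)
      then show "v = w" by (rule extensionality)
    qed
  qed (intro dfn definable_is_V)
  then show "is_V \<alpha> v ==> is_V \<alpha> w ==> v = w" by blast
qed

lemma is_V_unfold:
  assumes "is_V \<alpha> v"
  shows "x \<epsilon> v <-> (\<exists>\<gamma> w. \<gamma> \<epsilon> \<alpha> & is_V \<gamma> w & x \<sqsubseteq> w)" "\<gamma> \<epsilon> \<alpha> ==> \<exists>w. is_V \<gamma> w"
proof -
  from assms obtain h where h: "rec_graph h" "opair \<alpha> v \<epsilon> h" unfolding is_V_def by blast
  have *: "opair \<gamma> w \<epsilon> h <-> is_V \<gamma> w" if "\<gamma> \<epsilon> \<alpha>" for \<gamma> w
  proof -
    from h that obtain w' where "opair \<gamma> w' \<epsilon> h" unfolding rec_graph_def by blast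
    with h(1) is_V_unique[of \<gamma>] show ?thesis unfolding is_V_def by blast
  qed
  have "x \<epsilon> v <-> (\<exists>\<gamma> u. \<gamma> \<epsilon> \<alpha> & opair \<gamma> u \<epsilon> h & x \<sqsubseteq> u)"
    using h unfolding rec_graph_def by blast
  then show "x \<epsilon> v <-> (\<exists>\<gamma> w. \<gamma> \<epsilon> \<alpha> & is_V \<gamma> w & x \<sqsubseteq> w)"
    by (simp add: * cong: conj_cong)
  from h * show "\<gamma> \<epsilon> \<alpha> ==> \<exists>w. is_V \<gamma> w" unfolding rec_graph_def by blast
qed

lemma is_V_ex: "\<exists>v. is_V \<alpha> v"
proof (rule mem_induct[where P = "\<lambda>\<alpha>. \<exists>v. is_V \<alpha> v"])
  fix \<alpha> assume IH: "\<And>\<gamma>. \<gamma> \<epsilon> \<alpha> ==> \<exists>v. is_V \<gamma> v"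
  \<comment> \<open>The graph under construction must be closed downwards, so members of members of
    \<alpha> are needed as well; hence the transitive closure.\<close>
  obtain s where s: "\<And>\<gamma>. \<gamma> \<epsilon> s <-> \<gamma> \<epsilon> trcl \<alpha> & (\<exists>v. is_V \<gamma> v)"
  proof -
    have "Def UNIV (\<lambda>e. \<exists>v. is_V (e 0) v)" by (intro dfn definable_is_V)
    from separation'[where P = "\<lambda>\<gamma>. \<exists>v. is_V \<gamma> v", OF this] show ?thesis using that by blast
  qed
  have dV: "Def UNIV (\<lambda>e. is_V (e 0) (e 1))" by (intro dfn definable_is_V)
  have "\<exists>!w. is_V \<gamma> w" if "\<gamma> \<epsilon> s" for \<gamma>
    using that is_V_unique unfolding s by blast
  from replacement'[OF dV this] obtain b where b: "\<And>\<gamma>. \<gamma> \<epsilon> s ==> \<exists>w. w \<epsilon> b & is_V \<gamma> w"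
    by blast
  have b': "w \<epsilon> b" if "\<gamma> \<epsilon> s" "is_V \<gamma> w" for \<gamma> w
    using b[OF that(1)] is_V_unique that(2) by blast
  have \<alpha>s: "\<gamma> \<epsilon> s" if "\<gamma> \<epsilon> \<alpha>" for \<gamma>
    using that IH trcl_props[of \<alpha>] unfolding s by (blast dest: subsetD)
  define v where "v = collect (\<lambda>x. \<exists>\<gamma> w. \<gamma> \<epsilon> \<alpha> & is_V \<gamma> w & x \<sqsubseteq> w)"
  have v: "x \<epsilon> v <-> (\<exists>\<gamma> w. \<gamma> \<epsilon> \<alpha> & is_V \<gamma> w & x \<sqsubseteq> w)" for x
    unfolding v_def
  proof (rule mem_collect[where a = "Pw (Uni b)"])
    show "x \<epsilon> Pw (Uni b)" if "\<exists>\<gamma> w. \<gamma> \<epsilon> \<alpha> & is_V \<gamma> w & x \<sqsubseteq> w" for x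
    proof -
      from that obtain \<gamma> w where "\<gamma> \<epsilon> \<alpha>" "is_V \<gamma> w" "x \<sqsubseteq> w" by blast
      with b'[OF \<alpha>s] show ?thesis by (auto simp: subset_def)
    qed
  qed (intro dfn definable_is_V)
  define h where
    "h = collect (\<lambda>z. (\<exists>\<gamma> w. \<gamma> \<epsilon> s & is_V \<gamma> w & z = opair \<gamma> w) | z = opair \<alpha> v)"
  have h: "z \<epsilon> h <-> (\<exists>\<gamma> w. \<gamma> \<epsilon> s & is_V \<gamma> w & z = opair \<gamma> w) | z = opair \<alpha> v" for z
    unfolding h_def
  proof (rule mem_collect[where a = "cup (prod s b) (sing (opair \<alpha> v))"])
    show "z \<epsilon> cup (prod s b) (sing (opair \<alpha> v))"
      if "(\<exists>\<gamma> w. \<gamma> \<epsilon> s & is_V \<gamma> w & z = opair \<gamma> w) | z = opair \<alpha> v" for z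
      using that b' by auto
  qed (intro dfn definable_is_V)
  have low: "\<delta> \<epsilon> s" if "\<gamma> \<epsilon> s" "\<delta> \<epsilon> \<gamma>" for \<gamma> \<delta>
  proof -
    from that(1) obtain w where "is_V \<gamma> w" "\<gamma> \<epsilon> trcl \<alpha>" unfolding s by blast
    with is_V_unfold(2)[OF this(1) that(2)] that(2) trcl_props[of \<alpha>] show ?thesis
      unfolding s transitive_iff subset_def by blast
  qed
  show "\<exists>v. is_V \<alpha> v"
  proof (cases "\<alpha> \<epsilon> s")
    case False
    have h': "opair \<gamma> w \<epsilon> h <-> is_V \<gamma> w" if "\<gamma> \<epsilon> s" for \<gamma> w
      using False that by (auto simp: h)
    have "rec_graph h"
      unfolding rec_graph_def
    proof (intro allI impI)
      fix \<beta> u assume bu: "opair \<beta> u \<epsilon> h"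
      have sub: "\<gamma> \<epsilon> s" if "\<gamma> \<epsilon> \<beta>" for \<gamma>
        using bu that low \<alpha>s unfolding h by auto
      have "x \<epsilon> u <-> (\<exists>\<gamma> w. \<gamma> \<epsilon> \<beta> & is_V \<gamma> w & x \<sqsubseteq> w)" for x
        using bu is_V_unfold(1)[of \<beta> u x] v[of x] unfolding h by auto
      moreover have "\<exists>w. is_V \<gamma> w" if "\<gamma> \<epsilon> \<beta>" for \<gamma>
        using sub[OF that] unfolding s by blast
      ultimately show "(\<forall>x. (x \<epsilon> u) = (\<exists>\<gamma> w. \<gamma> \<epsilon> \<beta> & opair \<gamma> w \<epsilon> h & x \<sqsubseteq> w)) &
         (\<forall>\<gamma>. \<gamma> \<epsilon> \<beta> --> (\<exists>w. opair \<gamma> w \<epsilon> h))"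
        by (simp add: h' sub cong: conj_cong)
    qed
    then show ?thesis unfolding is_V_def using h by blast
  qed (simp add: s)
qed (intro dfn definable_is_V)

lemma is_V_iff: "is_V \<alpha> v <-> v = V \<alpha>"
proof -
  from is_V_ex is_V_unique have "\<exists>!v. is_V \<alpha> v" by blast
  from theI'[OF this] show ?thesis unfolding V_def using is_V_unique by blast
qed

lemma mem_V: "x \<epsilon> V \<alpha> <-> (\<exists>\<gamma>. \<gamma> \<epsilon> \<alpha> & x \<sqsubseteq> V \<gamma>)"
  using is_V_unfold(1)[of \<alpha> "V \<alpha>" x] by (simp add: is_V_iff)

lemma definable_term_V [dfn]:
  "Trm K t ==> Trm K (\<lambda>e. V (t e))"
  by (rule definable_term_lift1[where f = V])
    (unfold definable_term_def is_V_iff[symmetric], intro dfn definable_is_V)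

lemma Vset_eq:
  assumes "Ord \<alpha>"
  shows "Vset \<alpha> = V \<alpha>"
  unfolding Vset_def
proof (rule the_equality)
  let ?rec = "\<lambda>f. \<forall>\<beta>. \<beta> \<epsilon> succ \<alpha> -->
    (\<forall>x. x \<epsilon> app f \<beta> <-> (\<exists>\<gamma>. \<gamma> \<epsilon> \<beta> & x \<sqsubseteq> app f \<gamma>))"
  have low: "\<gamma> \<epsilon> succ \<alpha>" if "\<gamma> \<epsilon> \<beta>" "\<beta> \<epsilon> succ \<alpha>" for \<beta> \<gamma>
    using that Ord_trans[OF Ord_succ[OF assms]] by blast
  have "\<exists>b. \<forall>x. x \<epsilon> succ \<alpha> --> (\<exists>y. y \<epsilon> b & y = V x)"
    by (rule replacement'[where R = "\<lambda>x y. y = V x"]) (intro dfn, blast)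
  then obtain b where "\<And>x. x \<epsilon> succ \<alpha> ==> V x \<epsilon> b" by metis
  then obtain f where f: "func f (succ \<alpha>) b" "\<And>x. x \<epsilon> succ \<alpha> ==> app f x = V x"
  proof -
    have "Trm UNIV (\<lambda>e. V (e 0))" by (intro dfn)
    from make_func[where h = V, OF this] that \<open>\<And>x. x \<epsilon> succ \<alpha> ==> V x \<epsilon> b\<close>
    show ?thesis by blast
  qed
  have "?rec f"
  proof (intro allI impI)
    fix \<beta> x assume b: "\<beta> \<epsilon> succ \<alpha>"
    have "app f \<gamma> = V \<gamma>" if "\<gamma> \<epsilon> \<beta>" for \<gamma> using f(2) low[OF that b] by blast
    then show "x \<epsilon> app f \<beta> <-> (\<exists>\<gamma>. \<gamma> \<epsilon> \<beta> & x \<sqsubseteq> app f \<gamma>)"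
      unfolding f(2)[OF b] mem_V[of x] by auto
  qed
  then show "\<exists>f b. func f (succ \<alpha>) b & ?rec f & app f \<alpha> = V \<alpha>"
    using f by (metis mem_succ)
  fix v assume "\<exists>f b. func f (succ \<alpha>) b & ?rec f & app f \<alpha> = v"
  then obtain g c where g: "func g (succ \<alpha>) c" "?rec g" "app g \<alpha> = v" by blast
  have "\<beta> \<epsilon> succ \<alpha> --> ap g \<beta> = V \<beta>" for \<beta>
  proof (rule mem_induct[where P = "\<lambda>\<beta>. \<beta> \<epsilon> succ \<alpha> --> ap g \<beta> = V \<beta>"])
    fix \<beta> assume IH: "\<And>\<gamma>. \<gamma> \<epsilon> \<beta> ==> \<gamma> \<epsilon> succ \<alpha> --> ap g \<gamma> = V \<gamma>"
    show "\<beta> \<epsilon> succ \<alpha> --> ap g \<beta> = V \<beta>"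
    proof
      assume b: "\<beta> \<epsilon> succ \<alpha>"
      have "app g \<gamma> = V \<gamma>" if "\<gamma> \<epsilon> \<beta>" for \<gamma>
        using IH[OF that, THEN mp, OF low[OF that b]] app_eq_ap[OF g(1) low[OF that b]] by simp
      moreover have "x \<epsilon> app g \<beta> <-> (\<exists>\<gamma>. \<gamma> \<epsilon> \<beta> & x \<sqsubseteq> app g \<gamma>)" for x
        using g(2) b by blast
      ultimately have "x \<epsilon> app g \<beta> <-> x \<epsilon> V \<beta>" for x
        by (simp add: mem_V[of x \<beta>] cong: conj_cong)
      then show "ap g \<beta> = V \<beta>" using app_eq_ap[OF g(1) b] by (auto intro: extensionality)
    qed
  qed (intro dfn)
  then show "v = V \<alpha>" using g app_eq_ap[OF g(1), of \<alpha>] by simp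
qed

lemma V_transitive:
  assumes "Ord \<alpha>" "x \<epsilon> V \<alpha>" "y \<epsilon> x"
  shows "y \<epsilon> V \<alpha>"
proof -
  obtain \<gamma> where \<gamma>: "\<gamma> \<epsilon> \<alpha>" "y \<epsilon> V \<gamma>"
    using assms(2,3) unfolding mem_V[of x] subset_def by blast
  then obtain \<delta> where "\<delta> \<epsilon> \<gamma>" "y \<sqsubseteq> V \<delta>" unfolding mem_V[of y \<gamma>] by blast
  with \<gamma> show ?thesis unfolding mem_V[of _ \<alpha>] using Ord_trans[OF assms(1)] by blast
qed

lemma V_mono: "Ord \<alpha> ==> \<beta> \<epsilon> \<alpha> ==> V \<beta> \<sqsubseteq> V \<alpha>"
  unfolding subset_def mem_V[of _ \<alpha>] mem_V[of _ \<beta>] by (blast intro: Ord_trans)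

lemma V_mono_succ: "Ord \<alpha> ==> \<beta> \<epsilon> succ \<alpha> ==> V \<beta> \<sqsubseteq> V \<alpha>"
  using V_mono subset_refl by auto

lemma mem_V_succ: "Ord \<alpha> ==> x \<epsilon> V (succ \<alpha>) <-> x \<sqsubseteq> V \<alpha>"
  unfolding mem_V[of x "succ \<alpha>"] using V_mono_succ[of \<alpha>] by (auto intro: subset_trans)

lemma Ord_mem_V: "Ord \<alpha> ==> \<beta> \<epsilon> \<alpha> ==> \<beta> \<epsilon> V \<alpha>"
proof -
  assume a: "Ord \<alpha>"
  have "\<forall>\<beta>. \<beta> \<epsilon> \<alpha> --> \<beta> \<epsilon> V \<alpha>"
  proof (rule Ord_induct[where P = "\<lambda>\<alpha>. \<forall>\<beta>. \<beta> \<epsilon> \<alpha> --> \<beta> \<epsilon> V \<alpha>", OF _ a])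
    fix x assume IH: "\<And>y. y \<epsilon> x ==> \<forall>\<beta>. \<beta> \<epsilon> y --> \<beta> \<epsilon> V y"
    show "\<forall>\<beta>. \<beta> \<epsilon> x --> \<beta> \<epsilon> V x"
      unfolding mem_V[of _ x] using IH unfolding subset_def by blast
  qed (intro dfn)
  then show "\<beta> \<epsilon> \<alpha> ==> \<beta> \<epsilon> V \<alpha>" by blast
qed

lemma mem_V_Ord: "Ord \<alpha> ==> Ord \<beta> ==> \<beta> \<epsilon> V \<alpha> ==> \<beta> \<epsilon> \<alpha>"
proof -
  assume a: "Ord \<alpha>"
  have "\<forall>\<beta>. Ord \<beta> & \<beta> \<epsilon> V \<alpha> --> \<beta> \<epsilon> \<alpha>"
  proof (rule Ord_induct[where P = "\<lambda>\<alpha>. \<forall>\<beta>. Ord \<beta> & \<beta> \<epsilon> V \<alpha> --> \<beta> \<epsilon> \<alpha>", OF _ a])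
    fix x assume x: "Ord x" and IH: "\<And>y. y \<epsilon> x ==> \<forall>\<beta>. Ord \<beta> & \<beta> \<epsilon> V y --> \<beta> \<epsilon> y"
    have "\<beta> \<epsilon> x" if b: "Ord \<beta>" "\<beta> \<epsilon> V x" for \<beta>
    proof (rule ccontr)
      assume "\<not> \<beta> \<epsilon> x"
      from b(2) obtain y where y: "y \<epsilon> x" "\<beta> \<sqsubseteq> V y" unfolding mem_V[of _ x] by blast
      have "y \<epsilon> \<beta>" using Ord_linear[OF b(1) x] \<open>\<not> \<beta> \<epsilon> x\<close> y(1) Ord_trans[OF b(1)] by blast
      then have "y \<epsilon> V y" "Ord y" using y Ord_mem[OF x] by (auto simp: subset_def)
      with IH[OF y(1)] show False by auto
    qed
    then show "\<forall>\<beta>. Ord \<beta> & \<beta> \<epsilon> V x --> \<beta> \<epsilon> x" by blast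
  qed (intro dfn)
  then show "Ord \<beta> ==> \<beta> \<epsilon> V \<alpha> ==> \<beta> \<epsilon> \<alpha>" by blast
qed

lemma V_limit_subset:
  assumes "limit l" "\<gamma> \<epsilon> l" "x \<sqsubseteq> V \<gamma>"
  shows "x \<epsilon> V l"
  using assms unfolding mem_V[of x] by blast

lemma V_limit_upair:
  assumes l: "limit l" and x: "x \<epsilon> V l" and y: "y \<epsilon> V l"
  shows "upair x y \<epsilon> V l"
proof -
  from x y obtain a b where a: "a \<epsilon> l" "x \<sqsubseteq> V a" and b: "b \<epsilon> l" "y \<sqsubseteq> V b"
    unfolding mem_V[of _ l] by blast
  have o: "Ord l" using limit_Ord[OF l] .
  obtain c where c: "c \<epsilon> l" "a \<epsilon> succ c" "b \<epsilon> succ c"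
    using Ord_max[OF o a(1) b(1)] .
  have oc: "Ord c" using Ord_mem[OF o c(1)] .
  have "x \<sqsubseteq> V c" "y \<sqsubseteq> V c"
    using subset_trans[OF a(2) V_mono_succ[OF oc c(2)]] subset_trans[OF b(2) V_mono_succ[OF oc c(3)]]
    by blast+
  then have "upair x y \<sqsubseteq> V (succ c)"
    using mem_V_succ[OF oc] unfolding subset_def[of E "upair x y"] by auto
  then show ?thesis using V_limit_subset[OF l limit_succ[OF l c(1)]] by blast
qed

lemma V_limit_opair:
  "limit l ==> x \<epsilon> V l ==> y \<epsilon> V l ==> opair x y \<epsilon> V l"
  unfolding opair_eq by (intro V_limit_upair)

text \<open>Taking the least level for each member makes the choice of a level functional, as
  Replacement demands; the successor of the supremum of these levels then serves.\<close>

lemma ex_mem_V: "\<exists>\<alpha>. Ord \<alpha> & x \<sqsubseteq> V \<alpha>"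
proof (rule mem_induct[where P = "\<lambda>x. \<exists>\<alpha>. Ord \<alpha> & x \<sqsubseteq> V \<alpha>"])
  fix x assume IH: "\<And>y. y \<epsilon> x ==> \<exists>\<alpha>. Ord \<alpha> & y \<sqsubseteq> V \<alpha>"
  define R where "R y a <-> Ord a & y \<sqsubseteq> V a & (\<forall>b. b \<epsilon> a --> \<not> y \<sqsubseteq> V b)" for y a
  have "\<exists>!a. R y a" if y: "y \<epsilon> x" for y
  proof (rule ex_ex1I)
    have d: "Def UNIV (\<lambda>e. y \<sqsubseteq> V (e 0))" by (intro dfn)
    show "\<exists>a. R y a" using Ord_least[OF d] IH[OF y] unfolding R_def by blast
    show "a = b" if "R y a" "R y b" for a b
      using that Ord_linear[of a b] unfolding R_def by blast
  qed
  moreover have "Def UNIV (\<lambda>e. R (e 0) (e 1))" unfolding R_def by (intro dfn)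
  ultimately obtain b where b: "\<And>y. y \<epsilon> x ==> \<exists>a. a \<epsilon> b & R y a"
    using replacement'[of R x] by blast
  have "Def UNIV (\<lambda>e. Ord (e 0))" by (intro dfn)
  from separation'[where P = "Ord", OF this]
  obtain s where s: "\<And>x. x \<epsilon> s <-> x \<epsilon> b & Ord x" by blast
  have o: "Ord (Uni s)" by (rule Ord_Uni) (simp add: s)
  have "x \<sqsubseteq> V (succ (Uni s))"
  proof (rule subsetI)
    fix y assume "y \<epsilon> x"
    then obtain a where a: "a \<epsilon> s" "y \<sqsubseteq> V a" "Ord a" using b unfolding s R_def by blast
    have "a \<epsilon> succ (Uni s)"
      by (rule Ord_mem_succ_Uni[OF _ a(1)]) (simp add: s)
    with a show "y \<epsilon> V (succ (Uni s))"
      unfolding mem_V_succ[OF o] using V_mono_succ[OF o] subset_trans by blast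
  qed
  with Ord_succ[OF o] show "\<exists>\<alpha>. Ord \<alpha> & x \<sqsubseteq> V \<alpha>" by blast
qed (intro dfn)

text \<open>Replacement needs a functional relation, so \<open>x\<close> is sent to the first level
  that contains a witness. Using the level \<open>V b\<close> itself as the value makes the union of
  all values contain every witness set that is needed.\<close>

lemma collection:
  assumes "Def UNIV (\<lambda>e. R (e 0) (e 1))" "\<And>x. x \<epsilon> a ==> \<exists>y. R x y"
  shows "\<exists>\<beta>. Ord \<beta> & (\<forall>x. x \<epsilon> a --> (\<exists>y. y \<epsilon> V \<beta> & R x y))"
proof -
  note dR = definable_lift2[where P = R, OF assms(1)]
  define Q where "Q x v <-> (\<exists>b. Ord b & v = V b & (\<exists>y. y \<epsilon> v & R x y) &
    (\<forall>c. c \<epsilon> b --> \<not> (\<exists>y. y \<epsilon> V c & R x y)))" for x v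
  have "\<exists>!v. Q x v" if x: "x \<epsilon> a" for x
  proof (rule ex_ex1I)
    have d: "Def UNIV (\<lambda>e. \<exists>y. y \<epsilon> V (e 0) & R x y)" by (intro dfn dR)
    from assms(2)[OF x] obtain y where "R x y" by blast
    moreover obtain b where "Ord b" "y \<epsilon> V b"
      using ex_mem_V[of "sing y"] by (auto simp: subset_def)
    ultimately show "\<exists>v. Q x v" using Ord_least[OF d, of b] unfolding Q_def by metis
    show "v = w" if "Q x v" "Q x w" for v w
      using that Ord_linear unfolding Q_def by metis
  qed
  moreover have "Def UNIV (\<lambda>e. Q (e 0) (e 1))" unfolding Q_def by (intro dfn dR)
  ultimately obtain b where b: "\<And>x. x \<epsilon> a ==> \<exists>v. v \<epsilon> b & Q x v"
    using replacement'[of Q a] by blast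
  obtain \<beta> where \<beta>: "Ord \<beta>" "Uni b \<sqsubseteq> V \<beta>" using ex_mem_V by blast
  have "\<exists>y. y \<epsilon> V \<beta> & R x y" if "x \<epsilon> a" for x
    using b[OF that] \<beta>(2) unfolding Q_def by (auto simp: subset_def)
  with \<beta>(1) show ?thesis by blast
qed


section \<open>Internal formulas and truth\<close>

definition fm_closed :: "'a => bool" where
  "fm_closed F <->
     (\<forall>i j. i \<epsilon> \<omega> & j \<epsilon> \<omega> --> cMem i j \<epsilon> F & cEq i j \<epsilon> F) &
     (\<forall>q. q \<epsilon> F --> cNeg q \<epsilon> F) &
     (\<forall>q r. q \<epsilon> F & r \<epsilon> F --> cConj q r \<epsilon> F) &
     (\<forall>i q. i \<epsilon> \<omega> & q \<epsilon> F --> cEx i q \<epsilon> F)"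

lemmas code_defs = cMem_def cEq_def cNeg_def cConj_def cEx_def

lemma definable_term_codes [dfn]:
  assumes "Trm K t" "Trm K u"
  shows "Trm K (\<lambda>e. cMem (t e) (u e))" "Trm K (\<lambda>e. cEq (t e) (u e))"
    "Trm K (\<lambda>e. cConj (t e) (u e))"
    "Trm K (\<lambda>e. cEx (t e) (u e))"
  unfolding code_defs by (intro dfn assms)+

lemma definable_term_cNeg [dfn]:
  "Trm K t ==> Trm K (\<lambda>e. cNeg (t e))"
  unfolding code_defs by (intro dfn)

lemma definable_formula [dfn]:
  "Trm K t ==> Def K (\<lambda>e. formula (t e))"
  by (rule definable_lift1[where P = "formula"])
    (unfold formula_def, intro dfn)

lemma formula_iff: "formula p <-> (\<forall>F. fm_closed F --> p \<epsilon> F)"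
  by (simp only: formula_def fm_closed_def)

lemma fm_closedD:
  assumes "fm_closed F"
  shows "i \<epsilon> \<omega> ==> j \<epsilon> \<omega> ==> cMem i j \<epsilon> F"
    "i \<epsilon> \<omega> ==> j \<epsilon> \<omega> ==> cEq i j \<epsilon> F"
    "p \<epsilon> F ==> cNeg p \<epsilon> F"
    "p \<epsilon> F ==> q \<epsilon> F ==> cConj p q \<epsilon> F"
    "i \<epsilon> \<omega> ==> p \<epsilon> F ==> cEx i p \<epsilon> F"
  using assms by (simp_all add: fm_closed_def)

lemma fm_closedI:
  assumes "\<And>i j. i \<epsilon> \<omega> ==> j \<epsilon> \<omega> ==> cMem i j \<epsilon> F"
    "\<And>i j. i \<epsilon> \<omega> ==> j \<epsilon> \<omega> ==> cEq i j \<epsilon> F"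
    "\<And>p. p \<epsilon> F ==> cNeg p \<epsilon> F"
    "\<And>p q. p \<epsilon> F ==> q \<epsilon> F ==> cConj p q \<epsilon> F"
    "\<And>i p. i \<epsilon> \<omega> ==> p \<epsilon> F ==> cEx i p \<epsilon> F"
  shows "fm_closed F"
  using assms by (simp add: fm_closed_def)

lemma formula_intros:
  "i \<epsilon> \<omega> ==> j \<epsilon> \<omega> ==> formula (cMem i j)"
  "i \<epsilon> \<omega> ==> j \<epsilon> \<omega> ==> formula (cEq i j)"
  "formula p ==> formula (cNeg p)"
  "formula p ==> formula q ==> formula (cConj p q)"
  "i \<epsilon> \<omega> ==> formula p ==> formula (cEx i p)"
  unfolding formula_iff by (simp_all add: fm_closedD)

lemma fm_closed_V_omega: "fm_closed (V \<omega>)"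
  by (rule fm_closedI)
    (simp_all add: code_defs V_limit_opair[OF limit_omega] Ord_mem_V[OF Ord_omega] omega_succ omega_emp)

lemma formula_mem_V: "formula p ==> p \<epsilon> V \<omega>"
  using fm_closed_V_omega unfolding formula_iff by blast

text \<open>Internal formulas may be nonstandard, out of reach of induction in the metatheory. All
  codes lie in \<open>V \<omega>\<close>, and the elements of \<open>V \<omega>\<close> that satisfy
  \<open>P\<close> form a set closed under the formation rules.\<close>

lemma formula_induct:
  assumes "Def UNIV (\<lambda>e. P (e 0))" "formula p"
    and "\<And>i j. i \<epsilon> \<omega> ==> j \<epsilon> \<omega> ==> P (cMem i j)"
    and "\<And>i j. i \<epsilon> \<omega> ==> j \<epsilon> \<omega> ==> P (cEq i j)"
    and "\<And>q. P q ==> P (cNeg q)"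
    and "\<And>q r. P q ==> P r ==> P (cConj q r)"
    and "\<And>i q. i \<epsilon> \<omega> ==> P q ==> P (cEx i q)"
  shows "P p"
proof -
  obtain F where F: "\<And>x. x \<epsilon> F <-> x \<epsilon> V \<omega> & P x" using separation'[OF assms(1)] by blast
  have "fm_closed F"
    by (rule fm_closedI) (simp_all add: F fm_closedD[OF fm_closed_V_omega] assms(3-))
  with assms(2) have "p \<epsilon> F" unfolding formula_iff by blast
  with F show ?thesis by blast
qed

text \<open>\<open>eval_graph A h\<close> says that \<open>h\<close> is a set of pairs \<open>(p, v)\<close>, where \<open>v\<close> is the set of the
  assignments that satisfy \<open>p\<close> in \<open>A\<close>, in which every pair is justified by pairs of subformulas.\<close>

definition eval_step :: "'a => 'a => 'a => 'a => bool" where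
  "eval_step A h p v <->
    (\<exists>i j. i \<epsilon> \<omega> & j \<epsilon> \<omega> & p = cMem i j & (\<forall>s. s \<epsilon> v <-> func s \<omega> A & ap s i \<epsilon> ap s j)) |
    (\<exists>i j. i \<epsilon> \<omega> & j \<epsilon> \<omega> & p = cEq i j & (\<forall>s. s \<epsilon> v <-> func s \<omega> A & ap s i = ap s j)) |
    (\<exists>q w. opair q w \<epsilon> h & p = cNeg q & (\<forall>s. s \<epsilon> v <-> func s \<omega> A & \<not> s \<epsilon> w)) |
    (\<exists>q r w u. opair q w \<epsilon> h & opair r u \<epsilon> h & p = cConj q r &
       (\<forall>s. s \<epsilon> v <-> func s \<omega> A & s \<epsilon> w & s \<epsilon> u)) |
    (\<exists>i q w. i \<epsilon> \<omega> & opair q w \<epsilon> h & p = cEx i q &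
       (\<forall>s. s \<epsilon> v <-> func s \<omega> A &
         (\<exists>t. func t \<omega> A & (\<forall>k. k \<epsilon> \<omega> & k ~= i --> ap t k = ap s k) & t \<epsilon> w)))"

definition eval_graph :: "'a => 'a => bool" where
  "eval_graph A h <-> (\<forall>p v. opair p v \<epsilon> h --> eval_step A h p v)"

definition evaluates :: "'a => 'a => 'a => bool" where
  "evaluates A p v <-> (\<exists>h. eval_graph A h & opair p v \<epsilon> h)"

lemma definable_evaluates:
  "Trm K t ==> Trm K u ==> Trm K w ==>
    Def K (\<lambda>e. evaluates (t e) (u e) (w e))"
  by (rule definable_lift3[where P = evaluates])
    (unfold evaluates_def eval_graph_def eval_step_def, intro dfn)

text \<open>\<open>h\<close> occurs only positively: an entry records the whole set of satisfying
  assignments, so negation is the complement of a recorded set and not the absence of a pair.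
  Consequently two evaluations can be merged, which the conjunction clause needs.\<close>

lemma eval_step_mono:
  assumes "eval_step A h p v" "h \<sqsubseteq> h'"
  shows "eval_step A h' p v"
proof -
  have sub: "opair q w \<epsilon> h --> opair q w \<epsilon> h'" for q w
    using assms(2) by (simp add: subset_def)
  have "eval_step A h p v --> eval_step A h' p v"
    unfolding eval_step_def by (intro disj_mono ex_mono conj_mono sub imp_refl)
  with assms(1) show ?thesis by blast
qed

lemma eval_graph_cup: "eval_graph A g ==> eval_graph A h ==> eval_graph A (cup g h)"
  using eval_step_mono[of A g _ _ "cup g h"] eval_step_mono[of A h _ _ "cup g h"]
  by (auto simp: eval_graph_def subset_def)

lemma evaluates_step: "evaluates A p v <-> (\<exists>h. eval_graph A h & eval_step A h p v)"
proof
  assume "\<exists>h. eval_graph A h & eval_step A h p v"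
  then obtain h where h: "eval_graph A h" "eval_step A h p v" by blast
  let ?h = "cup h (sing (opair p v))"
  have "h \<sqsubseteq> ?h" by (simp add: subset_def)
  then have "eval_graph A ?h"
    using h eval_step_mono[of A h _ _ ?h] unfolding eval_graph_def by simp
  then show "evaluates A p v" unfolding evaluates_def by (intro exI[of _ ?h]) simp
qed (unfold evaluates_def eval_graph_def, blast)

lemma code_simps [simp]:
  "cMem i j = cMem i' j' <-> i = i' & j = j'" "cEq i j = cEq i' j' <-> i = i' & j = j'"
  "cNeg p = cNeg p' <-> p = p'" "cConj p q = cConj p' q' <-> p = p' & q = q'"
  "cEx i p = cEx i' p' <-> i = i' & p = p'"
  "cMem i j ~= cEq i' j'" "cMem i j ~= cNeg p" "cMem i j ~= cConj p q" "cMem i j ~= cEx i' q"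
  "cEq i j ~= cMem i' j'" "cEq i j ~= cNeg p" "cEq i j ~= cConj p q" "cEq i j ~= cEx i' q"
  "cNeg p ~= cMem i j" "cNeg p ~= cEq i j" "cNeg p ~= cConj p' q" "cNeg p ~= cEx i q"
  "cConj p q ~= cMem i j" "cConj p q ~= cEq i j" "cConj p q ~= cNeg p'" "cConj p q ~= cEx i q'"
  "cEx i p ~= cMem i' j" "cEx i p ~= cEq i' j" "cEx i p ~= cNeg q" "cEx i p ~= cConj p' q"
  by (simp_all add: code_defs)

lemma ex_eval_graph: "eval_graph A (emp)"
  by (simp add: eval_graph_def)

lemma evaluates_Mem: "i \<epsilon> \<omega> ==> j \<epsilon> \<omega> ==>
    evaluates A (cMem i j) v <-> (\<forall>s. s \<epsilon> v <-> func s \<omega> A & ap s i \<epsilon> ap s j)"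
  unfolding evaluates_step eval_step_def by simp (metis ex_eval_graph)

lemma evaluates_Eq: "i \<epsilon> \<omega> ==> j \<epsilon> \<omega> ==>
    evaluates A (cEq i j) v <-> (\<forall>s. s \<epsilon> v <-> func s \<omega> A & ap s i = ap s j)"
  unfolding evaluates_step eval_step_def by simp (metis ex_eval_graph)

lemma evaluates_Neg: "evaluates A (cNeg q) v <->
    (\<exists>w. evaluates A q w & (\<forall>s. s \<epsilon> v <-> func s \<omega> A & \<not> s \<epsilon> w))"
  unfolding evaluates_step[of _ "cNeg q"]
  unfolding eval_step_def evaluates_def by simp blast

lemma evaluates_Conj: "evaluates A (cConj q r) v <->
    (\<exists>w u. evaluates A q w & evaluates A r u & (\<forall>s. s \<epsilon> v <-> func s \<omega> A & s \<epsilon> w & s \<epsilon> u))"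
proof
  assume "\<exists>w u. evaluates A q w & evaluates A r u & (\<forall>s. s \<epsilon> v <-> func s \<omega> A & s \<epsilon> w & s \<epsilon> u)"
  then obtain w u g h where "eval_graph A g" "opair q w \<epsilon> g" "eval_graph A h" "opair r u \<epsilon> h"
    "\<forall>s. s \<epsilon> v <-> func s \<omega> A & s \<epsilon> w & s \<epsilon> u"
    unfolding evaluates_def by blast
  moreover from this have "eval_graph A (cup g h)" by (simp add: eval_graph_cup)
  moreover have "opair q w \<epsilon> cup g h" "opair r u \<epsilon> cup g h" using calculation by simp_all
  ultimately show "evaluates A (cConj q r) v"
    unfolding evaluates_step[of _ "cConj q r"] eval_step_def by (simp only: code_simps) blast
next
  assume "evaluates A (cConj q r) v"
  then show "\<exists>w u. evaluates A q w & evaluates A r u & (\<forall>s. s \<epsilon> v <-> func s \<omega> A & s \<epsilon> w & s \<epsilon> u)"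
    unfolding evaluates_step[of _ "cConj q r"] unfolding eval_step_def evaluates_def by simp blast
qed

lemma evaluates_Ex: "i \<epsilon> \<omega> ==> evaluates A (cEx i q) v <->
    (\<exists>w. evaluates A q w & (\<forall>s. s \<epsilon> v <-> func s \<omega> A &
         (\<exists>t. func t \<omega> A & (\<forall>k. k \<epsilon> \<omega> & k ~= i --> ap t k = ap s k) & t \<epsilon> w)))"
  unfolding evaluates_step[of _ "cEx i q"]
  unfolding eval_step_def evaluates_def by simp blast

lemma ex1_set:
  assumes "Def UNIV (\<lambda>e. P (e 0))"
  shows "\<exists>!v. \<forall>s. s \<epsilon> v <-> func s a b & P s"
proof (rule ex_ex1I)
  obtain v where "\<forall>s. s \<epsilon> v <-> s \<epsilon> Pw (prod a b) & (func s a b & P s)"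
  proof -
    have "Def UNIV (\<lambda>e. func (e 0) a b & P (e 0))" by (intro dfn assms)
    from separation'[where P = "\<lambda>s. func s a b & P s", OF this] that show ?thesis by blast
  qed
  then show "\<exists>v. \<forall>s. s \<epsilon> v <-> func s a b & P s"
    by (intro exI[of _ v]) (auto simp: func_iff)
qed (auto intro: extensionality)

lemma evaluates_ex1:
  assumes "formula p"
  shows "\<exists>!v. evaluates A p v"
proof (rule formula_induct[where P = "\<lambda>p. \<exists>!v. evaluates A p v", OF _ assms])
  show "Def UNIV (\<lambda>e. \<exists>!v. evaluates A (e 0) v)" by (intro dfn definable_evaluates)
next
  fix i j assume "i \<epsilon> \<omega>" "j \<epsilon> \<omega>"
  then show "\<exists>!v. evaluates A (cMem i j) v"
    unfolding evaluates_Mem[OF \<open>i \<epsilon> \<omega>\<close> \<open>j \<epsilon> \<omega>\<close>] by (intro ex1_set dfn)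
next
  fix i j assume "i \<epsilon> \<omega>" "j \<epsilon> \<omega>"
  then show "\<exists>!v. evaluates A (cEq i j) v"
    unfolding evaluates_Eq[OF \<open>i \<epsilon> \<omega>\<close> \<open>j \<epsilon> \<omega>\<close>] by (intro ex1_set dfn)
next
  fix q assume "\<exists>!v. evaluates A q v"
  then obtain w where w: "\<And>v. evaluates A q v <-> v = w" by blast
  show "\<exists>!v. evaluates A (cNeg q) v"
    unfolding evaluates_Neg w simp_thms by (intro ex1_set dfn)
next
  fix q r assume "\<exists>!v. evaluates A q v" "\<exists>!v. evaluates A r v"
  then obtain w u where w: "\<And>v. evaluates A q v <-> v = w" "\<And>v. evaluates A r v <-> v = u"
    by metis
  have "Def UNIV (\<lambda>e. e 0 \<epsilon> w & e 0 \<epsilon> u)" by (intro dfn)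
  from ex1_set[where P = "\<lambda>s. s \<epsilon> w & s \<epsilon> u", OF this]
  show "\<exists>!v. evaluates A (cConj q r) v"
    unfolding evaluates_Conj w by simp
next
  fix i q assume i: "i \<epsilon> \<omega>" and "\<exists>!v. evaluates A q v"
  then obtain w where w: "\<And>v. evaluates A q v <-> v = w" by blast
  show "\<exists>!v. evaluates A (cEx i q) v"
    unfolding evaluates_Ex[OF i] w simp_thms by (intro ex1_set dfn)
qed

lemma truth_set_ap:
  "truth_set A T <-> (\<forall>s. func s \<omega> A -->
     (\<forall>i j. i \<epsilon> \<omega> & j \<epsilon> \<omega> -->
        (opair (cMem i j) s \<epsilon> T <-> ap s i \<epsilon> ap s j) &
        (opair (cEq i j) s \<epsilon> T <-> ap s i = ap s j)) &
     (\<forall>p. formula p --> (opair (cNeg p) s \<epsilon> T <-> \<not> opair p s \<epsilon> T)) &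
     (\<forall>p q. formula p & formula q -->
        (opair (cConj p q) s \<epsilon> T <-> opair p s \<epsilon> T & opair q s \<epsilon> T)) &
     (\<forall>i p. i \<epsilon> \<omega> & formula p -->
        (opair (cEx i p) s \<epsilon> T <->
          (\<exists>t. func t \<omega> A & (\<forall>k. k \<epsilon> \<omega> & k ~= i --> ap t k = ap s k) &
               opair p t \<epsilon> T))))"
  unfolding truth_set_def
  by (simp add: app_eq_ap[of _ \<omega> A] cong: conj_cong)

lemma definable_Sat [dfn]:
  "Trm K t ==> Trm K u ==> Trm K w ==>
    Def K (\<lambda>e. Sat (t e) (u e) (w e))"
  by (rule definable_lift3[where P = "Sat"])
    (unfold Sat_def truth_set_ap, intro dfn)

text \<open>\<open>Sat\<close> asks for some truth set and would be false throughout if there were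
  none. One is assembled from the values of all formulas; \<open>V \<omega>\<close> bounds the codes
  and the power set of \<open>prod \<omega> A\<close> the assignments.\<close>

lemma ex_truth_set: "\<exists>T. truth_set A T"
proof -
  define f where "f p = (THE v. evaluates A p v)" for p
  have f: "evaluates A p v <-> v = f p" if "formula p" for p v
    using theI'[OF evaluates_ex1[OF that], of A] evaluates_ex1[OF that, of A] unfolding f_def by blast
  define T where "T = collect (\<lambda>z. \<exists>p s v. formula p & evaluates A p v & s \<epsilon> v &
    func s \<omega> A & z = opair p s)"
  have "z \<epsilon> T <-> (\<exists>p s v. formula p & evaluates A p v & s \<epsilon> v &
    func s \<omega> A & z = opair p s)" for z
    unfolding T_def
  proof (rule mem_collect[where a = "prod (V \<omega>) (Pw (prod \<omega> A))"])
    show "z \<epsilon> prod (V \<omega>) (Pw (prod \<omega> A))"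
      if "\<exists>p s v. formula p & evaluates A p v & s \<epsilon> v & func s \<omega> A & z = opair p s" for z
      using that formula_mem_V by (auto simp: func_iff)
  qed (intro dfn definable_evaluates)
  then have T: "opair p s \<epsilon> T <-> s \<epsilon> f p" if "formula p" "func s \<omega> A" for p s
    using that f by auto
  have "truth_set A T"
    unfolding truth_set_ap
  proof (intro allI impI conjI; (elim conjE)?)
    fix s i j assume s: "func s \<omega> A" and ij: "i \<epsilon> \<omega>" "j \<epsilon> \<omega>"
    show "opair (cMem i j) s \<epsilon> T <-> ap s i \<epsilon> ap s j"
      using T[OF formula_intros(1) s] f[OF formula_intros(1)] evaluates_Mem ij s by blast
    show "opair (cEq i j) s \<epsilon> T <-> ap s i = ap s j"
      using T[OF formula_intros(2) s] f[OF formula_intros(2)] evaluates_Eq ij s by blast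
  next
    fix s p assume s: "func s \<omega> A" and p: "formula p"
    show "opair (cNeg p) s \<epsilon> T <-> \<not> opair p s \<epsilon> T"
      using T[OF formula_intros(3) s] T[OF _ s] f[OF formula_intros(3)] evaluates_Neg f p s by metis
  next
    fix s p q assume s: "func s \<omega> A" and p: "formula p" "formula q"
    show "opair (cConj p q) s \<epsilon> T <-> opair p s \<epsilon> T & opair q s \<epsilon> T"
      using T[OF formula_intros(4) s] T[OF _ s] f[OF formula_intros(4)] evaluates_Conj f p s by metis
  next
    fix s i p assume s: "func s \<omega> A" and p: "formula p" and i: "i \<epsilon> \<omega>"
    have "evaluates A (cEx i p) (f (cEx i p))" using f[OF formula_intros(5)] i p by blast
    then have "s \<epsilon> f (cEx i p) <->
      (\<exists>t. func t \<omega> A & (\<forall>k. k \<epsilon> \<omega> & k ~= i --> ap t k = ap s k) & t \<epsilon> f p)"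
      unfolding evaluates_Ex[OF i] f[OF p] using s by blast
    then show "opair (cEx i p) s \<epsilon> T <->
      (\<exists>t. func t \<omega> A & (\<forall>k. k \<epsilon> \<omega> & k ~= i --> ap t k = ap s k) & opair p t \<epsilon> T)"
      using T[OF formula_intros(5)[OF i p] s] T[OF p] by (simp cong: conj_cong)
  qed
  then show ?thesis by blast
qed

section \<open>Formulas of the metatheory\<close>

primrec num :: "nat => 'a" where
  "num 0 = emp"
| "num (Suc n) = succ (num n)"

primrec code :: "fm => 'a" where
  "code (FMem i j) = cMem (num i) (num j)"
| "code (FEq i j) = cEq (num i) (num j)"
| "code (FNeg p) = cNeg (code p)"
| "code (FConj p q) = cConj (code p) (code q)"
| "code (FEx i p) = cEx (num i) (code p)"

text \<open>The environment is an external sequence, whereas the assignments of \<open>Sat\<close>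
  are elements of the model. \<open>ex_assignment\<close> connects the two on finitely many
  variables.\<close>

primrec rsat :: "'a => fm => (nat => 'a) => bool" where
  "rsat A (FMem i j) e = (e i \<epsilon> e j)"
| "rsat A (FEq i j) e = (e i = e j)"
| "rsat A (FNeg p) e = (\<not> rsat A p e)"
| "rsat A (FConj p q) e = (rsat A p e & rsat A q e)"
| "rsat A (FEx i p) e = (\<exists>x. x \<epsilon> A & rsat A p (e(i := x)))"

lemma num_mem [simp]: "num n \<epsilon> \<omega>"
  by (induction n) (auto simp: omega_emp intro: omega_succ)

lemma num_eq [simp]: "num m = num n <-> m = n"
proof (induction m arbitrary: n)
  case 0
  show ?case by (cases n) auto
next
  case (Suc m)
  then show ?case by (cases n) auto
qed

lemma formula_code: "formula (code p)"
  by (induction p) (auto intro: formula_intros)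

lemma rsat_cong: "(\<And>n. n \<in> fm_vars p ==> e n = e' n) ==> rsat A p e <-> rsat A p e'"
proof (induction p arbitrary: e e')
  case (FEx i p)
  have "rsat A p (e(i := x)) <-> rsat A p (e'(i := x))" for x
    by (rule FEx.IH) (use FEx.prems in auto)
  then show ?case by simp
next
  case (FConj p q)
  then show ?case by (metis UnCI fm_vars.simps(4) rsat.simps(4))
next
  case (FNeg p)
  then show ?case by (metis fm_vars.simps(3) rsat.simps(3))
qed auto

text \<open>Tarski's clauses force every truth set on the codes of standard formulas, so there the
  choice of \<open>T\<close> in \<open>Sat\<close> does not matter.\<close>

lemma truth_set_code:
  assumes T: "truth_set A T"
  shows "func s \<omega> A ==> opair (code p) s \<epsilon> T <-> rsat A p (\<lambda>n. app s (num n))"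
proof (induction p arbitrary: s)
  case (FEx i p)
  have "opair (code (FEx i p)) s \<epsilon> T <-> (\<exists>t. func t \<omega> A &
      (\<forall>k. k \<epsilon> \<omega> & k ~= num i --> app t k = app s k) & rsat A p (\<lambda>n. app t (num n)))"
    using T FEx.prems FEx.IH formula_code[of p] num_mem[of i] unfolding truth_set_def
    by (simp cong: conj_cong)
  also have "\<dots> <-> rsat A (FEx i p) (\<lambda>n. app s (num n))"
  proof
    assume "\<exists>t. func t \<omega> A & (\<forall>k. k \<epsilon> \<omega> & k ~= num i --> app t k = app s k) &
      rsat A p (\<lambda>n. app t (num n))"
    then obtain t where t: "func t \<omega> A" "\<And>k. k \<epsilon> \<omega> & k ~= num i ==> app t k = app s k"
      "rsat A p (\<lambda>n. app t (num n))" by blast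
    have "(\<lambda>n. app t (num n)) = (\<lambda>n. app s (num n))(i := app t (num i))"
      using t(2) by auto
    with t(3) app_mem(2)[OF t(1) num_mem] show "rsat A (FEx i p) (\<lambda>n. app s (num n))" by auto
  next
    assume "rsat A (FEx i p) (\<lambda>n. app s (num n))"
    then obtain x where x: "x \<epsilon> A" "rsat A p ((\<lambda>n. app s (num n))(i := x))" by auto
    from func_update[OF FEx.prems num_mem x(1)] obtain t where t: "func t \<omega> A" "app t (num i) = x"
      "\<forall>k. k \<epsilon> \<omega> & k ~= num i --> app t k = app s k" by blast
    have "(\<lambda>n. app t (num n)) = (\<lambda>n. app s (num n))(i := x)"
      using t(2,3) by auto
    with x(2) t show "\<exists>t. func t \<omega> A & (\<forall>k. k \<epsilon> \<omega> & k ~= num i --> app t k = app s k) &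
      rsat A p (\<lambda>n. app t (num n))" by auto
  qed
  finally show ?case .
next
  case (FNeg p)
  then show ?case using T formula_code[of p] unfolding truth_set_def by simp
next
  case (FConj p q)
  then show ?case using T formula_code[of p] formula_code[of q] unfolding truth_set_def by simp
qed (use T in \<open>simp_all add: truth_set_def\<close>)

lemma Sat_code:
  "func s \<omega> A ==> Sat A (code p) s <-> rsat A p (\<lambda>n. app s (num n))"
  unfolding Sat_def using truth_set_code ex_truth_set by blast

text \<open>Only finitely many values are prescribed, because an external sequence need not be
  represented by a function of the model.\<close>

lemma ex_assignment:
  assumes "a \<epsilon> A" "\<And>n. n < N ==> e n \<epsilon> A"
  shows "\<exists>s. func s \<omega> A & (\<forall>n<N. app s (num n) = e n)"
  using assms(2)
proof (induction N)
  case 0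
  have "Trm UNIV (\<lambda>e. a)" by (intro dfn)
  from make_func[where h = "\<lambda>_. a", OF this] assms(1) show ?case by blast
next
  case (Suc N)
  then obtain s where s: "func s \<omega> A" "\<forall>n<N. app s (num n) = e n" by force
  from func_update[OF s(1) num_mem Suc.prems[of N]] obtain t where t: "func t \<omega> A"
    "app t (num N) = e N" "\<forall>k. k \<epsilon> \<omega> & k ~= num N --> app t k = app s k" by blast
  from t s(2) show ?case by (intro exI[of _ t]) (auto simp: less_Suc_eq)
qed

lemma ex_var_bound: "\<exists>N>0. \<forall>n\<in>fm_vars p. n < N"
  using finite_nat_set_iff_bounded[of "fm_vars p"] finite_fm_vars[of p] by (metis gr0I less_Suc_eq not_less_zero zero_less_Suc)

lemma elem_submodel_rsat:
  assumes "elem_submodel E X Y" "\<And>n. e n \<epsilon> X"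
  shows "rsat X p e <-> rsat Y p e"
proof -
  obtain N where N: "N > 0" "\<forall>n\<in>fm_vars p. n < N" using ex_var_bound by blast
  obtain s where s: "func s \<omega> X" "\<forall>n<N. app s (num n) = e n"
    using ex_assignment[OF assms(2)[of 0], of N e] assms(2) by blast
  have eq: "rsat Z p e <-> rsat Z p (\<lambda>n. app s (num n))" for Z
    by (rule rsat_cong) (use N s in auto)
  have "func s \<omega> Y" using func_mono[OF s(1)] assms(1) by (simp add: elem_submodel_def)
  with s(1) assms(1) formula_code[of p] show ?thesis
    unfolding eq elem_submodel_def by (metis Sat_code)
qed

lemma elem_embedding_rsat:
  assumes j: "elem_embedding E j X Y" and e: "\<And>n. e n \<epsilon> X"
  shows "rsat X p e <-> rsat Y p (\<lambda>n. app j (e n))"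
proof -
  obtain N where N: "N > 0" "\<forall>n\<in>fm_vars p. n < N" using ex_var_bound by blast
  obtain s where s: "func s \<omega> X" "\<forall>n<N. app s (num n) = e n"
    using ex_assignment[OF e[of 0], of N e] e by blast
  have jf: "func j X Y" using j by (simp add: elem_embedding_def)
  have d: "Trm UNIV (\<lambda>e. ap j (ap s (e 0)))" by (intro dfn)
  have m: "ap s i \<epsilon> X" "ap s i = app s i" "ap j (ap s i) = app j (app s i)"
    "ap j (ap s i) \<epsilon> Y" if "i \<epsilon> \<omega>" for i
    using app_eq_ap[OF s(1) that] app_mem(2)[OF s(1) that] app_eq_ap[OF jf] app_mem(2)[OF jf] by auto
  obtain t where t: "func t \<omega> Y" "\<And>i. i \<epsilon> \<omega> ==> app t i = app j (app s i)"
    using make_func[where h = "\<lambda>i. ap j (ap s i)", OF d, of \<omega> Y] m by auto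
  have "rsat X p e <-> rsat X p (\<lambda>n. app s (num n))"
    by (rule rsat_cong) (use N s in auto)
  also have "\<dots> <-> rsat Y p (\<lambda>n. app t (num n))"
    using j formula_code[of p] s(1) t unfolding elem_embedding_def by (metis Sat_code)
  also have "\<dots> <-> rsat Y p (\<lambda>n. app j (e n))"
    by (rule rsat_cong) (use N s t(2) in auto)
  finally show ?thesis .
qed

section \<open>Reflection\<close>

primrec ex_subs :: "fm => (nat \<times> fm) set" where
  "ex_subs (FMem i j) = {}"
| "ex_subs (FEq i j) = {}"
| "ex_subs (FNeg p) = ex_subs p"
| "ex_subs (FConj p q) = ex_subs p \<union> ex_subs q"
| "ex_subs (FEx i p) = insert (i, p) (ex_subs p)"

lemma finite_ex_subs: "finite (ex_subs p)"
  by (induction p) auto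

text \<open>The Tarski-Vaught test, localized to the existential subformulas of a single
  formula.\<close>

lemma rsat_eq_sat:
  assumes "\<And>i q e. (i, q) \<in> ex_subs p ==> (\<And>n. e n \<epsilon> A) ==> \<exists>x. sat E q (e(i := x)) ==>
    \<exists>x. x \<epsilon> A & sat E q (e(i := x))"
  shows "(\<And>n. e n \<epsilon> A) ==> rsat A p e <-> sat E p e"
  using assms
proof (induction p arbitrary: e)
  case (FEx i p)
  have "rsat A p (e(i := x)) <-> sat E p (e(i := x))" if "x \<epsilon> A" for x
    by (rule FEx.IH) (use FEx.prems that in auto)
  then have "rsat A (FEx i p) e <-> (\<exists>x. x \<epsilon> A & sat E p (e(i := x)))"
    by (simp del: fun_upd_apply cong: conj_cong)
  also have "\<dots> <-> (\<exists>x. sat E p (e(i := x)))"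
    using FEx.prems(2)[of i p e, OF _ FEx.prems(1)] by (simp only: ex_subs.simps insert_iff simp_thms) blast
  finally show ?case by simp
next
  case (FConj p q)
  have "rsat A p e <-> sat E p e" "rsat A q e <-> sat E q e"
    by (rule FConj.IH; use FConj.prems in auto)+
  then show ?case by simp
next
  case (FNeg p)
  have "rsat A p e <-> sat E p e" by (rule FNeg.IH) (use FNeg.prems in auto)
  then show ?case by simp
qed auto

text \<open>The environment is read off an internal assignment \<open>s\<close>, so that quantifying
  over it is a quantifier of the model and the relation between \<alpha> and \<beta> is
  definable.\<close>

definition witness_bound :: "nat \<times> fm => 'a => 'a => bool" where
  "witness_bound iq \<alpha> \<beta> <-> (\<forall>s. func s \<omega> (V \<alpha>) &
     (\<exists>x. sat E (snd iq) ((\<lambda>n. ap s (num n))(fst iq := x))) -->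
     (\<exists>x. x \<epsilon> V \<beta> & sat E (snd iq) ((\<lambda>n. ap s (num n))(fst iq := x))))"

lemma definable_sat_assignment:
  "Def UNIV (\<lambda>e. sat E q ((\<lambda>n. ap (e 0) (num n))(i := e 1)))"
proof -
  have "Trm UNIV ((if n = i then (\<lambda>e. e 1) else (\<lambda>e. ap (e 0) (num n))))" for n
    by (cases "n = i") (simp_all, (intro dfn)+)
  note d = definable_sat[where T = "\<lambda>n. if n = i then (\<lambda>e. e 1) else (\<lambda>e. ap (e 0) (num n))", OF this]
  have eq: "(\<lambda>n. (if n = i then (\<lambda>e. e 1) else (\<lambda>e. ap (e 0) (num n))) e)
    = (\<lambda>n. ap (e 0) (num n))(i := e 1)" for e by auto
  show ?thesis using d[of q] unfolding eq .
qed

lemmas definable_sat_assignment' =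
  definable_lift2[where P = "\<lambda>s x. sat E q ((\<lambda>n. ap s (num n))(i := x))", OF definable_sat_assignment] for q i

lemma definable_witness_bound:
  "Trm UNIV t ==> Trm UNIV u ==>
    Def UNIV (\<lambda>e. witness_bound iq (t e) (u e))"
  by (rule definable_lift2[where P = "witness_bound iq"])
    (unfold witness_bound_def, intro dfn definable_sat_assignment')

lemma witness_bound_mono:
  "witness_bound iq \<alpha> \<beta> ==> V \<beta> \<sqsubseteq> V \<gamma> ==> witness_bound iq \<alpha> \<gamma>"
  unfolding witness_bound_def subset_def by blast

lemma ex_witness_bound: "\<exists>\<beta>. Ord \<beta> & witness_bound iq \<alpha> \<beta>"
proof -
  define S where "S s x <-> sat E (snd iq) ((\<lambda>n. ap s (num n))(fst iq := x))" for s x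
  note dS = definable_sat_assignment'[where q = "snd iq" and i = "fst iq", folded S_def]
  have "Def UNIV (\<lambda>e. S (e 0) (e 1) | \<not> (\<exists>x. S (e 0) x))" by (intro dfn dS)
  from collection[where R = "\<lambda>s x. S s x | \<not> (\<exists>x. S s x)" and a = "Pw (prod \<omega> (V \<alpha>))", OF this]
  obtain \<beta> where "Ord \<beta>" "\<And>s. s \<epsilon> Pw (prod \<omega> (V \<alpha>)) ==> \<exists>x. x \<epsilon> V \<beta> & (S s x | \<not> (\<exists>x. S s x))"
    by blast
  then show ?thesis unfolding witness_bound_def S_def[symmetric] func_iff by (metis mem_Pw)
qed

lemma definable_finite_ball:
  "finite I ==> (\<And>i. i \<in> I ==> Def K (P i)) ==> Def K (\<lambda>e. \<forall>i\<in>I. P i e)"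
proof (induction rule: finite_induct)
  case (insert i I)
  then show ?case by (simp add: definable_conj)
qed (simp add: definable_true)

lemma ex_witness_bounds:
  assumes "finite I"
  shows "\<exists>\<beta>. Ord \<beta> & \<alpha> \<epsilon> V \<beta> & (\<forall>iq\<in>I. witness_bound iq \<alpha> \<beta>)"
  using assms
proof (induction rule: finite_induct)
  case empty
  obtain \<beta> where "Ord \<beta>" "sing \<alpha> \<sqsubseteq> V \<beta>" using ex_mem_V by blast
  then show ?case by (auto simp: subset_def)
next
  case (insert iq I)
  then obtain \<beta> where b: "Ord \<beta>" "\<alpha> \<epsilon> V \<beta>" "\<forall>iq\<in>I. witness_bound iq \<alpha> \<beta>" by blast
  obtain \<gamma> where g: "Ord \<gamma>" "witness_bound iq \<alpha> \<gamma>" using ex_witness_bound by blast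
  have o: "Ord (succ (Uni (upair \<beta> \<gamma>)))"
    by (intro Ord_succ Ord_Uni) (auto simp: b g)
  let ?d = "succ (Uni (upair \<beta> \<gamma>))"
  have "\<beta> \<epsilon> ?d" "\<gamma> \<epsilon> ?d"
    by (rule Ord_mem_succ_Uni; use b g in auto)+
  then have "V \<beta> \<sqsubseteq> V ?d" "V \<gamma> \<sqsubseteq> V ?d" using V_mono[OF o] by blast+
  with b g witness_bound_mono o show ?case by (metis insert_iff subsetD)
qed

lemma V_limit_max:
  assumes l: "limit \<zeta>" and "\<gamma> \<epsilon> \<zeta>" "x \<epsilon> V \<zeta>"
  shows "\<exists>\<delta>. \<delta> \<epsilon> \<zeta> & V \<gamma> \<sqsubseteq> V \<delta> & x \<epsilon> V \<delta>"
proof -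
  have o: "Ord \<zeta>" using limit_Ord[OF l] .
  obtain \<beta> where b: "\<beta> \<epsilon> \<zeta>" "x \<sqsubseteq> V \<beta>" using assms(3) unfolding mem_V[of x] by blast
  obtain c where c: "c \<epsilon> \<zeta>" "\<gamma> \<epsilon> succ c" "\<beta> \<epsilon> succ c" using Ord_max[OF o assms(2) b(1)] .
  have oc: "Ord c" using Ord_mem[OF o c(1)] .
  have "x \<epsilon> V (succ c)" using mem_V_succ[OF oc] V_mono_succ[OF oc c(3)] b(2) subset_trans by blast
  then show ?thesis using V_mono[OF Ord_succ[OF oc] c(2)] limit_succ[OF l c(1)] by blast
qed

lemma ex_bound_rank:
  assumes l: "limit \<zeta>" and e: "\<And>n. n < (N :: nat) ==> e n \<epsilon> V \<zeta>"
  shows "\<exists>\<gamma>. \<gamma> \<epsilon> \<zeta> & (\<forall>n<N. e n \<epsilon> V \<gamma>)"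
  using e
proof (induction N)
  case 0
  then show ?case using l unfolding limit_iff by auto
next
  case (Suc N)
  then obtain \<gamma> where g: "\<gamma> \<epsilon> \<zeta>" "\<forall>n<N. e n \<epsilon> V \<gamma>" by auto
  with V_limit_max[OF l g(1) Suc.prems[of N]] show ?case by (auto simp: less_Suc_eq subset_def)
qed

text \<open>Starting from \<alpha>, the least ordinal that bounds witnesses for all parameters of
  the current level is taken \<omega> times. The supremum passes the Tarski-Vaught test because
  finitely many parameters already lie in one level of this sequence.\<close>

lemma reflection:
  assumes fin: "finite \<Phi>" and \<alpha>: "Ord \<alpha>"
  shows "\<exists>\<zeta>. limit \<zeta> & \<alpha> \<epsilon> \<zeta> &
    (\<forall>p\<in>\<Phi>. \<forall>e. (\<forall>n. e n \<epsilon> V \<zeta>) --> (rsat (V \<zeta>) p e <-> sat E p e))"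
proof -
  define I where "I = (\<Union>p\<in>\<Phi>. ex_subs p)"
  have I: "finite I" by (simp add: I_def fin finite_ex_subs)
  define H where "H a b <-> Ord b & a \<epsilon> V b & (\<forall>iq\<in>I. witness_bound iq a b)" for a b
  have dH: "Def UNIV (\<lambda>e. H (e 0) (e 1))"
    unfolding H_def by (intro dfn definable_finite_ball definable_witness_bound I)
  note dH' = definable_lift2[where P = H, OF dH]
  define h where "h a = (THE b. H a b & (\<forall>c. c \<epsilon> b --> \<not> H a c))" for a
  have "\<exists>!b. H a b & (\<forall>c. c \<epsilon> b --> \<not> H a c)" for a
  proof (rule ex_ex1I)
    have d: "Def UNIV (\<lambda>e. H a (e 0))" by (intro dfn dH')
    from ex_witness_bounds[OF I] obtain b where "H a b" unfolding H_def by blast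
    with Ord_least[OF d, of b] show "\<exists>b. H a b & (\<forall>c. c \<epsilon> b --> \<not> H a c)" unfolding H_def by blast
    show "b = c" if "H a b & (\<forall>c. c \<epsilon> b --> \<not> H a c)" "H a c & (\<forall>d. d \<epsilon> c --> \<not> H a d)" for b c
      using that Ord_linear[of b c] unfolding H_def by blast
  qed
  note ex1 = this
  have h: "b = h a <-> H a b & (\<forall>c. c \<epsilon> b --> \<not> H a c)" for a b
    using theI'[OF ex1[of a]] ex1[of a] unfolding h_def by blast
  have Hh: "H a (h a)" for a using h[of "h a" a] by blast
  have dh: "Trm UNIV (\<lambda>e. h (e 0))"
    unfolding definable_term_def h by (intro dfn dH')
  obtain f b where f: "func f \<omega> b" "app f emp = \<alpha>"
    "\<And>n. n \<epsilon> \<omega> ==> app f (succ n) = h (app f n)"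
    using omega_iterate[where g = h, OF dh, of \<alpha>] by blast
  have fO: "Ord (app f n)" if n: "n \<epsilon> \<omega>" for n
    using n
  proof (cases rule: omega_cases)
    case (2 m)
    with Hh[of "app f m"] show ?thesis by (simp add: f(3) H_def)
  qed (simp add: f(2) \<alpha>)
  have fS: "app f n \<epsilon> app f (succ n)" if n: "n \<epsilon> \<omega>" for n
    using Hh[of "app f n"] mem_V_Ord fO n f(3)[OF n] unfolding H_def by metis
  define s where "s = collect (\<lambda>y. \<exists>n. n \<epsilon> \<omega> & y = ap f n)"
  have "y \<epsilon> s <-> (\<exists>n. n \<epsilon> \<omega> & y = ap f n)" for y
    unfolding s_def
  proof (rule mem_collect[where a = b])
    show "y \<epsilon> b" if "\<exists>n. n \<epsilon> \<omega> & y = ap f n" for y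
      using that app_eq_ap[OF f(1)] app_mem(2)[OF f(1)] by auto
  qed (intro dfn)
  then have s: "y \<epsilon> s <-> (\<exists>n. n \<epsilon> \<omega> & y = app f n)" for y
    using app_eq_ap[OF f(1)] by (simp cong: conj_cong)
  define \<zeta> where "\<zeta> = Uni s"
  have \<zeta>: "y \<epsilon> \<zeta> <-> (\<exists>n. n \<epsilon> \<omega> & y \<epsilon> app f n)" for y
    unfolding \<zeta>_def using s by auto
  have f\<zeta>: "app f n \<epsilon> \<zeta>" if "n \<epsilon> \<omega>" for n
    using fS[OF that] omega_succ[OF that] \<zeta> by blast
  have "Ord \<zeta>" unfolding \<zeta>_def by (rule Ord_Uni) (use s fO in auto)
  then have lim: "limit \<zeta>"
    unfolding limit_iff using f\<zeta> omega_emp \<zeta> by blast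
  have "rsat (V \<zeta>) p e <-> sat E p e" if p: "p \<in> \<Phi>" and e: "\<And>n. e n \<epsilon> V \<zeta>" for p e
  proof (rule rsat_eq_sat[OF _ e])
    fix i q and e :: "nat => 'a"
    assume iq: "(i, q) \<in> ex_subs p" and e: "\<And>n. e n \<epsilon> V \<zeta>" and x: "\<exists>x. sat E q (e(i := x))"
    \<comment> \<open>The ranks of the whole external sequence \<open>e\<close> need not be bounded
      below \<zeta>, but those at the finitely many variables of \<open>q\<close> are.\<close>
    obtain N where N: "N > 0" "\<forall>n\<in>fm_vars q. n < N" using ex_var_bound by blast
    obtain \<gamma> where g: "\<gamma> \<epsilon> \<zeta>" "\<forall>n<N. e n \<epsilon> V \<gamma>" using ex_bound_rank[OF lim, of N e] e by blast
    then obtain m where m: "m \<epsilon> \<omega>" "\<gamma> \<epsilon> app f m" unfolding \<zeta> by blast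
    have em: "e n \<epsilon> V (app f m)" if "n < N" for n
      using V_mono[OF fO[OF m(1)] m(2)] g(2) that by (auto simp: subset_def)
    obtain s where s: "func s \<omega> (V (app f m))" "\<forall>n<N. app s (num n) = e n"
      using ex_assignment[OF em[OF N(1)], of N e] em by blast
    have eq: "sat E q (e(i := x)) <-> sat E q ((\<lambda>n. ap s (num n))(i := x))" for x
      by (rule sat_cong) (use N s app_eq_ap[OF s(1) num_mem] in auto)
    have "witness_bound (i, q) (app f m) (app f (succ m))"
      using Hh[of "app f m"] iq p m(1) f(3) unfolding H_def I_def by auto
    with x s(1) obtain y where "y \<epsilon> V (app f (succ m))" "sat E q (e(i := y))"
      unfolding witness_bound_def eq by auto
    moreover have "V (app f (succ m)) \<sqsubseteq> V \<zeta>"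
      using V_mono[OF \<open>Ord \<zeta>\<close>] f\<zeta> omega_succ[OF m(1)] by blast
    ultimately show "\<exists>x. x \<epsilon> V \<zeta> & sat E q (e(i := x))" by (auto simp: subset_def)
  qed
  moreover have "\<alpha> \<epsilon> \<zeta>" using f\<zeta>[OF omega_emp] f(2) by simp
  ultimately show ?thesis using lim by blast
qed

text \<open>For a reflecting \<zeta>, truth in the universe, in \<open>V \<zeta>\<close> and in
  \<open>X\<close> coincide at points of \<open>X\<close>, so \<open>j\<close> preserves truth in
  the universe for the chosen formulas. Reflecting \<open>FEx 0 p\<close> together with
  \<open>p\<close> is what puts witnesses into \<open>X\<close>.\<close>

lemma exacting_transfer:
  assumes ex: "exacting \<kappa>" and fin: "finite \<Phi>"
  shows "\<exists>X Y j. V \<kappa> \<sqsubseteq> X & \<kappa> \<epsilon> X & func j X Y & app j \<kappa> = \<kappa> &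
    (\<exists>\<alpha>. \<alpha> \<epsilon> \<kappa> & app j \<alpha> ~= \<alpha>) &
    (\<forall>p\<in>\<Phi>. \<forall>e. (\<forall>n. e n \<epsilon> X) --> (sat E p e <-> sat E p (\<lambda>n. app j (e n)))) &
    (\<forall>p\<in>\<Phi>. \<forall>e. (\<forall>n. e n \<epsilon> X) --> (\<exists>x. sat E p (e(0 := x))) -->
      (\<exists>x. x \<epsilon> X & sat E p (e(0 := x))))"
proof -
  have \<kappa>: "Ord \<kappa>" using ex by (simp add: exacting_def cardinal_def)
  let ?\<Psi> = "\<Phi> \<union> FEx 0 ` \<Phi>"
  have "finite ?\<Psi>" using fin by simp
  from reflection[OF this \<kappa>] obtain \<zeta> where lim: "limit \<zeta>" and \<kappa>\<zeta>: "\<kappa> \<epsilon> \<zeta>"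
    and refl: "\<And>p e. p \<in> ?\<Psi> ==> (\<And>n. e n \<epsilon> V \<zeta>) ==> rsat (V \<zeta>) p e <-> sat E p e" by blast
  have \<zeta>: "Ord \<zeta>" using limit_Ord[OF lim] .
  with ex \<kappa>\<zeta> \<kappa> obtain X j where X: "elem_submodel E X (V \<zeta>)" "V \<kappa> \<sqsubseteq> X" "\<kappa> \<epsilon> X"
    and j: "elem_embedding E j X (V \<zeta>)" "app j \<kappa> = \<kappa>" "\<exists>\<alpha>. \<alpha> \<epsilon> \<kappa> & app j \<alpha> ~= \<alpha>"
    unfolding exacting_def Vset_eq[OF \<kappa>] by (metis Vset_eq)
  have jf: "func j X (V \<zeta>)" using j(1) by (simp add: elem_embedding_def)
  have XV: "x \<epsilon> V \<zeta>" if "x \<epsilon> X" for x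
    using X(1) that by (simp add: elem_submodel_def subset_def)
  have satX: "sat E p e <-> rsat X p e" if "p \<in> ?\<Psi>" "\<And>n. e n \<epsilon> X" for p e
    using refl[OF that(1)] XV that(2) elem_submodel_rsat[OF X(1)] by blast
  have "sat E p e <-> sat E p (\<lambda>n. app j (e n))" if "p \<in> \<Phi>" "\<And>n. e n \<epsilon> X" for p e
    using satX[of p e] that elem_embedding_rsat[OF j(1), of e p] refl[of p "\<lambda>n. app j (e n)"]
      app_mem(2)[OF jf] by auto
  moreover have "\<exists>x. x \<epsilon> X & sat E p (e(0 := x))"
    if p: "p \<in> \<Phi>" and e: "\<And>n. e n \<epsilon> X" and x: "\<exists>x. sat E p (e(0 := x))" for p e
  proof -
    have "sat E (FEx 0 p) e" using x by simp
    then have "rsat X (FEx 0 p) e" using satX[of "FEx 0 p" e] p e by simp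
    then obtain x where "x \<epsilon> X" "rsat X p (e(0 := x))" by auto
    with satX[of p "e(0 := x)"] p e show ?thesis by auto
  qed
  ultimately show ?thesis using X(2,3) j(2,3) jf by blast
qed


section \<open>Representatives of eventual equality\<close>

definition inj_func :: "'a => 'a => 'a => bool" where
  "inj_func f a b <-> func f a b &
    (\<forall>x y. x \<epsilon> a & y \<epsilon> a & ap f x = ap f y --> x = y)"

definition in_range :: "'a => 'a => 'a => bool" where
  "in_range f a y <-> (\<exists>x. x \<epsilon> a & ap f x = y)"

definition ev_eq :: "'a => 'a => bool" where
  "ev_eq u v <-> (\<exists>n. n \<epsilon> \<omega> & (\<forall>k. k \<epsilon> \<omega> & \<not> k \<epsilon> n --> ap u k = ap v k))"

definition is_rep :: "'a => 'a => 'a => 'a => bool" where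
  "is_rep c \<gamma> u v <-> v \<epsilon> c & func v \<omega> \<gamma> & ev_eq u v"

text \<open>A form of the Erdos-Hajnal theorem on \<open>\<omega>\<close>-Jonsson functions: \<open>c\<close> is a set of representatives
  for eventual equality on \<open>\<omega>\<close>-sequences in \<open>\<gamma>\<close>, and the values of representatives of sequences from
  any subset of \<open>e[\<gamma>]\<close> of size \<open>|\<gamma>|\<close> cover \<open>e[\<gamma>]\<close>.\<close>

definition jonsson :: "'a => 'a => 'a => bool" where
  "jonsson \<gamma> c e <-> (\<forall>u. func u \<omega> \<gamma> --> (\<exists>!v. is_rep c \<gamma> u v)) & inj_func e \<gamma> \<gamma> &
    (\<forall>b. inj_func b \<gamma> \<gamma> & (\<forall>x. x \<epsilon> \<gamma> --> in_range e \<gamma> (ap b x)) -->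
      (\<forall>\<xi>. \<xi> \<epsilon> \<gamma> --> (\<exists>m u v. m \<epsilon> \<omega> & func u \<omega> \<gamma> &
        (\<forall>n. n \<epsilon> \<omega> --> in_range b \<gamma> (ap u n)) & is_rep c \<gamma> u v & ap v m = ap e \<xi>)))"

lemma definable_inj_func:
  "Trm K t ==> Trm K u ==> Trm K w ==>
    Def K (\<lambda>e. inj_func (t e) (u e) (w e))"
  by (rule definable_lift3[where P = inj_func])
    (unfold inj_func_def, intro dfn)

lemma definable_in_range:
  "Trm K t ==> Trm K u ==> Trm K w ==>
    Def K (\<lambda>e. in_range (t e) (u e) (w e))"
  by (rule definable_lift3[where P = in_range])
    (unfold in_range_def, intro dfn)

lemma definable_is_rep:
  "Trm K t ==> Trm K u ==> Trm K w ==> Trm K x ==>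
    Def K (\<lambda>e. is_rep (t e) (u e) (w e) (x e))"
  by (rule definable_lift4[where P = is_rep])
    (unfold is_rep_def ev_eq_def, intro dfn)

lemmas definable_jonsson_intros = definable_inj_func definable_in_range definable_is_rep

lemma definable_jonsson:
  "Trm K t ==> Trm K u ==> Trm K w ==>
    Def K (\<lambda>e. jonsson (t e) (u e) (w e))"
  by (rule definable_lift3[where P = jonsson])
    (unfold jonsson_def, intro dfn definable_jonsson_intros)

lemma ev_eq_refl: "ev_eq u u"
  unfolding ev_eq_def using omega_emp by blast

lemma ev_eq_sym: "ev_eq u v ==> ev_eq v u"
  unfolding ev_eq_def by metis

lemma ev_eq_trans:
  assumes "ev_eq u v" "ev_eq v w"
  shows "ev_eq u w"
proof -
  from assms obtain m n where m: "m \<epsilon> \<omega>" "\<And>k. k \<epsilon> \<omega> & \<not> k \<epsilon> m ==> ap u k = ap v k"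
    and n: "n \<epsilon> \<omega>" "\<And>k. k \<epsilon> \<omega> & \<not> k \<epsilon> n ==> ap v k = ap w k"
    unfolding ev_eq_def by blast
  obtain c where c: "c \<epsilon> \<omega>" "m \<epsilon> succ c" "n \<epsilon> succ c"
    using Ord_max[OF Ord_omega m(1) n(1)] .
  have "Ord (succ c)" using Ord_succ Ord_mem[OF Ord_omega] c(1) by blast
  then have "\<not> k \<epsilon> m & \<not> k \<epsilon> n" if "\<not> k \<epsilon> succ c" for k
    using c(2,3) that Ord_trans by blast
  then show ?thesis unfolding ev_eq_def
    using m(2) n(2) omega_succ[OF c(1)] by (metis (no_types))
qed

lemma ex_representatives: "\<exists>c. \<forall>u. func u \<omega> \<gamma> --> (\<exists>!v. is_rep c \<gamma> u v)"
proof -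
  define F where "F = collect (\<lambda>k. \<exists>u. func u \<omega> \<gamma> & (\<forall>v. v \<epsilon> k <-> func v \<omega> \<gamma> & ev_eq u v))"
  have F: "k \<epsilon> F <-> (\<exists>u. func u \<omega> \<gamma> & (\<forall>v. v \<epsilon> k <-> func v \<omega> \<gamma> & ev_eq u v))" for k
    unfolding F_def
  proof (rule mem_collect[where a = "Pw (Pw (prod \<omega> \<gamma>))"])
    show "k \<epsilon> Pw (Pw (prod \<omega> \<gamma>))"
      if "\<exists>u. func u \<omega> \<gamma> & (\<forall>v. v \<epsilon> k <-> func v \<omega> \<gamma> & ev_eq u v)" for k
      using that by (auto simp: subset_def func_iff)
  qed (unfold ev_eq_def, intro dfn)
  have "\<exists>c. \<forall>k. k \<epsilon> F --> (\<exists>!z. z \<epsilon> k & z \<epsilon> c)"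
  proof (rule choice)
    show "\<exists>z. z \<epsilon> k" if "k \<epsilon> F" for k
      using that ev_eq_refl unfolding F by blast
    show "k = l" if "k \<epsilon> F" "l \<epsilon> F" "z \<epsilon> k" "z \<epsilon> l" for k l z
    proof -
      from that obtain u v where "\<And>w. w \<epsilon> k <-> func w \<omega> \<gamma> & ev_eq u w"
        "\<And>w. w \<epsilon> l <-> func w \<omega> \<gamma> & ev_eq v w" unfolding F by blast
      with that(3,4) show ?thesis
        by (intro extensionality) (metis ev_eq_sym ev_eq_trans)
    qed
  qed
  then obtain c where c: "\<And>k. k \<epsilon> F ==> \<exists>!z. z \<epsilon> k & z \<epsilon> c" by blast
  have "\<exists>!v. is_rep c \<gamma> u v" if u: "func u \<omega> \<gamma>" for u
  proof -
    have "Def UNIV (\<lambda>e. ev_eq u (e 0))" unfolding ev_eq_def by (intro dfn)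
    from ex1_set[where P = "ev_eq u", OF this] obtain k
      where k: "\<And>v. v \<epsilon> k <-> func v \<omega> \<gamma> & ev_eq u v" by blast
    with u have "k \<epsilon> F" unfolding F by blast
    from c[OF this] show ?thesis unfolding is_rep_def k by (simp add: conj_ac)
  qed
  then show ?thesis by blast
qed

text \<open>If no injection works, every injection has one into its range for which some point of
  that range is bad, that is, missed by the values of all representatives of sequences in the
  smaller range. Iterating from the identity gives shrinking ranges and points \<open>t n\<close> in
  the n-th range that are bad for the next one. The representative of \<open>t\<close> takes the
  value \<open>t n\<close> at some \<open>n\<close> past the point of agreement, yet it also
  represents a modification of \<open>t\<close> that stays in the next range, a
  contradiction.\<close>

lemma ex_jonsson: "\<exists>c e. jonsson \<gamma> c e"
proof -
  obtain c where c: "\<And>u. func u \<omega> \<gamma> ==> \<exists>!v. is_rep c \<gamma> u v" using ex_representatives by blast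
  define bad where "bad b y <-> (\<forall>m u v. m \<epsilon> \<omega> & func u \<omega> \<gamma> &
    (\<forall>n. n \<epsilon> \<omega> --> in_range b \<gamma> (ap u n)) & is_rep c \<gamma> u v --> ap v m ~= y)" for b y
  define N where "N e b <-> inj_func b \<gamma> \<gamma> & (\<forall>x. x \<epsilon> \<gamma> --> in_range e \<gamma> (ap b x)) &
    (\<exists>\<xi>. \<xi> \<epsilon> \<gamma> & bad b (ap e \<xi>))" for e b
  have dN: "Def UNIV (\<lambda>e. N (e 0) (e 1))"
    unfolding N_def bad_def by (intro dfn definable_jonsson_intros)
  show ?thesis
  proof (rule ccontr)
    assume contra: "\<not> ?thesis"
    have N_ex: "\<exists>b. N e b" if e: "inj_func e \<gamma> \<gamma>" for e
    proof -
      have "\<not> jonsson \<gamma> c e" using contra by blast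
      then show ?thesis using c e unfolding jonsson_def N_def bad_def by blast
    qed
    define I where "I = collect (\<lambda>e. inj_func e \<gamma> \<gamma>)"
    have I: "e \<epsilon> I <-> inj_func e \<gamma> \<gamma>" for e
      unfolding I_def
    proof (rule mem_collect[where a = "Pw (prod \<gamma> \<gamma>)"])
      show "e \<epsilon> Pw (prod \<gamma> \<gamma>)" if "inj_func e \<gamma> \<gamma>" for e
        using that by (simp add: inj_func_def func_iff)
    qed (intro dfn definable_jonsson_intros)
    have "\<exists>b. b \<epsilon> I & N e b" if "e \<epsilon> I" for e
      using N_ex that unfolding I N_def by blast
    from choice_function[where R = N, OF dN this] obtain g
      where g: "func g I I" "\<And>e. e \<epsilon> I ==> N e (app g e)" by blast
    have "Trm UNIV (\<lambda>e. e 0)" by (intro dfn)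
    from make_func[where h = "\<lambda>x. x", OF this, of \<gamma> \<gamma>] obtain d
      where d: "func d \<gamma> \<gamma>" "\<And>x. x \<epsilon> \<gamma> ==> app d x = x" by blast
    then have dI: "d \<epsilon> I" unfolding I inj_func_def using app_eq_ap[OF d(1)] by auto
    have "Trm UNIV (\<lambda>e. ap g (e 0))" by (intro dfn)
    from omega_iterate[where g = "ap g" and a = d, OF this] obtain f B
      where f: "func f \<omega> B" "app f emp = d"
        "\<And>n. n \<epsilon> \<omega> ==> app f (succ n) = ap g (app f n)" by blast
    note apf = app_eq_ap[OF f(1)]
    have fI: "ap f n \<epsilon> I" if "n \<epsilon> \<omega>" for n
    proof (rule omega_induct[where P = "\<lambda>n. ap f n \<epsilon> I", OF _ that])
      show "ap f emp \<epsilon> I" using f(2) apf[OF omega_emp] dI by simp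
      show "ap f (succ n) \<epsilon> I" if "n \<epsilon> \<omega>" "ap f n \<epsilon> I" for n
        using f(3)[OF that(1)] apf[OF that(1)] apf[OF omega_succ[OF that(1)]]
          app_eq_ap[OF g(1) that(2)] app_mem(2)[OF g(1) that(2)] by simp
    qed (intro dfn)
    have fN: "N (ap f n) (ap f (succ n))" if "n \<epsilon> \<omega>" for n
      using g(2)[OF fI[OF that]] app_eq_ap[OF g(1) fI[OF that]] f(3)[OF that] apf[OF that]
        apf[OF omega_succ[OF that]] by simp
    let ?P = "\<lambda>k. \<forall>n y. n \<epsilon> succ k & in_range (ap f k) \<gamma> y --> in_range (ap f n) \<gamma> y"
    have "?P k" if "k \<epsilon> \<omega>" for k
    proof (rule omega_induct[where P = ?P, OF _ that])
      fix k assume k: "k \<epsilon> \<omega>" and IH: "?P k"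
      have "in_range (ap f k) \<gamma> y" if "in_range (ap f (succ k)) \<gamma> y" for y
        using fN[OF k] that unfolding N_def in_range_def by blast
      then show "?P (succ k)" using IH by (metis mem_succ)
    qed (intro dfn definable_in_range, simp)
    then have sub: "in_range (ap f n) \<gamma> y"
      if "n \<epsilon> succ k" "k \<epsilon> \<omega>" "in_range (ap f k) \<gamma> y" for n k y
      using that by blast
    define R where "R n y <-> in_range (ap f n) \<gamma> y & bad (ap f (succ n)) y" for n y
    have dR: "Def UNIV (\<lambda>e. R (e 0) (e 1))"
      unfolding R_def bad_def by (intro dfn definable_jonsson_intros)
    have "\<exists>y. y \<epsilon> \<gamma> & R n y" if n: "n \<epsilon> \<omega>" for n
    proof -
      obtain \<xi> where x: "\<xi> \<epsilon> \<gamma>" "bad (ap f (succ n)) (ap (ap f n) \<xi>)"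
        using fN[OF n] unfolding N_def by blast
      have "func (ap f n) \<gamma> \<gamma>" using fI[OF n] unfolding I inj_func_def by blast
      from app_mem(2)[OF this x(1)] app_eq_ap[OF this x(1)] x show ?thesis
        unfolding R_def in_range_def by auto
    qed
    from choice_function[where R = R, OF dR this] obtain t
      where t: "func t \<omega> \<gamma>" "\<And>n. n \<epsilon> \<omega> ==> R n (app t n)" by blast
    note apt = app_eq_ap[OF t(1)]
    obtain v where v: "is_rep c \<gamma> t v" using c[OF t(1)] by blast
    then obtain n where n: "n \<epsilon> \<omega>" "\<And>k. k \<epsilon> \<omega> ==> \<not> k \<epsilon> n ==> ap t k = ap v k"
      unfolding is_rep_def ev_eq_def by blast
    note sn = omega_succ[OF n(1)]
    \<comment> \<open>\<open>u\<close> is \<open>t\<close> with all entries up to \<open>n\<close>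
      overwritten by the entry at \<open>succ n\<close>. Its values then lie in the range of
      \<open>ap f (succ n)\<close>, and it is still eventually equal to \<open>t\<close>.\<close>
    define Q where "Q k y <-> k \<epsilon> succ n & y = ap t (succ n) | \<not> k \<epsilon> succ n & y = ap t k" for k y
    have "\<exists>u. func u \<omega> \<gamma> & (\<forall>k. k \<epsilon> \<omega> --> Q k (app u k))"
    proof (rule choice_function)
      show "Def UNIV (\<lambda>e. Q (e 0) (e 1))" unfolding Q_def by (intro dfn)
      show "\<exists>y. y \<epsilon> \<gamma> & Q k y" if "k \<epsilon> \<omega>" for k
        using app_mem(2)[OF t(1)] apt that sn unfolding Q_def by metis
    qed
    then obtain u where u: "func u \<omega> \<gamma>" "\<And>k. k \<epsilon> \<omega> ==> Q k (app u k)" by blast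
    have uQ: "Q k (ap u k)" if "k \<epsilon> \<omega>" for k using u(2)[OF that] app_eq_ap[OF u(1) that] by simp
    have on: "Ord n" using Ord_mem[OF Ord_omega n(1)] .
    have "ap u k = ap v k" if k: "k \<epsilon> \<omega>" "\<not> k \<epsilon> succ n" for k
      using uQ[OF k(1)] k n(2)[OF k(1)] unfolding Q_def by auto
    then have "is_rep c \<gamma> u v" using v sn unfolding is_rep_def ev_eq_def by blast
    moreover have "in_range (ap f (succ n)) \<gamma> (ap u k)" if k: "k \<epsilon> \<omega>" for k
    proof -
      have *: "in_range (ap f l) \<gamma> (ap t l)" if "l \<epsilon> \<omega>" for l
        using t(2)[OF that] apt[OF that] unfolding R_def by simp
      show ?thesis
      proof (cases "k \<epsilon> succ n")
        case True
        then show ?thesis using uQ[OF k] *[OF sn] unfolding Q_def by simp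
      next
        case False
        have "succ n \<epsilon> succ k"
          by (rule Ord_mem_succ[OF _ _ False]) (use Ord_mem[OF Ord_omega] sn k in blast)+
        from sub[OF this k *[OF k]] False show ?thesis using uQ[OF k] unfolding Q_def by simp
      qed
    qed
    moreover have "ap v n = ap t n" using n by simp
    moreover have "bad (ap f (succ n)) (ap t n)"
      using t(2)[OF n(1)] apt[OF n(1)] unfolding R_def by simp
    ultimately show False using u(1) n(1) unfolding bad_def by blast
  qed
qed

section \<open>Cardinals and the hierarchy\<close>

lemma V_limit_func:
  assumes l: "limit l" and f: "func f a b" and "a \<epsilon> V l" "b \<epsilon> V l"
  shows "f \<epsilon> V l"
proof -
  have o: "Ord l" using limit_Ord[OF l] .
  from assms obtain \<alpha> \<beta> where a: "\<alpha> \<epsilon> l" "a \<sqsubseteq> V \<alpha>" and b: "\<beta> \<epsilon> l" "b \<sqsubseteq> V \<beta>"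
    unfolding mem_V[of _ l] by blast
  obtain c where c: "c \<epsilon> l" "\<alpha> \<epsilon> succ c" "\<beta> \<epsilon> succ c" using Ord_max[OF o a(1) b(1)] .
  have oc: "Ord c" using Ord_mem[OF o c(1)] .
  have ab: "x \<epsilon> V c" if "x \<epsilon> a | x \<epsilon> b" for x
    using that a(2) b(2) V_mono_succ[OF oc c(2)] V_mono_succ[OF oc c(3)] by (auto simp: subset_def)
  have pair: "upair x y \<epsilon> V (succ d)" if "Ord d" "x \<epsilon> V d" "y \<epsilon> V d" for d x y
    using that mem_V_succ[OF that(1)] by (auto simp: subset_def)
  have "f \<sqsubseteq> V (succ (succ c))"
  proof (rule subsetI)
    fix z assume "z \<epsilon> f"
    then obtain x y where "x \<epsilon> a" "y \<epsilon> b" "z = opair x y"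
      using f by (auto simp: func_iff subset_def mem_prod)
    then show "z \<epsilon> V (succ (succ c))"
      unfolding opair_eq using ab by (auto intro!: pair Ord_succ oc)
  qed
  then show ?thesis using V_limit_subset[OF l] limit_succ[OF l] c(1) by blast
qed

text \<open>Hilbert's hotel: if \<kappa> were an infinite successor of \<delta>, sending 0 to
  \<delta>, each n + 1 to n and fixing everything outside \<omega> would map \<delta> bijectively
  onto \<kappa>.\<close>

lemma cardinal_limit:
  assumes "cardinal E UNIV \<kappa>" "\<omega> \<epsilon> \<kappa>"
  shows "limit \<kappa>"
proof (rule ccontr)
  assume n: "\<not> ?thesis"
  have o: "Ord \<kappa>" using assms(1) by (simp add: cardinal_def)
  with n assms(2) obtain \<delta> where d: "\<delta> \<epsilon> \<kappa>" "\<And>z. z \<epsilon> \<kappa> ==> \<not> \<delta> \<epsilon> z"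
    unfolding limit_iff by blast
  have od: "Ord \<delta>" using Ord_mem[OF o d(1)] .
  have \<kappa>: "z \<epsilon> \<kappa> <-> z \<epsilon> \<delta> | z = \<delta>" for z
    using d o od Ord_linear[OF _ od, of z] Ord_mem[OF o] Ord_trans[OF o] by blast
  have w: "n \<epsilon> \<delta>" if "n \<epsilon> \<omega>" for n
    using assms(2) that Ord_trans[OF od] unfolding \<kappa> by blast
  have nd: "\<not> \<delta> \<epsilon> \<omega>" using w[of \<delta>] by auto
  define R where "R x y <-> x = emp & y = \<delta> | (\<exists>n. n \<epsilon> \<omega> & x = succ n & y = n) |
    \<not> x \<epsilon> \<omega> & y = x" for x y
  have "\<exists>f. func f \<delta> \<kappa> & (\<forall>x. x \<epsilon> \<delta> --> R x (app f x))"
  proof (rule choice_function)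
    show "Def UNIV (\<lambda>e. R (e 0) (e 1))" unfolding R_def by (intro dfn)
    show "\<exists>y. y \<epsilon> \<kappa> & R x y" if "x \<epsilon> \<delta>" for x
    proof (cases "x \<epsilon> \<omega>")
      case True
      then show ?thesis
      proof (cases rule: omega_cases)
        case (2 m)
        then show ?thesis using w unfolding R_def \<kappa> by blast
      qed (auto simp: R_def \<kappa>)
    qed (use that in \<open>auto simp: R_def \<kappa>\<close>)
  qed
  then obtain f where f: "func f \<delta> \<kappa>" "\<And>x. x \<epsilon> \<delta> ==> R x (app f x)" by blast
  have "\<exists>!x. x \<epsilon> \<delta> & app f x = y" if y: "y \<epsilon> \<kappa>" for y
  proof -
    have "z = z'" if "R x z" "R x z'" for x z z'
      using that unfolding R_def by (metis omega_succ omega_emp succ_inject succ_neq_emp(1))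
    then have R1: "app f x = y <-> R x y" if "x \<epsilon> \<delta>" for x
      using f(2)[OF that] by blast
    consider "y = \<delta>" | "y \<epsilon> \<omega>" | "y \<epsilon> \<delta>" "\<not> y \<epsilon> \<omega>" "y ~= \<delta>" using y \<kappa> by auto
    then have "\<exists>x. x \<epsilon> \<delta> & R x y"
    proof cases
      case 1 then show ?thesis using w[OF omega_emp] by (auto simp: R_def)
    next
      case 2 then show ?thesis using w[OF omega_succ] by (auto simp: R_def)
    next
      case 3 then show ?thesis by (auto simp: R_def)
    qed
    moreover have "x = x'" if "x \<epsilon> \<delta>" "R x y" "x' \<epsilon> \<delta>" "R x' y" for x x'
      using that nd unfolding R_def by auto
    ultimately show ?thesis using R1 by metis
  qed
  then have "is_bij E UNIV f \<delta> \<kappa>"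
    unfolding is_bij_def maps_to_iff using f(1) func_mem_iff[OF f(1)] by simp
  with assms(1) d(1) show False unfolding cardinal_def by blast
qed


section \<open>Definability from parameters\<close>

text \<open>The condition of \<open>OD\<close> rephrased with the definable operations
  \<open>V\<close> and \<open>ap\<close>. The requirement that parameters come from the class or the
  ordinals is split off, since that class is external to the model.\<close>

definition is_defined :: "'a => 'a => 'a => 'a => 'a => bool" where
  "is_defined x \<beta> n q p <-> Ord \<beta> & x \<epsilon> V \<beta> & n \<epsilon> \<omega> & func q n (V \<beta>) & formula p &
     (\<forall>y s. y \<epsilon> V \<beta> & func s \<omega> (V \<beta>) & ap s emp = y &
            (\<forall>i. i \<epsilon> n --> ap s (succ i) = ap q i)
        --> (Sat (V \<beta>) p s <-> y = x))"

lemma definable_is_defined: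
  "Trm K t1 ==> Trm K t2 ==> Trm K t3 ==>
    Trm K t4 ==> Trm K t5 ==>
    Def K (\<lambda>e. is_defined (t1 e) (t2 e) (t3 e) (t4 e) (t5 e))"
  by (rule definable_lift5[where P = is_defined])
    (unfold is_defined_def, intro dfn)

lemma omega_mem_trans: "n \<epsilon> \<omega> ==> i \<epsilon> n ==> i \<epsilon> \<omega>"
  using Ord_trans[OF Ord_omega] by blast

lemma OD_iff:
  "x \<in> OD \<Gamma> <-> (\<exists>\<beta> n q p. is_defined x \<beta> n q p & (\<forall>i. i \<epsilon> n --> ap q i \<in> \<Gamma> | Ord (ap q i)))"
proof -
  have "Ord \<beta> & x \<epsilon> Vset \<beta> &
     n \<epsilon> omega E & func q n (Vset \<beta>) & (\<forall>i. i \<epsilon> n --> app q i \<in> \<Gamma> | Ord (app q i)) &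
     formula p &
     (\<forall>y s. y \<epsilon> Vset \<beta> & func s \<omega> (Vset \<beta>) & app s emp = y &
            (\<forall>i. i \<epsilon> n --> app s (succ i) = app q i)
        --> (Sat (Vset \<beta>) p s <-> y = x)) <->
     is_defined x \<beta> n q p & (\<forall>i. i \<epsilon> n --> ap q i \<in> \<Gamma> | Ord (ap q i))"
    (is "?l <-> ?r") for \<beta> n q p
  proof (cases "Ord \<beta> & n \<epsilon> \<omega> & func q n (V \<beta>)")
    case True
    then have b: "Ord \<beta>" and n: "n \<epsilon> \<omega>" and q: "func q n (V \<beta>)" by auto
    have q': "app q i = ap q i" if "i \<epsilon> n" for i using app_eq_ap[OF q that] .
    have "(\<forall>y s. y \<epsilon> V \<beta> & func s \<omega> (V \<beta>) & app s emp = y &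
            (\<forall>i. i \<epsilon> n --> app s (succ i) = app q i)
        --> (Sat (V \<beta>) p s <-> y = x)) <-> (\<forall>y s. y \<epsilon> V \<beta> & func s \<omega> (V \<beta>) & ap s emp = y &
            (\<forall>i. i \<epsilon> n --> ap s (succ i) = ap q i)
        --> (Sat (V \<beta>) p s <-> y = x))"
      using n by (simp add: q' app_eq_ap[where a = \<omega> and b = "V \<beta>"] omega_emp omega_succ
          omega_mem_trans cong: conj_cong)
    with b n q show ?thesis by (simp add: Vset_eq is_defined_def q') blast
  next
    case False
    then show ?thesis by (auto simp: is_defined_def Vset_eq)
  qed
  note * = this
  show ?thesis by (simp only: OD_def mem_Collect_eq *)
qed

text \<open>The defining condition would be vacuous without an admissible assignment. One is built
  with \<open>x\<close> at variable 0 and, as a default, at all variables beyond the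
  parameters.\<close>

lemma is_defined_unique:
  assumes "is_defined x \<beta> n q p" "is_defined x' \<beta> n q p"
  shows "x = x'"
proof -
  from assms(1) have x: "x \<epsilon> V \<beta>" and n: "n \<epsilon> \<omega>" and q: "func q n (V \<beta>)"
    by (auto simp: is_defined_def)
  define R where "R k y <-> (\<exists>i. i \<epsilon> n & k = succ i & y = ap q i) |
    \<not> (\<exists>i. i \<epsilon> n & k = succ i) & y = x" for k y
  have "\<exists>s. func s \<omega> (V \<beta>) & (\<forall>k. k \<epsilon> \<omega> --> R k (app s k))"
  proof (rule choice_function)
    show "Def UNIV (\<lambda>e. R (e 0) (e 1))" unfolding R_def by (intro dfn)
    show "\<exists>y. y \<epsilon> V \<beta> & R k y" if "k \<epsilon> \<omega>" for k
      using x app_mem(2)[OF q] app_eq_ap[OF q] unfolding R_def by metis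
  qed
  then obtain s where s: "func s \<omega> (V \<beta>)" "\<And>k. k \<epsilon> \<omega> ==> R k (app s k)" by blast
  have s': "R k (ap s k)" if "k \<epsilon> \<omega>" for k using s(2)[OF that] app_eq_ap[OF s(1) that] by simp
  have "ap s emp = x" using s'[OF omega_emp] by (simp add: R_def)
  moreover have "ap s (succ i) = ap q i" if "i \<epsilon> n" for i
    using s'[OF omega_succ[OF omega_mem_trans[OF n that]]] that by (auto simp: R_def)
  ultimately show ?thesis using assms x s(1) unfolding is_defined_def by blast
qed

text \<open>The parameters of \<open>least_def\<close> are \<open>n\<close>, the formula \<open>p\<close> and the entries of \<open>q\<close> that are not
  ordinals, which are stored in \<open>r\<close>. The ordinals in \<open>\<beta>, q\<close> are minimized.\<close>

definition cofinal_def :: "'a => 'a => 'a => 'a => 'a => 'a => 'a => 'a => bool" where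
  "cofinal_def \<kappa> n p r a \<beta> q f <-> is_defined f \<beta> n q p &
     (\<forall>i. i \<epsilon> n --> (Ord (ap r i) & Ord (ap q i)) | (\<not> Ord (ap r i) & ap q i = ap r i)) &
     func f a \<kappa> & (\<forall>b. b \<epsilon> \<kappa> --> (\<exists>x. x \<epsilon> a & b \<epsilon> succ (ap f x)))"

definition agree :: "'a => 'a => 'a => bool" where
  "agree k q q' <-> (\<forall>i. i \<epsilon> k --> ap q i = ap q' i)"

definition lex_less :: "'a => 'a => 'a => bool" where
  "lex_less n q q' <-> (\<exists>k. k \<epsilon> n & ap q k \<epsilon> ap q' k & agree k q q')"

definition least_def :: "'a => 'a => 'a => 'a => 'a => 'a => bool" where
  "least_def \<kappa> n p r a f <-> (\<exists>\<beta> q. cofinal_def \<kappa> n p r a \<beta> q f &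
     (\<forall>\<beta>' q' f'. cofinal_def \<kappa> n p r a \<beta>' q' f' --> \<beta> \<epsilon> \<beta>' | (\<beta> = \<beta>' & (q = q' | lex_less n q q'))))"

text \<open>All of \<open>n\<close>, \<open>p\<close>, \<open>r\<close> and \<open>a\<close> are
  bounded by \<gamma>, so that they become fixed points of the embedding once it fixes
  \<open>V \<gamma>\<close> pointwise. No parameter besides \<kappa> is left.\<close>

definition least_rank :: "'a => 'a => bool" where
  "least_rank \<kappa> \<gamma> <-> Ord \<gamma> &
     (\<exists>n p r a f. n \<epsilon> V \<gamma> & p \<epsilon> V \<gamma> & r \<epsilon> V \<gamma> & a \<epsilon> V \<gamma> & least_def \<kappa> n p r a f) &
     (\<forall>\<delta>. \<delta> \<epsilon> \<gamma> -->
       \<not> (\<exists>n p r a f. n \<epsilon> V \<delta> & p \<epsilon> V \<delta> & r \<epsilon> V \<delta> & a \<epsilon> V \<delta> & least_def \<kappa> n p r a f))"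

lemma definable_lex_less: 
  "Trm K t ==> Trm K u ==> Trm K w ==>
    Def K (\<lambda>e. lex_less (t e) (u e) (w e))"
  by (rule definable_lift3[where P = lex_less])
    (unfold lex_less_def agree_def, intro dfn)

lemma definable_cofinal_def:
  "Def K (\<lambda>e. cofinal_def (e k1) (e k2) (e k3) (e k4) (e k5) (e k6) (e k7) (e k8))"
  unfolding cofinal_def_def by (intro dfn definable_is_defined)

lemma definable_least_def:
  assumes "Trm K t1" "Trm K t2" "Trm K t3"
    "Trm K t4" "Trm K t5" "Trm K t6"
  shows "Def K (\<lambda>e. least_def (t1 e) (t2 e) (t3 e) (t4 e) (t5 e) (t6 e))"
proof -
  have "Def K (\<lambda>e. least_def (e 0) (e 1) (e 2) (e 3) (e 4) (e 5))"
    unfolding least_def_def by (intro dfn definable_lex_less definable_cofinal_def)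
  from definable_lift[OF this, of "[t1, t2, t3, t4, t5, t6]"] assms show ?thesis by simp
qed

lemma definable_least_rank: "Def K (\<lambda>e. least_rank (e k1) (e k2))"
  unfolding least_rank_def by (intro dfn definable_least_def)

lemma lex_less_asym:
  assumes "Ord n" "lex_less n q q'" "lex_less n q' q"
  shows False
proof -
  from assms obtain k l where k: "k \<epsilon> n" "ap q k \<epsilon> ap q' k" "agree k q q'"
    and l: "l \<epsilon> n" "ap q' l \<epsilon> ap q l" "agree l q' q" unfolding lex_less_def by blast
  have "k \<epsilon> l | k = l | l \<epsilon> k" using Ord_linear Ord_mem[OF assms(1)] k(1) l(1) by blast
  then show False
  proof (elim disjE)
    assume "k \<epsilon> l"
    then have "ap q' k = ap q k" using l(3) unfolding agree_def by blast
    with k(2) show False by simp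
  next
    assume "k = l"
    then show False using k(2) l(2) mem_asym by blast
  next
    assume "l \<epsilon> k"
    then have "ap q l = ap q' l" using k(3) unfolding agree_def by blast
    with l(2) show False by simp
  qed
qed

lemma least_def_unique:
  assumes "least_def \<kappa> n p r a f" "least_def \<kappa> n p r a f'"
  shows "f = f'"
proof -
  from assms(1) obtain \<beta> q where 1: "cofinal_def \<kappa> n p r a \<beta> q f"
    "\<And>\<beta>' q' f'. cofinal_def \<kappa> n p r a \<beta>' q' f' ==> \<beta> \<epsilon> \<beta>' | (\<beta> = \<beta>' & (q = q' | lex_less n q q'))"
    unfolding least_def_def by blast
  from assms(2) obtain \<beta>' q' where 2: "cofinal_def \<kappa> n p r a \<beta>' q' f'"
    "\<And>\<beta> q f. cofinal_def \<kappa> n p r a \<beta> q f ==> \<beta>' \<epsilon> \<beta> | (\<beta>' = \<beta> & (q' = q | lex_less n q' q))"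
    unfolding least_def_def by blast
  have n: "Ord n" using 1(1) Ord_mem[OF Ord_omega] unfolding cofinal_def_def is_defined_def by blast
  have "\<beta> = \<beta>'" using 1(2)[OF 2(1)] 2(2)[OF 1(1)] mem_asym by blast
  moreover have "q = q'" using 1(2)[OF 2(1)] 2(2)[OF 1(1)] lex_less_asym[OF n] calculation by auto
  ultimately show ?thesis using 1(1) 2(1) is_defined_unique unfolding cofinal_def_def by blast
qed

text \<open>The length \<open>n\<close> is a natural number of the model, so the lexicographic
  minimum is found by internal induction: among the tuples that agree with the current one below
  \<open>k\<close>, entry \<open>k\<close> is minimized. Where \<open>r\<close> holds a non-ordinal,
  the entry is prescribed and all tuples agree.\<close>

lemma ex_least_def:
  assumes c: "cofinal_def \<kappa> n p r a \<beta>0 q0 f0"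
  shows "\<exists>f. least_def \<kappa> n p r a f"
proof -
  define W where "W \<beta> q <-> (\<exists>f. cofinal_def \<kappa> n p r a \<beta> q f)" for \<beta> q
  have dW: "Trm UNIV t ==> Trm UNIV u ==> Def UNIV (\<lambda>e. W (t e) (u e))" for t u
  proof (rule definable_lift2[where P = W])
    show "Def UNIV (\<lambda>e. W (e 0) (e 1))"
      unfolding W_def cofinal_def_def by (intro dfn definable_is_defined)
  qed
  have WO: "Ord \<beta>" if "W \<beta> q" for \<beta> q using that unfolding W_def cofinal_def_def is_defined_def by blast
  have n: "n \<epsilon> \<omega>" using c unfolding cofinal_def_def is_defined_def by blast
  have on: "Ord n" using Ord_mem[OF Ord_omega n] .
  have "Def UNIV (\<lambda>e. \<exists>q. W (e 0) q)" by (intro dfn dW)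
  from Ord_least[where P = "\<lambda>\<beta>. \<exists>q. W \<beta> q", OF this, of \<beta>0] c WO
  obtain \<beta> where \<beta>: "Ord \<beta>" "\<exists>q. W \<beta> q" "\<And>\<beta>'. \<beta>' \<epsilon> \<beta> ==> \<not> (\<exists>q. W \<beta>' q)"
    unfolding W_def by blast
  let ?P = "\<lambda>k. k \<epsilon> succ n --> (\<exists>q. W \<beta> q & (\<forall>q'. W \<beta> q' --> agree k q q' | lex_less k q q'))"
  have min: "?P k" if "k \<epsilon> \<omega>" for k
  proof (rule omega_induct[where P = ?P, OF _ that])
    show "Def UNIV (\<lambda>e. ?P (e 0))"
      unfolding agree_def by (intro dfn dW definable_lex_less)
    show "?P emp" using \<beta>(2) by (auto simp: agree_def)
    fix k assume k: "k \<epsilon> \<omega>" and IH: "?P k"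
    show "?P (succ k)"
    proof
      assume sk: "succ k \<epsilon> succ n"
      have kn: "k \<epsilon> n" using sk Ord_trans[OF on, of "succ k" k] by auto
      with IH obtain q where q: "W \<beta> q" "\<And>q'. W \<beta> q' ==> agree k q q' | lex_less k q q'" by auto
      have step: "\<exists>q1. W \<beta> q1 & agree k q q1 &
        (\<forall>q'. W \<beta> q' & agree k q q' --> ap q1 k = ap q' k | ap q1 k \<epsilon> ap q' k)"
      proof (cases "Ord (ap r k)")
        case True
        have O: "Ord (ap q' k)" if "W \<beta> q'" for q'
          using that True kn unfolding W_def cofinal_def_def by blast
        have "Def UNIV (\<lambda>e. \<exists>q'. W \<beta> q' & agree k q q' & ap q' k = e 0)"
          unfolding agree_def by (intro dfn dW)
        from Ord_least[where P = "\<lambda>z. \<exists>q'. W \<beta> q' & agree k q q' & ap q' k = z", OF this, of "ap q k"]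
        obtain m where m: "Ord m" "\<exists>q'. W \<beta> q' & agree k q q' & ap q' k = m"
          "\<And>b. b \<epsilon> m ==> \<not> (\<exists>q'. W \<beta> q' & agree k q q' & ap q' k = b)"
          using q(1) O unfolding agree_def by blast
        then obtain q1 where q1: "W \<beta> q1" "agree k q q1" "ap q1 k = m" by blast
        have "ap q1 k = ap q' k | ap q1 k \<epsilon> ap q' k" if "W \<beta> q'" "agree k q q'" for q'
          using Ord_linear[OF m(1) O[OF that(1)]] m(3)[of "ap q' k"] that q1(3) by auto
        with q1 show ?thesis by blast
      next
        case False
        have "ap q' k = ap r k" if "W \<beta> q'" for q'
          using that False kn unfolding W_def cofinal_def_def by blast
        with q(1) show ?thesis by (metis agree_def)
      qed
      then obtain q1 where q1: "W \<beta> q1" "agree k q q1"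
        "\<And>q'. W \<beta> q' ==> agree k q q' ==> ap q1 k = ap q' k | ap q1 k \<epsilon> ap q' k" by blast
      have "agree (succ k) q1 q' | lex_less (succ k) q1 q'" if q': "W \<beta> q'" for q'
      proof (cases "agree k q q'")
        case True
        then have "agree k q1 q'" using q1(2) by (auto simp: agree_def)
        with q1(3)[OF q' True] show ?thesis by (auto simp: agree_def lex_less_def)
      next
        case False
        with q(2)[OF q'] obtain i where i: "i \<epsilon> k" "ap q i \<epsilon> ap q' i" "agree i q q'"
          unfolding lex_less_def by blast
        have "Ord k" using Ord_mem[OF Ord_omega k] .
        then have "agree i q1 q'" using i q1(2) Ord_trans unfolding agree_def by metis
        with i q1(2) show ?thesis unfolding lex_less_def agree_def by auto
      qed
      with q1(1) show "\<exists>q. W \<beta> q & (\<forall>q'. W \<beta> q' --> agree (succ k) q q' | lex_less (succ k) q q')"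
        by blast
    qed
  qed
  obtain q where q: "W \<beta> q" "\<And>q'. W \<beta> q' ==> agree n q q' | lex_less n q q'"
    using min[OF n] by auto
  then obtain f where f: "cofinal_def \<kappa> n p r a \<beta> q f" unfolding W_def by blast
  have "\<beta> \<epsilon> \<beta>' | (\<beta> = \<beta>' & (q = q' | lex_less n q q'))" if c': "cofinal_def \<kappa> n p r a \<beta>' q' f'" for \<beta>' q' f'
  proof -
    have W': "W \<beta>' q'" using c' unfolding W_def by blast
    have "\<not> \<beta>' \<epsilon> \<beta>" using \<beta>(3) W' by blast
    then have "\<beta> \<epsilon> \<beta>' | \<beta> = \<beta>'" using Ord_linear[OF \<beta>(1) WO[OF W']] by blast
    moreover have "q = q' | lex_less n q q'" if "\<beta> = \<beta>'"
    proof -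
      have fn: "func q n (V \<beta>)" "func q' n (V \<beta>)"
        using f c' that unfolding cofinal_def_def is_defined_def by auto
      have "q = q'" if "agree n q q'"
        by (rule func_ext[OF fn]) (use that app_eq_ap[OF fn(1)] app_eq_ap[OF fn(2)] in \<open>simp add: agree_def\<close>)
      with q(2) W' that show ?thesis by blast
    qed
    ultimately show ?thesis by blast
  qed
  with f show ?thesis unfolding least_def_def by blast
qed

section \<open>Exacting embeddings\<close>

text \<open>Padding with the last element keeps all values of the environment of a nonempty list
  from \<open>X\<close> inside \<open>X\<close>, as transfer requires.\<close>

definition env :: "'a list => nat => 'a" where
  "env xs n = (if n < length xs then xs ! n else last xs)"

text \<open>The finite stock of conditions to be reflected. Where an element of \<open>X\<close> is
  sought, it stands at variable 0. Witnesses are found one at a time, so \<open>jonsson\<close>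
  occurs twice: for \<open>c\<close> with the second component quantified, then for that
  component.\<close>

definition preserved :: "((nat => 'a) => bool) set" where
  "preserved = {\<lambda>e. e 0 \<epsilon> e 1, \<lambda>e. e 0 = e 1, \<lambda>e. e 0 = emp, \<lambda>e. e 0 = succ (e 1), \<lambda>e. e 0 = \<omega>,
    \<lambda>e. e 0 \<sqsubseteq> V (e 1), \<lambda>e. func (e 0) (e 1) (e 2), \<lambda>e. e 0 = ap (e 1) (e 2),
    \<lambda>e. in_range (e 0) (e 1) (e 2), \<lambda>e. is_rep (e 1) (e 2) (e 3) (e 0),
    \<lambda>e. \<exists>x. jonsson (e 1) (e 0) x, \<lambda>e. jonsson (e 1) (e 2) (e 0),
    \<lambda>e. \<forall>x. x \<epsilon> e 0 <-> (\<exists>n. n \<epsilon> \<omega> & x \<epsilon> ap (e 1) n),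
    \<lambda>e. least_rank (e 0) (e 1), \<lambda>e. least_def (e 1) (e 2) (e 3) (e 4) (e 5) (e 0)}"

lemma definable_preserved: "\<forall>P\<in>preserved. Def {} P"
  unfolding preserved_def ball_simps
  by (intro conjI TrueI; intro dfn definable_in_range definable_is_rep definable_jonsson
      definable_least_rank definable_least_def)

lemma exacting_transfer_list:
  assumes "exacting \<kappa>" and fin: "finite S" and def: "\<forall>P\<in>S. Def {} P"
  shows "\<exists>X Y j. V \<kappa> \<sqsubseteq> X & \<kappa> \<epsilon> X & func j X Y & app j \<kappa> = \<kappa> &
    (\<exists>\<alpha>. \<alpha> \<epsilon> \<kappa> & app j \<alpha> ~= \<alpha>) &
    (\<forall>P\<in>S. \<forall>xs. xs ~= [] & (\<forall>x\<in>set xs. x \<epsilon> X) -->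
      (P (env xs) <-> P (env (map (app j) xs))) &
      (\<forall>x. P (env (x # xs)) --> (\<exists>x. x \<epsilon> X & P (env (x # xs)))))"
proof -
  have "\<forall>P\<in>S. \<exists>p. \<forall>e. sat E p e <-> P e" using def definable_empD by blast
  then obtain fm where fm: "\<And>P e. P \<in> S ==> sat E (fm P) e <-> P e" by metis
  obtain X Y j where
    j: "V \<kappa> \<sqsubseteq> X" "\<kappa> \<epsilon> X" "func j X Y" "app j \<kappa> = \<kappa>" "\<exists>\<alpha>. \<alpha> \<epsilon> \<kappa> & app j \<alpha> ~= \<alpha>"
    and 1: "\<forall>p\<in>fm ` S. \<forall>e. (\<forall>n. e n \<epsilon> X) --> (sat E p e <-> sat E p (\<lambda>n. app j (e n)))"
    and 2: "\<forall>p\<in>fm ` S. \<forall>e. (\<forall>n. e n \<epsilon> X) --> (\<exists>x. sat E p (e(0 := x))) -->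
      (\<exists>x. x \<epsilon> X & sat E p (e(0 := x)))"
    using exacting_transfer[OF assms(1) finite_imageI[OF fin, of fm]]
    by (elim exE conjE) (rule that; (assumption | intro exI conjI; assumption))
  have "(P (env xs) <-> P (env (map (app j) xs))) &
      (\<forall>x. P (env (x # xs)) --> (\<exists>x. x \<epsilon> X & P (env (x # xs))))"
    if P: "P \<in> S" and xs: "xs ~= []" "\<forall>x\<in>set xs. x \<epsilon> X" for P xs
  proof -
    have X: "env ys n \<epsilon> X" if "ys ~= []" "\<forall>y\<in>set ys. y \<epsilon> X" for ys n
      using that by (auto simp: env_def)
    have eq: "(\<lambda>n. app j (env xs n)) = env (map (app j) xs)"
      using xs(1) by (auto simp: env_def last_map)
    \<comment> \<open>\<open>hd xs\<close> is a placeholder from \<open>X\<close> at position 0.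
      Since \<open>xs\<close> is nonempty, overwriting it does not affect the padding.\<close>
    have eq': "(env (hd xs # xs))(0 := x) = env (x # xs)" for x
      using xs(1) by (auto simp: env_def nth_Cons split: nat.split)
    have "\<forall>n. env xs n \<epsilon> X" "\<forall>n. env (hd xs # xs) n \<epsilon> X" using X[of xs] X[of "hd xs # xs"] xs by auto
    with 1[rule_format, of "fm P" "env xs"] 2[rule_format, of "fm P" "env (hd xs # xs)"] P show ?thesis
      unfolding fm[OF P] eq eq' by blast
  qed
  with j show ?thesis by blast
qed

end

text \<open>Isolates the first-order consequences of exactness; the reflecting \<zeta> and internal
  satisfaction disappear from the argument about the critical point.\<close>

locale exacting_embedding = ZFC +
  fixes \<kappa> X Y j :: 'a
  assumes cardinal: "cardinal E UNIV \<kappa>"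
    and V_sub: "V \<kappa> \<sqsubseteq> X" and \<kappa>_mem: "\<kappa> \<epsilon> X" and func_j: "func j X Y" and j_\<kappa>: "app j \<kappa> = \<kappa>"
    and moved: "\<exists>\<alpha>. \<alpha> \<epsilon> \<kappa> & app j \<alpha> ~= \<alpha>"
    and transfer: "P \<in> preserved ==> xs ~= [] ==> \<forall>x\<in>set xs. x \<epsilon> X ==>
      P (env xs) <-> P (env (map (app j) xs))"
    and witness: "P \<in> preserved ==> xs ~= [] ==> \<forall>x\<in>set xs. x \<epsilon> X ==>
      P (env (x # xs)) ==> \<exists>x. x \<epsilon> X & P (env (x # xs))"
begin

abbreviation J where "J x == app j x"

lemma j_mem: "x \<epsilon> X ==> y \<epsilon> X ==> J x \<epsilon> J y <-> x \<epsilon> y"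
  using transfer[of "\<lambda>e. e 0 \<epsilon> e 1" "[x, y]"] by (simp add: preserved_def env_def)

lemma j_eq: "x \<epsilon> X ==> y \<epsilon> X ==> J x = J y <-> x = y"
  using transfer[of "\<lambda>e. e 0 = e 1" "[x, y]"] by (simp add: preserved_def env_def)

lemma j_emp: "emp \<epsilon> X ==> J emp = emp"
  using transfer[of "\<lambda>e. e 0 = emp" "[emp]"] by (simp add: preserved_def env_def)

lemma j_succ: "x \<epsilon> X ==> succ x \<epsilon> X ==> J (succ x) = succ (J x)"
  using transfer[of "\<lambda>e. e 0 = succ (e 1)" "[succ x, x]"] by (simp add: preserved_def env_def)

lemma j_omega: "\<omega> \<epsilon> X ==> J \<omega> = \<omega>"
  using transfer[of "\<lambda>e. e 0 = \<omega>" "[\<omega>]"] by (simp add: preserved_def env_def)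

lemma j_subset_V: "x \<epsilon> X ==> \<delta> \<epsilon> X ==> J x \<sqsubseteq> V (J \<delta>) <-> x \<sqsubseteq> V \<delta>"
  using transfer[of "\<lambda>e. e 0 \<sqsubseteq> V (e 1)" "[x, \<delta>]"] by (simp add: preserved_def env_def)

lemma j_func: "f \<epsilon> X ==> a \<epsilon> X ==> b \<epsilon> X ==> func (J f) (J a) (J b) <-> func f a b"
  using transfer[of "\<lambda>e. func (e 0) (e 1) (e 2)" "[f, a, b]"] by (simp add: preserved_def env_def)

lemma j_ap: "ap f x \<epsilon> X ==> f \<epsilon> X ==> x \<epsilon> X ==> J (ap f x) = ap (J f) (J x)"
  using transfer[of "\<lambda>e. e 0 = ap (e 1) (e 2)" "[ap f x, f, x]"] by (simp add: preserved_def env_def)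

lemma j_in_range: "f \<epsilon> X ==> a \<epsilon> X ==> y \<epsilon> X ==> in_range (J f) (J a) (J y) <-> in_range f a y"
  using transfer[of "\<lambda>e. in_range (e 0) (e 1) (e 2)" "[f, a, y]"] by (simp add: preserved_def env_def)

lemma j_is_rep: "c \<epsilon> X ==> \<gamma> \<epsilon> X ==> u \<epsilon> X ==> v \<epsilon> X ==>
    is_rep (J c) (J \<gamma>) (J u) (J v) <-> is_rep c \<gamma> u v"
  using transfer[of "\<lambda>e. is_rep (e 1) (e 2) (e 3) (e 0)" "[v, c, \<gamma>, u]"]
  by (simp add: preserved_def env_def)

lemma witness_is_rep: "c \<epsilon> X ==> \<gamma> \<epsilon> X ==> u \<epsilon> X ==> is_rep c \<gamma> u v ==> \<exists>v. v \<epsilon> X & is_rep c \<gamma> u v"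
  using witness[of "\<lambda>e. is_rep (e 1) (e 2) (e 3) (e 0)" "[c, \<gamma>, u]" v]
  by (simp add: preserved_def env_def)

lemma j_jonsson: "\<gamma> \<epsilon> X ==> c \<epsilon> X ==> e \<epsilon> X ==> jonsson (J \<gamma>) (J c) (J e) <-> jonsson \<gamma> c e"
  using transfer[of "\<lambda>e. jonsson (e 1) (e 2) (e 0)" "[e, \<gamma>, c]"]
  by (simp add: preserved_def env_def)

lemma witness_jonsson: "\<gamma> \<epsilon> X ==> \<exists>c e. c \<epsilon> X & e \<epsilon> X & jonsson \<gamma> c e"
proof -
  assume g: "\<gamma> \<epsilon> X"
  obtain c' e' where "jonsson \<gamma> c' e'" using ex_jonsson by blast
  then obtain c e' where c: "c \<epsilon> X" "jonsson \<gamma> c e'"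
    using witness[of "\<lambda>e. \<exists>x. jonsson (e 1) (e 0) x" "[\<gamma>]" c'] g by (auto simp: preserved_def env_def)
  then show ?thesis
    using witness[of "\<lambda>e. jonsson (e 1) (e 2) (e 0)" "[\<gamma>, c]" e'] g by (auto simp: preserved_def env_def)
qed

lemma j_Uni_range: "x \<epsilon> X ==> f \<epsilon> X ==> (\<forall>z. z \<epsilon> J x <-> (\<exists>n. n \<epsilon> \<omega> & z \<epsilon> ap (J f) n)) <->
    (\<forall>z. z \<epsilon> x <-> (\<exists>n. n \<epsilon> \<omega> & z \<epsilon> ap f n))"
  using transfer[of "\<lambda>e. \<forall>x. x \<epsilon> e 0 <-> (\<exists>n. n \<epsilon> \<omega> & x \<epsilon> ap (e 1) n)" "[x, f]"]
  by (simp add: preserved_def env_def)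

lemma j_least_rank: "\<gamma> \<epsilon> X ==> least_rank \<kappa> (J \<gamma>) <-> least_rank \<kappa> \<gamma>"
  using transfer[of "\<lambda>e. least_rank (e 0) (e 1)" "[\<kappa>, \<gamma>]"]
  by (simp add: preserved_def env_def j_\<kappa> \<kappa>_mem)

lemma j_least_def: "n \<epsilon> X ==> p \<epsilon> X ==> r \<epsilon> X ==> a \<epsilon> X ==> f \<epsilon> X ==>
    least_def \<kappa> (J n) (J p) (J r) (J a) (J f) <-> least_def \<kappa> n p r a f"
  using transfer[of "\<lambda>e. least_def (e 1) (e 2) (e 3) (e 4) (e 5) (e 0)" "[f, \<kappa>, n, p, r, a]"]
  by (simp add: preserved_def env_def j_\<kappa> \<kappa>_mem)

text \<open>Elementarity gives some solution in \<open>X\<close>, and by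
  \<open>least_def_unique\<close> it is \<open>f\<close>. This is how a map outside
  \<open>V \<kappa>\<close> is placed in \<open>X\<close>.\<close>

lemma witness_least_def: "n \<epsilon> X ==> p \<epsilon> X ==> r \<epsilon> X ==> a \<epsilon> X ==> least_def \<kappa> n p r a f ==> f \<epsilon> X"
  using witness[of "\<lambda>e. least_def (e 1) (e 2) (e 3) (e 4) (e 5) (e 0)" "[\<kappa>, n, p, r, a]" f]
  by (auto simp: preserved_def env_def \<kappa>_mem dest: least_def_unique)

end

context exacting_embedding
begin

lemma Ord_\<kappa>: "Ord \<kappa>"
  using cardinal by (simp add: cardinal_def)

lemma V_mem_X: "x \<epsilon> V \<kappa> ==> x \<epsilon> X"
  using V_sub by (rule subsetD)

lemma \<kappa>_mem_X: "x \<epsilon> \<kappa> ==> x \<epsilon> X"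
  using Ord_mem_V[OF Ord_\<kappa>] V_mem_X by blast

lemma j_ap_eq: "x \<epsilon> X ==> J x = ap j x"
  using app_eq_ap[OF func_j] .

lemma j_\<kappa>_mem: "x \<epsilon> \<kappa> ==> J x \<epsilon> \<kappa>"
  using j_mem[OF \<kappa>_mem_X \<kappa>_mem] j_\<kappa> by simp

section \<open>The critical point of \<open>j\<close> and the fixed points of
  \<open>j\<close>\<close>

definition crit :: 'a where
  "crit = (SOME c. c \<epsilon> \<kappa> & J c ~= c & (\<forall>x. x \<epsilon> c --> J x = x))"

lemma crit_props: "crit \<epsilon> \<kappa> & J crit ~= crit & (\<forall>x. x \<epsilon> crit --> J x = x)"
  unfolding crit_def
proof (rule someI_ex)
  obtain \<alpha> where \<alpha>: "\<alpha> \<epsilon> \<kappa>" "J \<alpha> ~= \<alpha>" using moved by blast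
  have "Def UNIV (\<lambda>e. e 0 \<epsilon> \<kappa> & ap j (e 0) ~= e 0)" by (intro dfn)
  from Ord_least[where P = "\<lambda>x. x \<epsilon> \<kappa> & ap j x ~= x", OF this, of \<alpha>] \<alpha>
  obtain c where c: "c \<epsilon> \<kappa>" "ap j c ~= c" "\<And>x. x \<epsilon> c ==> \<not> (x \<epsilon> \<kappa> & ap j x ~= x)"
    using Ord_mem[OF Ord_\<kappa>] j_ap_eq[OF \<kappa>_mem_X] by auto
  have "J x = x" if "x \<epsilon> c" for x
    using c(3)[OF that] Ord_trans[OF Ord_\<kappa> c(1) that] j_ap_eq[OF \<kappa>_mem_X] by auto
  with c show "\<exists>c. c \<epsilon> \<kappa> & J c ~= c & (\<forall>x. x \<epsilon> c --> J x = x)"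
    using j_ap_eq[OF \<kappa>_mem_X] by metis
qed

lemmas crit_mem = crit_props[THEN conjunct1]
lemmas j_crit = crit_props[THEN conjunct2, THEN conjunct1]
lemmas j_below_crit = crit_props[THEN conjunct2, THEN conjunct2, rule_format]

lemma crit_less: "crit \<epsilon> J crit"
proof -
  have "\<not> J crit \<epsilon> crit"
    using j_mem[OF \<kappa>_mem_X[OF j_\<kappa>_mem[OF crit_mem]] \<kappa>_mem_X[OF crit_mem]] j_below_crit[of "J crit"]
    by auto
  then show ?thesis
    using Ord_linear Ord_mem[OF Ord_\<kappa>] crit_mem j_\<kappa>_mem[OF crit_mem] j_crit by blast
qed

text \<open>Arguments below \<open>crit\<close> are their own images; from \<open>crit\<close> on,
  images are at least \<open>J crit\<close>, which exceeds \<open>crit\<close>.\<close>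

lemma crit_not_image: "\<xi> \<epsilon> \<kappa> ==> J \<xi> ~= crit"
proof
  assume x: "\<xi> \<epsilon> \<kappa>" and e: "J \<xi> = crit"
  consider "\<xi> \<epsilon> crit" | "\<xi> = crit" | "crit \<epsilon> \<xi>"
    using Ord_linear Ord_mem[OF Ord_\<kappa>] crit_mem x by blast
  then show False
  proof cases
    case 1
    then show False using e j_below_crit by auto
  next
    case 2
    then show False using e j_crit by simp
  next
    case 3
    then have "J crit \<epsilon> J \<xi>" using j_mem \<kappa>_mem_X crit_mem x by blast
    with e crit_less mem_asym show False by metis
  qed
qed

text \<open>Zero is fixed, and so is the successor of a fixed point.\<close>

lemma crit_not_omega: "\<not> crit \<epsilon> \<omega>"
proof
  assume "crit \<epsilon> \<omega>"
  then show False
  proof (cases rule: omega_cases)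
    case 1
    then show False using j_crit j_emp \<kappa>_mem_X[OF crit_mem] by simp
  next
    case (2 m)
    then have "m \<epsilon> crit" by simp
    then have "J m = m" "m \<epsilon> X"
      using j_below_crit \<kappa>_mem_X Ord_trans[OF Ord_\<kappa> crit_mem] by blast+
    then show False using j_crit j_succ[of m] \<kappa>_mem_X[OF crit_mem] 2 by simp
  qed
qed

lemma omega_le_crit: "n \<epsilon> \<omega> ==> n \<epsilon> crit"
  using crit_not_omega Ord_linear[OF Ord_omega Ord_mem[OF Ord_\<kappa> crit_mem]]
    Ord_trans[OF Ord_mem[OF Ord_\<kappa> crit_mem]] by metis

lemma omega_mem: "\<omega> \<epsilon> \<kappa>"
  using crit_not_omega Ord_linear[OF Ord_omega Ord_mem[OF Ord_\<kappa> crit_mem]]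
    Ord_trans[OF Ord_\<kappa> crit_mem] crit_mem by metis

lemmas limit_\<kappa> = cardinal_limit[OF cardinal omega_mem]

lemma j_nat: "n \<epsilon> \<omega> ==> J n = n" and nat_mem_X: "n \<epsilon> \<omega> ==> n \<epsilon> X"
  using omega_le_crit j_below_crit \<kappa>_mem_X Ord_trans[OF Ord_\<kappa> crit_mem] by blast+

lemmas omega_mem_X = \<kappa>_mem_X[OF omega_mem]

text \<open>A priori \<open>J z\<close> could acquire elements outside \<open>X\<close>. But
  \<open>z\<close> is included in some \<open>V \<delta>\<close> with \<delta> below
  \<open>crit\<close>, so \<open>J z\<close> is included in the same \<open>V \<delta>\<close>,
  whose elements are fixed by induction. The case \<gamma> = \<open>crit\<close> is still
  covered.\<close>

lemma j_fixes_V: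
  assumes "\<gamma> \<epsilon> succ crit" "z \<epsilon> V \<gamma>"
  shows "J z = z"
proof -
  have oc: "Ord (succ crit)" using Ord_succ Ord_mem[OF Ord_\<kappa> crit_mem] by blast
  have VX: "z \<epsilon> X" if "\<gamma> \<epsilon> succ crit" "z \<epsilon> V \<gamma>" for \<gamma> z
  proof -
    have "\<gamma> \<epsilon> \<kappa>" using that(1) Ord_trans[OF Ord_\<kappa> crit_mem] crit_mem by auto
    then show ?thesis using V_mono[OF Ord_\<kappa>] that(2) V_mem_X subsetD by blast
  qed
  have "\<gamma> \<epsilon> succ crit --> (\<forall>z. z \<epsilon> V \<gamma> --> ap j z = z)"
  proof (rule Ord_induct[where P = "\<lambda>\<gamma>. \<gamma> \<epsilon> succ crit --> (\<forall>z. z \<epsilon> V \<gamma> --> ap j z = z)"])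
    show "Ord \<gamma>" using Ord_mem[OF oc assms(1)] .
    fix \<gamma> assume IH: "\<And>\<delta>. \<delta> \<epsilon> \<gamma> ==> \<delta> \<epsilon> succ crit --> (\<forall>z. z \<epsilon> V \<delta> --> ap j z = z)"
    have "ap j z = z" if g: "\<gamma> \<epsilon> succ crit" and z: "z \<epsilon> V \<gamma>" for z
    proof -
      obtain \<delta> where d: "\<delta> \<epsilon> \<gamma>" "z \<sqsubseteq> V \<delta>" using z unfolding mem_V[of z] by blast
      have dc: "\<delta> \<epsilon> crit" using d(1) g Ord_trans[OF Ord_mem[OF Ord_\<kappa> crit_mem]] by auto
      have zX: "z \<epsilon> X" using VX g z by blast
      have dX: "\<delta> \<epsilon> X" using \<kappa>_mem_X Ord_trans[OF Ord_\<kappa> crit_mem dc] by blast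
      have fx: "J w = w" "w \<epsilon> X" if "w \<epsilon> V \<delta>" for w
        using IH[OF d(1)] dc that VX[of \<delta>] j_ap_eq by auto
      have "J z \<sqsubseteq> V \<delta>" using j_subset_V[OF zX dX] d(2) j_below_crit[OF dc] by simp
      then have "w \<epsilon> J z <-> w \<epsilon> z" for w
        using j_mem[of w z] fx[of w] zX d(2) by (metis subsetD)
      then have "J z = z" by (rule extensionality)
      with j_ap_eq[OF zX] show ?thesis by simp
    qed
    then show "\<gamma> \<epsilon> succ crit --> (\<forall>z. z \<epsilon> V \<gamma> --> ap j z = z)" by blast
  qed (intro dfn)
  with assms j_ap_eq[OF VX[OF assms]] show ?thesis by simp
qed

lemma V_\<kappa>_func: "func f a b ==> a \<epsilon> \<kappa> ==> b \<epsilon> \<kappa> ==> f \<epsilon> X"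
  using V_limit_func[OF limit_\<kappa>] Ord_mem_V[OF Ord_\<kappa>] V_mem_X by blast

text \<open>Kunen's inconsistency argument: with \<open>b = j \<circ> e\<close>, the value \<open>j(e)(crit)\<close> would be \<open>j(\<eta>)\<close>
  for some \<open>\<eta> \<in> e[\<gamma>]\<close>.\<close>

lemma fixed_below_crit:
  assumes \<gamma>: "\<gamma> \<epsilon> \<kappa>" "J \<gamma> = \<gamma>"
  shows "\<gamma> \<epsilon> crit"
proof (rule ccontr)
  assume "\<not> ?thesis"
  then have c\<gamma>: "crit \<epsilon> \<gamma>"
    using Ord_linear Ord_mem[OF Ord_\<kappa>] crit_mem \<gamma> j_crit by blast
  have \<gamma>X: "\<gamma> \<epsilon> X" using \<kappa>_mem_X \<gamma>(1) .
  have sub: "x \<epsilon> \<kappa>" "x \<epsilon> X" if "x \<epsilon> \<gamma>" for x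
    using Ord_trans[OF Ord_\<kappa> \<gamma>(1) that] \<kappa>_mem_X by blast+
  have j\<gamma>: "J x \<epsilon> \<gamma>" if "x \<epsilon> \<gamma>" for x using j_mem[OF sub(2)[OF that] \<gamma>X] \<gamma>(2) that by simp
  \<comment> \<open>\<open>j\<close> acts only on \<open>X\<close>, so the pair is found there by
    elementarity.\<close>
  obtain c e where ce: "c \<epsilon> X" "e \<epsilon> X" "jonsson \<gamma> c e" using witness_jonsson[OF \<gamma>X] by blast
  have J: "jonsson \<gamma> (J c) (J e)" using j_jonsson[OF \<gamma>X ce(1,2)] ce(3) \<gamma>(2) by simp
  have e: "inj_func e \<gamma> \<gamma>" and rep: "\<And>u. func u \<omega> \<gamma> ==> \<exists>!v. is_rep c \<gamma> u v"
    using ce(3) unfolding jonsson_def by auto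
  have Je: "inj_func (J e) \<gamma> \<gamma>" and Jrep: "\<And>u. func u \<omega> \<gamma> ==> \<exists>!v. is_rep (J c) \<gamma> u v"
    using J unfolding jonsson_def by auto
  have ef: "func e \<gamma> \<gamma>" using e by (simp add: inj_func_def)
  have e\<gamma>: "ap e x \<epsilon> \<gamma>" if "x \<epsilon> \<gamma>" for x using app_mem(2)[OF ef that] app_eq_ap[OF ef that] by simp
  have Jap: "J (ap e x) = ap (J e) (J x)" if "x \<epsilon> \<gamma>" for x
    using j_ap sub(2) e\<gamma> ce(2) that by blast
  have "Trm UNIV (\<lambda>x. ap j (ap e (x 0)))" by (intro dfn)
  from make_func[where h = "\<lambda>x. ap j (ap e x)", OF this, of \<gamma> \<gamma>] obtain b where b: "func b \<gamma> \<gamma>"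
    "\<And>x. x \<epsilon> \<gamma> ==> app b x = ap j (ap e x)"
    using j\<gamma> e\<gamma> j_ap_eq[OF sub(2)] by auto
  have b': "ap b x = J (ap e x)" if "x \<epsilon> \<gamma>" for x
    using b(2)[OF that] app_eq_ap[OF b(1) that] j_ap_eq[OF sub(2)[OF e\<gamma>[OF that]]] by simp
  have "inj_func b \<gamma> \<gamma>"
    using b(1) e b' j_eq sub(2) e\<gamma> unfolding inj_func_def by metis
  moreover have "in_range (J e) \<gamma> (ap b x)" if "x \<epsilon> \<gamma>" for x
    using b'[OF that] Jap[OF that] j\<gamma>[OF that] unfolding in_range_def by auto
  ultimately obtain m u v where m: "m \<epsilon> \<omega>" and u: "func u \<omega> \<gamma>"
    "\<And>n. n \<epsilon> \<omega> ==> in_range b \<gamma> (ap u n)" and v: "is_rep (J c) \<gamma> u v" "ap v m = ap (J e) crit"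
    using J c\<gamma> unfolding jonsson_def by blast
  have "\<exists>t. func t \<omega> \<gamma> & (\<forall>n. n \<epsilon> \<omega> --> ap j (app t n) = ap u n)"
  proof (rule choice_function[where R = "\<lambda>n y. ap j y = ap u n"])
    show "\<exists>y. y \<epsilon> \<gamma> & ap j y = ap u n" if "n \<epsilon> \<omega>" for n
      using u(2)[OF that] b' e\<gamma> j_ap_eq[OF sub(2)] unfolding in_range_def by metis
  qed (intro dfn)
  then obtain t where t: "func t \<omega> \<gamma>" "\<And>n. n \<epsilon> \<omega> ==> ap j (app t n) = ap u n" by blast
  \<comment> \<open>\<open>t\<close> pulls \<open>u\<close> back along \<open>j\<close>. As a map
    from \<omega> into \<gamma> it lies in \<open>V \<kappa>\<close>; this is what
    \<omega>-sequences are used for.\<close>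
  have tX: "t \<epsilon> X" using V_\<kappa>_func[OF t(1) omega_mem \<gamma>(1)] .
  have Jt: "func (J t) \<omega> \<gamma>"
    using j_func[OF tX omega_mem_X \<gamma>X] t(1) j_omega[OF omega_mem_X] \<gamma>(2) by simp
  \<comment> \<open>Entry by entry: \<open>j\<close> fixes each index \<open>n\<close>, so the entry
    of \<open>J t\<close> at \<open>n\<close> is the image of the entry of \<open>t\<close> at
    \<open>n\<close>.\<close>
  have "J t = u"
  proof (rule func_ext[OF Jt u(1)])
    fix n assume n: "n \<epsilon> \<omega>"
    have tn: "ap t n \<epsilon> \<gamma>" using app_mem(2)[OF t(1) n] app_eq_ap[OF t(1) n] by simp
    have "ap (J t) n = J (ap t n)"
      using j_ap[of t n] tn sub(2) tX nat_mem_X[OF n] j_nat[OF n] by simp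
    also have "\<dots> = ap u n" using t(2)[OF n] app_eq_ap[OF t(1) n] j_ap_eq[OF sub(2)[OF tn]] by simp
    finally show "app (J t) n = app u n" using app_eq_ap[OF Jt n] app_eq_ap[OF u(1) n] by simp
  qed
  \<comment> \<open>The representative of \<open>t\<close> is taken in \<open>X\<close>. By
    uniqueness its image is \<open>v\<close>, so the value of \<open>v\<close> at \<open>m\<close>
    is an image under \<open>j\<close>.\<close>
  obtain w where w: "w \<epsilon> X" "is_rep c \<gamma> t w"
    using witness_is_rep[OF ce(1) \<gamma>X tX] rep[OF t(1)] by blast
  have "is_rep (J c) \<gamma> u (J w)"
    using j_is_rep[OF ce(1) \<gamma>X tX w(1)] w(2) \<gamma>(2) \<open>J t = u\<close> by simp
  then have vw: "v = J w" using Jrep[OF u(1)] v(1) by blast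
  have wf: "func w \<omega> \<gamma>" using w(2) by (simp add: is_rep_def)
  let ?\<eta> = "ap w m"
  have \<eta>: "?\<eta> \<epsilon> \<gamma>" using app_mem(2)[OF wf m] app_eq_ap[OF wf m] by simp
  have J\<eta>: "J ?\<eta> = ap (J e) crit"
    using j_ap[of w m] sub(2)[OF \<eta>] w(1) nat_mem_X[OF m] j_nat[OF m] vw v(2) by simp
  \<comment> \<open>Elementarity pulls membership in the range back to \<open>e\<close>; injectivity
    of \<open>J e\<close> then turns the preimage \<xi> into a solution of
    \<open>J \<xi> = crit\<close>.\<close>
  then have "in_range (J e) (J \<gamma>) (J ?\<eta>)" using c\<gamma> \<gamma>(2) unfolding in_range_def by auto
  then have "in_range e \<gamma> ?\<eta>" using j_in_range[OF ce(2) \<gamma>X sub(2)[OF \<eta>]] by simp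
  then obtain \<xi> where \<xi>: "\<xi> \<epsilon> \<gamma>" "ap e \<xi> = ?\<eta>" unfolding in_range_def by blast
  then have "ap (J e) (J \<xi>) = ap (J e) crit" using J\<eta> Jap by metis
  then have "J \<xi> = crit" using Je j\<gamma>[OF \<xi>(1)] c\<gamma> unfolding inj_func_def by blast
  with crit_not_image sub(1)[OF \<xi>(1)] show False by blast
qed

text \<open>The given data only show that some \<gamma> below \<kappa> bounds suitable parameters.
  The contradiction is derived for parameters of least rank, which may define a different cofinal
  map.\<close>

lemma least_def_bounded:
  assumes l: "least_def \<kappa> n p r a f" and "n \<epsilon> V \<kappa>" "p \<epsilon> V \<kappa>" "r \<epsilon> V \<kappa>" "a \<epsilon> V \<kappa>"
  shows False
proof -
  define G where "G \<gamma> <->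
    (\<exists>n p r a f. n \<epsilon> V \<gamma> & p \<epsilon> V \<gamma> & r \<epsilon> V \<gamma> & a \<epsilon> V \<gamma> & least_def \<kappa> n p r a f)" for \<gamma>
  have "\<exists>\<gamma>. \<gamma> \<epsilon> \<kappa> & (\<forall>i<4. ([n, p, r, a] ! i) \<epsilon> V \<gamma>)"
    by (rule ex_bound_rank[OF limit_\<kappa>]) (use assms in \<open>auto simp: less_Suc_eq numeral_eq_Suc\<close>)
  then obtain \<gamma>0 where g0: "\<gamma>0 \<epsilon> \<kappa>" "\<forall>i<4. ([n, p, r, a] ! i) \<epsilon> V \<gamma>0" by blast
  have "n \<epsilon> V \<gamma>0" "p \<epsilon> V \<gamma>0" "r \<epsilon> V \<gamma>0" "a \<epsilon> V \<gamma>0"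
    using g0(2)[rule_format, of 0] g0(2)[rule_format, of 1] g0(2)[rule_format, of 2]
      g0(2)[rule_format, of 3] by simp_all
  then have "G \<gamma>0" using l unfolding G_def by blast
  have "Def UNIV (\<lambda>e. G (e 0))" unfolding G_def by (intro dfn definable_least_def)
  from Ord_least[where P = G, OF this _ \<open>G \<gamma>0\<close>] Ord_mem[OF Ord_\<kappa> g0(1)]
  obtain \<gamma> where \<gamma>: "Ord \<gamma>" "G \<gamma>" "\<And>\<delta>. \<delta> \<epsilon> \<gamma> ==> \<not> G \<delta>" by blast
  have lrG: "least_rank \<kappa> \<gamma> <-> Ord \<gamma> & G \<gamma> & (\<forall>\<delta>. \<delta> \<epsilon> \<gamma> --> \<not> G \<delta>)" for \<gamma>
    by (simp only: least_rank_def G_def)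
  have lr_unique: "\<gamma>' = \<gamma>" if "least_rank \<kappa> \<gamma>'" for \<gamma>'
    using that \<gamma> Ord_linear[OF \<gamma>(1), of \<gamma>'] unfolding lrG by blast
  have "\<not> \<gamma>0 \<epsilon> \<gamma>" using \<gamma>(3) \<open>G \<gamma>0\<close> by blast
  then have \<gamma>\<kappa>: "\<gamma> \<epsilon> \<kappa>"
    using Ord_linear[OF \<gamma>(1) Ord_mem[OF Ord_\<kappa> g0(1)]] g0(1) Ord_trans[OF Ord_\<kappa>] by blast
  have "least_rank \<kappa> (J \<gamma>)" using j_least_rank[OF \<kappa>_mem_X[OF \<gamma>\<kappa>]] lrG \<gamma> by blast
  then have "J \<gamma> = \<gamma>" by (rule lr_unique)
  from fixed_below_crit[OF \<gamma>\<kappa> this] have \<gamma>c: "\<gamma> \<epsilon> succ crit" by simp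
  obtain n p r a f where d: "n \<epsilon> V \<gamma>" "p \<epsilon> V \<gamma>" "r \<epsilon> V \<gamma>" "a \<epsilon> V \<gamma>" "least_def \<kappa> n p r a f"
    using \<gamma>(2) unfolding G_def by blast
  have X: "x \<epsilon> X" if "x \<epsilon> V \<gamma>" for x using V_mono[OF Ord_\<kappa> \<gamma>\<kappa>] that V_mem_X subsetD by blast
  have fX: "f \<epsilon> X" using witness_least_def[OF _ _ _ _ d(5)] X d by blast
  have "least_def \<kappa> n p r a (J f)"
    using j_least_def[of n p r a f] X d fX j_fixes_V[OF \<gamma>c] by simp
  then have Jf: "J f = f" using least_def_unique d(5) by blast
  have f: "func f a \<kappa>" and cof: "\<And>b. b \<epsilon> \<kappa> ==> \<exists>x. x \<epsilon> a & b \<epsilon> succ (ap f x)"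
    using d(5) unfolding least_def_def cofinal_def_def by blast+
  \<comment> \<open>Cofinality is tested at \<open>crit\<close>: the value found is at least
    \<open>crit\<close>, but as a fixed point it must lie below.\<close>
  obtain x where x: "x \<epsilon> a" "crit \<epsilon> succ (ap f x)" using cof[OF crit_mem] by blast
  have xV: "x \<epsilon> V \<gamma>" using V_transitive[OF \<gamma>(1) d(4) x(1)] .
  have y: "ap f x \<epsilon> \<kappa>" using app_mem(2)[OF f x(1)] app_eq_ap[OF f x(1)] by simp
  have "J (ap f x) = ap f x"
    using j_ap[of f x] \<kappa>_mem_X[OF y] fX X[OF xV] Jf j_fixes_V[OF \<gamma>c xV] by simp
  from fixed_below_crit[OF y this] x(2) show False by (auto dest: mem_asym)
qed

lemma OD_not_cofinal:
  assumes od: "f \<in> OD {x. x \<epsilon> V \<kappa>}" and a: "a \<epsilon> \<kappa>" and f: "func f a \<kappa>"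
    and cof: "\<And>b. b \<epsilon> \<kappa> ==> \<exists>x. x \<epsilon> a & b \<epsilon> succ (ap f x)"
  shows False
proof -
  obtain \<beta> n q p where d: "is_defined f \<beta> n q p"
    and q: "\<And>i. i \<epsilon> n ==> ap q i \<epsilon> V \<kappa> | Ord (ap q i)"
    using od unfolding OD_iff by blast
  have n: "n \<epsilon> \<omega>" and p: "formula p" using d by (auto simp: is_defined_def)
  have emp_V: "emp \<epsilon> V \<kappa>"
    using Ord_mem_V[OF Ord_\<kappa>] limit_emp[OF limit_\<kappa>] by blast
  \<comment> \<open>Ordinal entries, which may lie above \<kappa>, are replaced by
    \<open>emp\<close>. This is itself an ordinal, so \<open>r\<close> remembers which entries are
    ordinals but not their values.\<close>
  define R where "R i y <-> Ord (ap q i) & y = emp | \<not> Ord (ap q i) & y = ap q i" for i y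
  have "\<exists>r. func r n (V \<kappa>) & (\<forall>i. i \<epsilon> n --> R i (app r i))"
  proof (rule choice_function)
    show "Def UNIV (\<lambda>e. R (e 0) (e 1))" unfolding R_def by (intro dfn)
    show "\<exists>y. y \<epsilon> V \<kappa> & R i y" if "i \<epsilon> n" for i
      using q[OF that] emp_V unfolding R_def by blast
  qed
  then obtain r where r: "func r n (V \<kappa>)" "\<And>i. i \<epsilon> n ==> R i (app r i)" by blast
  have r': "ap r i \<epsilon> V \<kappa>" "R i (ap r i)" if "i \<epsilon> n" for i
    using app_mem(2)[OF r(1) that] r(2)[OF that] app_eq_ap[OF r(1) that] by simp_all
  \<comment> \<open>Regularity of \<kappa> in the universe is not at hand (it fails, by
    \<open>ex_cofinal_omega\<close>). That the entries of \<open>r\<close> are bounded in rank below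
    \<kappa> comes from internal induction on their number and \<kappa> being a limit.\<close>
  let ?P = "\<lambda>k. k \<epsilon> succ n --> (\<exists>\<delta>. \<delta> \<epsilon> \<kappa> & (\<forall>i. i \<epsilon> k --> ap r i \<epsilon> V \<delta>))"
  have "?P k" if "k \<epsilon> \<omega>" for k
  proof (rule omega_induct[where P = ?P, OF _ that])
    show "?P emp" using omega_mem by auto
    fix k assume IH: "?P k"
    show "?P (succ k)"
    proof
      assume sk: "succ k \<epsilon> succ n"
      have kn: "k \<epsilon> n" using sk Ord_trans[OF Ord_mem[OF Ord_omega n], of "succ k" k] by auto
      with IH obtain \<delta> where d: "\<delta> \<epsilon> \<kappa>" "\<And>i. i \<epsilon> k ==> ap r i \<epsilon> V \<delta>" by auto
      from V_limit_max[OF limit_\<kappa> d(1) r'(1)[OF kn]] d(2)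
      show "\<exists>\<delta>. \<delta> \<epsilon> \<kappa> & (\<forall>i. i \<epsilon> succ k --> ap r i \<epsilon> V \<delta>)"
        by (metis mem_succ subsetD)
    qed
  qed (intro dfn)
  from this[OF n] obtain \<delta> where \<delta>: "\<delta> \<epsilon> \<kappa>" "\<And>i. i \<epsilon> n ==> ap r i \<epsilon> V \<delta>" by auto
  have \<omega>V: "\<omega> \<epsilon> V \<kappa>" using Ord_mem_V[OF Ord_\<kappa> omega_mem] .
  have nV: "n \<epsilon> V \<kappa>" using V_transitive[OF Ord_\<kappa> \<omega>V n] .
  have "func r n (V \<delta>)"
    by (rule func_range[OF r(1)]) (use \<delta>(2) app_eq_ap[OF r(1)] in simp)
  then have rV: "r \<epsilon> V \<kappa>"
    using V_limit_func[OF limit_\<kappa>] nV V_limit_subset[OF limit_\<kappa> \<delta>(1) subset_refl] by blast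
  have pV: "p \<epsilon> V \<kappa>" using formula_mem_V[OF p] V_mono[OF Ord_\<kappa> omega_mem] subsetD by blast
  have aV: "a \<epsilon> V \<kappa>" using Ord_mem_V[OF Ord_\<kappa> a] .
  have "cofinal_def \<kappa> n p r a \<beta> q f"
    unfolding cofinal_def_def using d f cof r'(2) Ord_emp unfolding R_def by metis
  from ex_least_def[OF this] least_def_bounded nV pV rV aV show False by blast
qed

text \<open>The critical sequence is cofinal in \<open>\<kappa>\<close>: otherwise its supremum would be a fixed point of \<open>j\<close>.\<close>

lemma ex_cofinal_omega:
  "\<exists>f. func f \<omega> \<kappa> & (\<forall>b. b \<epsilon> \<kappa> --> (\<exists>n. n \<epsilon> \<omega> & b \<epsilon> succ (ap f n)))"
proof -
  have "Trm UNIV (\<lambda>e. ap j (e 0))" by (intro dfn)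
  from omega_iterate[where g = "ap j" and a = crit, OF this] obtain f B
    where f: "func f \<omega> B" "app f emp = crit"
      "\<And>n. n \<epsilon> \<omega> ==> app f (succ n) = ap j (app f n)" by blast
  note apf = app_eq_ap[OF f(1)]
  have f0: "ap f emp = crit" using f(2) apf[OF omega_emp] by simp
  have fS: "ap f (succ n) = ap j (ap f n)" if "n \<epsilon> \<omega>" for n
    using f(3)[OF that] apf[OF that] apf[OF omega_succ[OF that]] by simp
  have jap: "ap j x \<epsilon> \<kappa>" if "x \<epsilon> \<kappa>" for x using j_\<kappa>_mem[OF that] j_ap_eq[OF \<kappa>_mem_X[OF that]] by simp
  have incr: "ap f n \<epsilon> \<kappa> & ap f n \<epsilon> ap f (succ n) & n \<epsilon> \<omega>" if "n \<epsilon> \<omega>" for n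
  proof (rule omega_induct[where P = "\<lambda>n. ap f n \<epsilon> \<kappa> & ap f n \<epsilon> ap f (succ n) & n \<epsilon> \<omega>", OF _ that])
    show "ap f emp \<epsilon> \<kappa> & ap f emp \<epsilon> ap f (succ (emp)) & emp \<epsilon> \<omega>"
      using crit_less crit_mem j_ap_eq[OF \<kappa>_mem_X] by (simp add: fS omega_emp f0)
    fix n assume n: "n \<epsilon> \<omega>" and IH: "ap f n \<epsilon> \<kappa> & ap f n \<epsilon> ap f (succ n) & n \<epsilon> \<omega>"
    have \<kappa>: "ap f n \<epsilon> \<kappa>" "ap f (succ n) \<epsilon> \<kappa>" using IH jap fS[OF n] by auto
    then have "J (ap f n) \<epsilon> J (ap f (succ n))" using j_mem \<kappa>_mem_X IH by blast
    then show "ap f (succ n) \<epsilon> \<kappa> & ap f (succ n) \<epsilon> ap f (succ (succ n)) & succ n \<epsilon> \<omega>"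
      using \<kappa> j_ap_eq[OF \<kappa>_mem_X] fS omega_succ n by simp
  qed (intro dfn)
  have f\<kappa>: "func f \<omega> \<kappa>" by (rule func_range[OF f(1)]) (use incr apf in simp)
  moreover have "\<exists>n. n \<epsilon> \<omega> & b \<epsilon> succ (ap f n)" if b: "b \<epsilon> \<kappa>" for b
  proof (rule ccontr)
    assume n: "\<not> ?thesis"
    have ob: "Ord b" using Ord_mem[OF Ord_\<kappa> b] .
    have fb: "ap f n \<epsilon> b" if "n \<epsilon> \<omega>" for n
      using n that incr[OF that] Ord_linear[OF ob Ord_mem[OF Ord_\<kappa>], of "ap f n"] by auto
    have "func f \<omega> b" by (rule func_range[OF f(1)]) (use fb apf in simp)
    \<comment> \<open>The assumed bound \<open>b\<close> is what puts the whole sequence into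
      \<open>V \<kappa>\<close> and hence into \<open>X\<close>.\<close>
    then have fX: "f \<epsilon> X" using V_\<kappa>_func omega_mem b by blast
    define \<gamma> where "\<gamma> = collect (\<lambda>x. \<exists>n. n \<epsilon> \<omega> & x \<epsilon> ap f n)"
    have \<gamma>: "x \<epsilon> \<gamma> <-> (\<exists>n. n \<epsilon> \<omega> & x \<epsilon> ap f n)" for x
      unfolding \<gamma>_def
      by (rule mem_collect[where a = b], intro dfn) (use fb Ord_trans[OF ob] in blast)
    have o: "Ord \<gamma>"
    proof (rule OrdI)
      fix y z assume "y \<epsilon> \<gamma>" "z \<epsilon> y"
      then obtain n where "n \<epsilon> \<omega>" "y \<epsilon> ap f n" unfolding \<gamma> by blast
      with \<open>z \<epsilon> y\<close> show "z \<epsilon> \<gamma>" unfolding \<gamma> using Ord_trans Ord_mem[OF Ord_\<kappa>] incr by blast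
    next
      fix y assume "y \<epsilon> \<gamma>"
      then show "Ord y" unfolding \<gamma> using Ord_mem Ord_\<kappa> incr by blast
    qed
    have "\<not> b \<epsilon> \<gamma>" unfolding \<gamma> using fb mem_asym by blast
    then have \<gamma>\<kappa>: "\<gamma> \<epsilon> \<kappa>" using Ord_linear[OF o ob] b Ord_trans[OF Ord_\<kappa>] by blast
    \<comment> \<open>\<open>j\<close> shifts the sequence by one place. Dropping the first term of
      an increasing sequence leaves its supremum \<gamma> unchanged.\<close>
    have Jf: "ap (J f) n = ap f (succ n)" if "n \<epsilon> \<omega>" for n
      using j_ap[of f n] fX nat_mem_X[OF that] j_nat[OF that] incr[OF that] \<kappa>_mem_X fS[OF that] j_ap_eq
      by auto
    have J\<gamma>: "z \<epsilon> J \<gamma> <-> (\<exists>n. n \<epsilon> \<omega> & z \<epsilon> ap (J f) n)" for z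
      using j_Uni_range[OF \<kappa>_mem_X[OF \<gamma>\<kappa>] fX] \<gamma> by blast
    have "z \<epsilon> J \<gamma> <-> z \<epsilon> \<gamma>" for z
    proof
      assume "z \<epsilon> J \<gamma>"
      then show "z \<epsilon> \<gamma>" unfolding J\<gamma> \<gamma> using Jf omega_succ by metis
    next
      assume "z \<epsilon> \<gamma>"
      then obtain n where n: "n \<epsilon> \<omega>" "z \<epsilon> ap f n" unfolding \<gamma> by blast
      then have "z \<epsilon> ap f (succ n)"
        using incr[OF n(1)] incr[OF omega_succ[OF n(1)]] Ord_trans Ord_mem[OF Ord_\<kappa>] by blast
      then show "z \<epsilon> J \<gamma>" unfolding J\<gamma> using Jf n(1) by metis
    qed
    then have "J \<gamma> = \<gamma>" by (rule extensionality)
    from fixed_below_crit[OF \<gamma>\<kappa> this] have "\<gamma> \<epsilon> crit" .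
    moreover have "crit \<epsilon> \<gamma>" unfolding \<gamma> using incr[OF omega_emp] f0 omega_succ[OF omega_emp] by auto
    ultimately show False using mem_asym by blast
  qed
  ultimately show ?thesis by blast
qed

end

section \<open>Hereditarily definable sets\<close>

context ZFC
begin

lemma trcl_sing_mem: "x \<epsilon> trcl (sing x)"
  using trcl_props[of "sing x"] by (auto simp: subset_def)

lemma HOD_OD: "x \<in> HOD \<Gamma> ==> x \<in> OD \<Gamma>"
  using trcl_sing_mem unfolding HOD_def by blast

lemma HOD_transitive:
  assumes "x \<in> HOD \<Gamma>" "y \<epsilon> x"
  shows "y \<in> HOD \<Gamma>"
proof -
  have t: "transitive (trcl (sing x))" using trcl_props by blast
  with assms(2) have "sing y \<sqsubseteq> trcl (sing x)"
    using trcl_sing_mem[of x] by (auto simp: subset_def transitive_iff)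
  then have "trcl (sing y) \<sqsubseteq> trcl (sing x)" using t trcl_props[of "sing y"] by blast
  with assms(1) show ?thesis unfolding HOD_def by (blast dest: subsetD)
qed

text \<open>The formula \<open>v\<^sub>0 = v\<^sub>1\<close> over \<open>V (succ \<alpha>)\<close>
  with \<alpha> as its only parameter does it, whatever the class.\<close>

lemma Ord_OD:
  assumes o: "Ord \<alpha>"
  shows "\<alpha> \<in> OD \<Gamma>"
proof -
  let ?\<beta> = "succ \<alpha>" and ?n = "succ (emp)"
  have b: "Ord ?\<beta>" "\<alpha> \<epsilon> V ?\<beta>" using Ord_succ[OF o] Ord_mem_V[of ?\<beta> \<alpha>] by auto
  have "Trm UNIV (\<lambda>e. \<alpha>)" by (intro dfn)
  from make_func[where h = "\<lambda>_. \<alpha>", OF this, of ?n "V ?\<beta>"] b obtain q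
    where q: "func q ?n (V ?\<beta>)" "\<And>i. i \<epsilon> ?n ==> app q i = \<alpha>" by blast
  have q': "ap q i = \<alpha>" if "i \<epsilon> ?n" for i using q(2)[OF that] app_eq_ap[OF q(1) that] by simp
  have "is_defined \<alpha> ?\<beta> ?n q (code (FEq 0 1))"
    unfolding is_defined_def
  proof (intro conjI allI impI; (elim conjE)?)
    show "?n \<epsilon> \<omega>" using omega_succ[OF omega_emp] .
    show "formula (code (FEq 0 1))" by (rule formula_code)
    fix y s assume s: "func s \<omega> (V ?\<beta>)" "ap s emp = y"
      "\<forall>i. i \<epsilon> ?n --> ap s (succ i) = ap q i"
    have "Sat (V ?\<beta>) (code (FEq 0 1)) s <-> app s emp = app s (succ (emp))"
      unfolding Sat_code[OF s(1)] by simp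
    also have "\<dots> <-> y = \<alpha>"
      using app_eq_ap[OF s(1) omega_emp] app_eq_ap[OF s(1) omega_succ[OF omega_emp]] s(2,3) q' by simp
    finally show "Sat (V ?\<beta>) (code (FEq 0 1)) s <-> y = \<alpha>" .
  qed (use b q in auto)
  then show ?thesis unfolding OD_iff using q' o by metis
qed

lemma Ord_HOD:
  assumes o: "Ord \<alpha>"
  shows "\<alpha> \<in> HOD \<Gamma>"
proof -
  have "transitive (succ \<alpha>)" using Ord_succ[OF o] by (simp add: ordinal_def)
  moreover have "sing \<alpha> \<sqsubseteq> succ \<alpha>" by (simp add: subset_def)
  ultimately have "trcl (sing \<alpha>) \<sqsubseteq> succ \<alpha>" using trcl_props by blast
  then show ?thesis
    unfolding HOD_def using Ord_OD Ord_mem[OF Ord_succ[OF o]] by (blast dest: subsetD)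
qed

section \<open>Absoluteness of pairs, functions and bijections for transitive classes\<close>

definition transitive_class :: "'a set => bool" where
  "transitive_class M <-> (\<forall>x y. x \<in> M & y \<epsilon> x --> y \<in> M)"

lemma transitive_classD: "transitive_class M ==> x \<in> M ==> y \<epsilon> x ==> y \<in> M"
  unfolding transitive_class_def by blast

lemma transitive_class_HOD: "transitive_class (HOD \<Gamma>)"
  unfolding transitive_class_def using HOD_transitive by blast

lemma is_opair_absolute:
  assumes tM: "transitive_class M" and "x \<in> M" "y \<in> M" "z \<in> M"
  shows "is_opair E M x y z <-> z = opair x y"
proof -
  note M = transitive_classD[OF tM]
  have up: "is_upair E M u v a <-> a = upair u v" if "a \<in> M" "u \<in> M" "v \<in> M" for a u v
  proof
    assume a: "is_upair E M u v a"
    show "a = upair u v"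
    proof (rule extensionality)
      show "w \<epsilon> a <-> w \<epsilon> upair u v" for w
        using a M[OF that(1), of w] that(2,3) unfolding is_upair_def mem_upair by blast
    qed
  qed (simp add: is_upair_def)
  have "z = opair x y ==> upair x x \<in> M & upair x y \<in> M"
    using M[OF \<open>z \<in> M\<close>] by (simp add: opair_eq)
  then show ?thesis
    unfolding is_opair_def using up assms(2-) by (auto simp: opair_eq)
qed

lemma mem_pair_absolute:
  assumes tM: "transitive_class M" and "f \<in> M" "opair x y \<epsilon> f"
  shows "x \<in> M & y \<in> M"
proof -
  note M = transitive_classD[OF tM]
  have "upair x y \<in> M" using M[OF M[OF assms(2,3)]] by (simp add: opair_eq)
  then show ?thesis using M[of "upair x y"] by simp
qed

text \<open>On the right, membership of \<open>x\<close> and \<open>y\<close> in \<open>M\<close>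
  comes for free: both are reached from \<open>f\<close> by descending along membership.\<close>

lemma maps_to_absolute:
  assumes tM: "transitive_class M" and f: "f \<in> M"
  shows "x \<in> M & y \<in> M & maps_to E M f x y <-> opair x y \<epsilon> f"
  using mem_pair_absolute[OF tM f, of x y] is_opair_absolute[OF tM, of x y] transitive_classD[OF tM f]
  unfolding maps_to_def by blast

lemma is_fun_absolute:
  assumes tM: "transitive_class M" and f: "f \<in> M" and a: "a \<in> M" and b: "b \<in> M"
  shows "is_fun E M f a b <-> func f a b"
proof -
  note M = transitive_classD[OF tM]
  have "(\<exists>!y. y \<in> M & maps_to E M f x y) <-> (\<exists>!y. opair x y \<epsilon> f)" if "x \<in> M" for x
    using maps_to_absolute[OF tM f, of x] that by simp
  moreover have "(\<exists>x\<in>M. \<exists>y\<in>M. x \<epsilon> a & y \<epsilon> b & is_opair E M x y z) <->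
      (\<exists>x y. x \<epsilon> a & y \<epsilon> b & z = opair x y)" if "z \<epsilon> f" for z
    using is_opair_absolute[OF tM _ _ M[OF f that]] M[OF a] M[OF b] by blast
  ultimately show ?thesis
    unfolding is_fun_def is_opair_iff maps_to_iff using M[OF f] M[OF a] by auto
qed

lemma is_bij_absolute:
  assumes tM: "transitive_class M" and f: "f \<in> M" and a: "a \<in> M" and b: "b \<in> M"
  shows "is_bij E M f a b <-> is_bij E UNIV f a b"
proof -
  note M = transitive_classD[OF tM]
  have "x \<in> M & x \<epsilon> a & maps_to E M f x y <-> x \<epsilon> a & opair x y \<epsilon> f" if "y \<in> M" for x y
    using maps_to_absolute[OF tM f, of x y] that by blast
  then show ?thesis
    unfolding is_bij_def is_fun_absolute[OF tM f a b] maps_to_iff using M[OF b] by auto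
qed

text \<open>\<open>M\<close> is a transitive class containing \<kappa>, so bijections and cofinal
  maps found in \<open>M\<close> are such in the universe as well. The former contradict that
  \<kappa> is a cardinal, the latter \<open>OD_not_cofinal\<close>, since elements of
  \<open>M\<close> are in \<open>OD\<close>.\<close>

lemma HOD_regular:
  assumes "exacting \<kappa>"
  defines "M == HOD {x. x \<epsilon> Vset \<kappa>}"
  shows "(\<kappa> \<in> M & regular_cardinal E M \<kappa>) & M ~= UNIV"
proof -
  have card: "cardinal E UNIV \<kappa>" using assms(1) by (simp add: exacting_def)
  then have o: "Ord \<kappa>" by (simp add: cardinal_def)
  have fin: "finite preserved" by (simp add: preserved_def)
  obtain X Y j where emb: "V \<kappa> \<sqsubseteq> X" "\<kappa> \<epsilon> X" "func j X Y" "app j \<kappa> = \<kappa>"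
    "\<exists>\<alpha>. \<alpha> \<epsilon> \<kappa> & app j \<alpha> ~= \<alpha>" and tr:
    "\<forall>P\<in>preserved. \<forall>xs. xs ~= [] & (\<forall>x\<in>set xs. x \<epsilon> X) -->
      (P (env xs) <-> P (env (map (app j) xs))) &
      (\<forall>x. P (env (x # xs)) --> (\<exists>x. x \<epsilon> X & P (env (x # xs))))"
    using exacting_transfer_list[OF assms(1) fin definable_preserved]
    by (elim exE conjE) (rule that; (assumption | intro exI conjI; assumption))
  interpret exacting_embedding E \<kappa> X Y j
    by unfold_locales (use card emb tr in \<open>blast+\<close>)
  have tM: "transitive_class M" unfolding M_def by (rule transitive_class_HOD)
  note M = transitive_classD[OF tM]
  have \<kappa>M: "\<kappa> \<in> M" unfolding M_def by (rule Ord_HOD[OF o])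
  have sub: "transitive_set E M x" if "transitive x" for x
    using that unfolding transitive_set_def by blast
  have oM: "ordinal E M \<kappa>" using o sub unfolding ordinal_def by blast
  have cM: "cardinal E M \<kappa>"
    using oM is_bij_absolute[OF tM _ _ \<kappa>M] card unfolding cardinal_def by blast
  have lM: "limit_ordinal E M \<kappa>"
    unfolding limit_ordinal_def using oM limit_\<kappa> M[OF \<kappa>M] unfolding limit_iff by blast
  have cof: "(\<forall>b\<in>M. b \<epsilon> \<kappa> --> (\<exists>x\<in>M. \<exists>y\<in>M. x \<epsilon> a & maps_to E M f x y & (b = y | b \<epsilon> y))) <->
      (\<forall>b. b \<epsilon> \<kappa> --> (\<exists>x. x \<epsilon> a & b \<epsilon> succ (ap f x)))"
    if fM: "f \<in> M" and f: "func f a \<kappa>" for a f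
  proof -
    have "(\<exists>x\<in>M. \<exists>y\<in>M. x \<epsilon> a & maps_to E M f x y & (b = y | b \<epsilon> y)) <->
      (\<exists>x. x \<epsilon> a & b \<epsilon> succ (ap f x))" for b
    proof -
      have "(\<exists>x\<in>M. \<exists>y\<in>M. x \<epsilon> a & maps_to E M f x y & (b = y | b \<epsilon> y)) <->
        (\<exists>x y. opair x y \<epsilon> f & x \<epsilon> a & (b = y | b \<epsilon> y))"
        unfolding maps_to_absolute[OF tM fM, symmetric] by blast
      also have "\<dots> <-> (\<exists>x. x \<epsilon> a & b \<epsilon> succ (ap f x))"
        using func_mem_iff[OF f] app_eq_ap[OF f] by auto
      finally show ?thesis .
    qed
    then show ?thesis using M[OF \<kappa>M] by blast
  qed
  have "regular_cardinal E M \<kappa>"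
    unfolding regular_cardinal_def
  proof (intro conjI cM lM notI)
    assume "\<exists>a\<in>M. a \<epsilon> \<kappa> & (\<exists>f\<in>M. is_fun E M f a \<kappa> &
      (\<forall>b\<in>M. b \<epsilon> \<kappa> --> (\<exists>x\<in>M. \<exists>y\<in>M. x \<epsilon> a & maps_to E M f x y & (b = y | b \<epsilon> y))))"
    then obtain a f where a: "a \<in> M" "a \<epsilon> \<kappa>" and f: "f \<in> M" "is_fun E M f a \<kappa>"
      and c: "\<forall>b\<in>M. b \<epsilon> \<kappa> --> (\<exists>x\<in>M. \<exists>y\<in>M. x \<epsilon> a & maps_to E M f x y & (b = y | b \<epsilon> y))"
      by blast
    have fn: "func f a \<kappa>" using is_fun_absolute[OF tM f(1) a(1) \<kappa>M] f(2) by simp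
    have "f \<in> OD {x. x \<epsilon> V \<kappa>}" using f(1) HOD_OD unfolding M_def Vset_eq[OF o] by blast
    from OD_not_cofinal[OF this a(2) fn] cof[OF f(1) fn] c show False by blast
  qed
  moreover have "M ~= UNIV"
  proof
    assume MU: "M = UNIV"
    obtain f where f: "func f \<omega> \<kappa>" "\<forall>b. b \<epsilon> \<kappa> --> (\<exists>n. n \<epsilon> \<omega> & b \<epsilon> succ (ap f n))"
      using ex_cofinal_omega by blast
    have "f \<in> OD {x. x \<epsilon> V \<kappa>}" using HOD_OD[of f] MU unfolding M_def Vset_eq[OF o] by blast
    from OD_not_cofinal[OF this omega_mem f(1)] f(2) show False by blast
  qed
  ultimately show ?thesis using \<kappa>M by blast
qed

end

theorem theorem2p10:
  fixes E :: "'a \<Rightarrow> 'a \<Rightarrow> bool" and \<kappa> :: 'a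
  assumes "ZFC E"
    and "exacting E \<kappa>"
  defines "M \<equiv> HOD E {x. E x (Vset E \<kappa>)}"
  shows "(\<kappa> \<in> M \<and> regular_cardinal E M \<kappa>) \<and> M \<noteq> UNIV"
  unfolding M_def by (rule ZFC.HOD_regular[OF assms(1,2)])

end
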